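(* Let $d\ge 1$, let $V:\mathbb{R}^d\to[0,\infty)$ be Borel measurable and locally bounded, and suppose there are constants $C_1,C_2>0$ and $g\in\mathcal{G}$ such that $C_1g(|x|)\le V(x)\le C_2g(|x|)$ for all $x\in\mathbb{R}^d$ with $|x|>1$. Let $p(t,x,y)$ be the heat kernel of the Schrödinger semigroup $\{T_t^V\}_{t\ge0}$ and let $G(x,y)=\int_0^\infty p(t,x,y)\,dt$ be the associated Green's function. Write $M(x,y)=\max\{g(|x|),g(|y|)\}$ and $$\Phi(x,y)=\begin{cases}1,& d\ge3,\\ \max\left\{\log\left(\frac{1}{|x-y|\sqrt{M(x,y)}}\right),1\right\},& d=2,\\ \frac{1}{|x-y|\sqrt{M(x,y)}},& d=1.\end{cases}$$ Then there exist constants $c_1,c_2,c_3,c_4>0$ such that for all $x,y\in\mathbb{R}^d$, $$c_1|x-y|^{-(d-2)}e^{-c_2|x-y|\sqrt{M(x,y)}}\,\Phi(x,y)\le G(x,y)\le c_3|x-y|^{-(d-2)}e^{-c_4|x-y|\sqrt{M(x,y)}}\,\Phi(x,y).$$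
   Context: $\mathcal{G}$ is the class of nondecreasing functions $g:[0,\infty)\to[1,\infty)$ with $\lim_{r\to\infty}g(r)=\infty$ for which there is a constant $c_0>0$ with $g(2r)\le c_0g(r)$ for all $r\ge0$. Locally bounded means bounded on compact sets. $\{B_t\}_{t\ge0}$ is the standard Brownian motion on $\mathbb{R}^d$, with $\mathbb{P}_x,\mathbb{E}_x$ the probability and expectation when it starts at $x$. The Schrödinger semigroup of $\mathcal{L}^V=-\frac12\Delta+V$ is $$T_t^Vf(x)=\mathbb{E}_x\left[f(B_t)\exp\left(-\int_0^tV(B_s)\,ds\right)\right],\quad f\in C_b(\mathbb{R}^d).$$ Its heat kernel is the (existing) jointly continuous function $p:(0,\infty)\times\mathbb{R}^d\times\mathbb{R}^d\to[0,\infty)$ with $T_t^Vf(x)=\int_{\mathbb{R}^d}p(t,x,y)f(y)\,dy$ for all $f\in C_b(\mathbb{R}^d)$, $t>0$, $x\in\mathbb{R}^d$; it satisfies $p(t,x,y)=p(t,y,x)$. Convention on the diagonal $x=y$: for $d\ge2$ both sides are read as $+\infty$; for $d=1$ the product $|x-y|^{-(d-2)}\Phi(x,y)=|x-y|\cdot\frac{1}{|x-y|\sqrt{M(x,y)}}$ is read as $\frac{1}{\sqrt{M(x,y)}}$. *)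

theory Defs
  imports "HOL-Probability.Probability"
begin

text \<open>
  The Euclidean space of dimension \<open>d \<ge> 1\<close> is a type of class \<^class>\<open>euclidean_space\<close>,
  with \<open>d = DIM('a)\<close>.
\<close>

definition brownian_motion_from ::
  "'a::euclidean_space \<Rightarrow> 'w measure \<Rightarrow> (real \<Rightarrow> 'w \<Rightarrow> 'a) \<Rightarrow> bool" where
  "brownian_motion_from x M B \<longleftrightarrow>
     prob_space M \<and>
     (\<forall>t\<ge>0. B t \<in> borel_measurable M) \<and>
     (AE \<omega> in M. B 0 \<omega> = x) \<and>
     (\<forall>s t. 0 \<le> s \<and> s < t \<longrightarrow>
        distributed M lborel (\<lambda>\<omega>. B t \<omega> - B s \<omega>)
          (\<lambda>z. ennreal (\<Prod>b\<in>Basis. normal_density 0 (sqrt (t - s)) (z \<bullet> b)))) \<and>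
     (\<forall>(n::nat) (\<tau>::nat \<Rightarrow> real). 0 \<le> \<tau> 0 \<and> (\<forall>i<n. \<tau> i < \<tau> (Suc i)) \<longrightarrow>
        prob_space.indep_vars M (\<lambda>_. borel) (\<lambda>i \<omega>. B (\<tau> (Suc i)) \<omega> - B (\<tau> i) \<omega>) {..<n}) \<and>
     (\<forall>\<omega>\<in>space M. continuous_on {0..} (\<lambda>t. B t \<omega>))"

text \<open>
  \<open>P x\<close> is the probability measure under which the process \<open>B\<close> starts at \<open>x\<close>.
\<close>

definition brownian_family ::
  "('a::euclidean_space \<Rightarrow> 'w measure) \<Rightarrow> (real \<Rightarrow> 'w \<Rightarrow> 'a) \<Rightarrow> bool" where
  "brownian_family P B \<longleftrightarrow> (\<forall>x. brownian_motion_from x (P x) B)"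

definition schrodinger_semigroup ::
  "('a::euclidean_space \<Rightarrow> 'w measure) \<Rightarrow> (real \<Rightarrow> 'w \<Rightarrow> 'a) \<Rightarrow> ('a \<Rightarrow> real) \<Rightarrow>
   real \<Rightarrow> ('a \<Rightarrow> real) \<Rightarrow> 'a \<Rightarrow> real" where
  "schrodinger_semigroup P B V t f x =
     prob_space.expectation (P x)
       (\<lambda>\<omega>. f (B t \<omega>) * exp (- (LBINT s:{0..t}. V (B s \<omega>))))"

text \<open>
  The values of \<open>p t x y\<close> for \<open>t \<le> 0\<close> are unconstrained and never used.
\<close>

definition is_heat_kernel ::
  "(real \<Rightarrow> ('a::euclidean_space \<Rightarrow> real) \<Rightarrow> 'a \<Rightarrow> real) \<Rightarrow> (real \<Rightarrow> 'a \<Rightarrow> 'a \<Rightarrow> real) \<Rightarrow> bool" where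
  "is_heat_kernel T p \<longleftrightarrow>
     continuous_on ({0<..} \<times> UNIV \<times> UNIV) (\<lambda>(t, x, y). p t x y) \<and>
     (\<forall>t>0. \<forall>x y. 0 \<le> p t x y) \<and>
     (\<forall>t>0. \<forall>x f. continuous_on UNIV f \<and> bounded (range f) \<longrightarrow>
        has_bochner_integral lborel (\<lambda>y. p t x y * f y) (T t f x))"

text \<open>
  Extended-valued, since the integral diverges on the diagonal when \<open>d \<ge> 2\<close>.
\<close>

definition green_function ::
  "(real \<Rightarrow> 'a::euclidean_space \<Rightarrow> 'a \<Rightarrow> real) \<Rightarrow> 'a \<Rightarrow> 'a \<Rightarrow> ennreal" where
  "green_function p x y = (\<integral>\<^sup>+ t\<in>{0<..}. ennreal (p t x y) \<partial>lborel)"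

definition locally_bounded :: "('a::euclidean_space \<Rightarrow> real) \<Rightarrow> bool" where
  "locally_bounded V \<longleftrightarrow> (\<forall>K. compact K \<longrightarrow> bounded (V ` K))"

text \<open>
  A function on \<open>[0, \<infinity>)\<close> is represented by a total function whose values at
  negative arguments are irrelevant.
\<close>

definition growth_class :: "(real \<Rightarrow> real) set" where
  "growth_class = {g. (\<forall>r\<ge>0. 1 \<le> g r) \<and> mono_on {0..} g \<and> filterlim g at_top at_top \<and>
     (\<exists>c\<^sub>0>0. \<forall>r\<ge>0. g (2 * r) \<le> c\<^sub>0 * g r)}"

definition max_growth :: "(real \<Rightarrow> real) \<Rightarrow> 'a::euclidean_space \<Rightarrow> 'a \<Rightarrow> real" where
  "max_growth g x y = max (g (norm x)) (g (norm y))"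

definition Phi :: "(real \<Rightarrow> real) \<Rightarrow> 'a::euclidean_space \<Rightarrow> 'a \<Rightarrow> real" where
  "Phi g x y =
     (if DIM('a) \<ge> 3 then 1
      else if DIM('a) = 2 then max (ln (1 / (norm (x - y) * sqrt (max_growth g x y)))) 1
      else 1 / (norm (x - y) * sqrt (max_growth g x y)))"

text \<open>
  The two-sided bound without its leading constant. On the diagonal it is \<open>\<infinity>\<close> for
  \<open>d \<ge> 2\<close>; for \<open>d = 1\<close> the factors \<open>norm (x - y)\<close> and \<open>1 / norm (x - y)\<close> are
  cancelled first, and the exponential equals 1.
\<close>

definition green_bound ::
  "(real \<Rightarrow> real) \<Rightarrow> real \<Rightarrow> 'a::euclidean_space \<Rightarrow> 'a \<Rightarrow> ennreal" where
  "green_bound g c x y =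
     (if x = y then (if DIM('a) \<ge> 2 then \<infinity> else ennreal (1 / sqrt (max_growth g x y)))
      else ennreal (norm (x - y) powr (- (real DIM('a) - 2)) *
             exp (- c * norm (x - y) * sqrt (max_growth g x y)) * Phi g x y))"

end

theory Submission
  imports Defs
begin

text \<open>
  Conditionally on \<open>B\<^sub>0 = x\<close> and \<open>B\<^sub>t = y\<close> the position at time \<open>s\<close> is Gaussian with mean
  \<open>x + (s / t) (y - x)\<close> and variance \<open>s (t - s) / t\<close>, and both bounds come from applying Jensen's
  inequality to this bridge; neither the Markov property nor the symmetry of \<open>p\<close> is needed.
  Write \<open>R = max |x| |y| 1\<close> and \<open>p\<^sub>0\<close> for the free heat kernel.

  Lower bound: by convexity of \<open>exp\<close> the kernel is at least \<open>p\<^sub>0\<close> times the exponential of minus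
  the mean of \<open>\<integral> V(B\<^sub>s) ds\<close> under the bridge, which for \<open>t \<le> 4 R\<^sup>2\<close> is at most \<open>C M t\<close> by doubling.

  Upper bound: by Jensen in the time variable, \<open>exp (- \<integral> V(B\<^sub>s) ds)\<close> over an interval of length \<open>\<tau>\<close> is
  at most the average of \<open>exp (- \<tau> V(B\<^sub>s))\<close>. With \<open>\<tau> = min (t / 10) (R / sqrt M)\<close> and the interval adjacent
  to the endpoint of larger norm this gives \<open>p \<le> C p\<^sub>0 (exp (- c M t) + exp (- c R sqrt M))\<close>. With two
  disjoint intervals of length \<open>t / 5\<close> it gives \<open>p \<le> C t\<^bsup>-3/2\<^esup>\<close> for \<open>t \<ge> 1\<close>, which makes the second
  term integrable in time also for \<open>d \<le> 2\<close>.
\<close>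

section \<open>Gaussian densities\<close>

text \<open>Up to constants, |x-y| sqrt M is the minimum over t of the cost |x-y|^2 / t + M t,
  attained at t = |x-y| / sqrt M. This is why times up to order R^2 suffice for the lower bound:
  they contain this t, and 1 / M as well. In the upper bound, killing at rate M is guaranteed only
  near the far endpoint. At time R / sqrt M the cost of leaving that region, R^2 / t, equals the
  cost M t of staying, so a longer window gains nothing and the term exp (- c R sqrt M) remains. Its
  size is harmless since |x-y| <= 2 R, and the difficulty is its behaviour for large t. There it is
  interpolated with the polynomial decay, which costs three quarters of the rate. The kernel is
  given only through integrals against bounded continuous functions, so no conditional law is ever
  constructed: every bridge estimate is an inequality between integrals for all test functions
  supported near y, and continuity of the kernel makes it pointwise.\<close>

definition gauss :: "real \<Rightarrow> 'a::euclidean_space \<Rightarrow> 'a \<Rightarrow> real" where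
  "gauss t x y = (2 * pi * t) powr (- (real DIM('a) / 2)) * exp (- (norm (x - y))\<^sup>2 / (2 * t))"

lemma gauss_nonneg [simp]: "0 \<le> gauss t x y"
  by (simp add: gauss_def)

lemma gauss_translate: "gauss t x (x + z) = gauss t 0 z"
  by (simp add: gauss_def)

lemma borel_measurable_gauss [measurable]:
  assumes [measurable]: "f \<in> borel_measurable N" "h \<in> borel_measurable N" "k \<in> borel_measurable N"
  shows "(\<lambda>\<omega>. gauss (f \<omega>) (h \<omega>) (k \<omega> :: 'a::euclidean_space)) \<in> borel_measurable N"
  unfolding gauss_def by measurable

lemma continuous_on_gauss: "continuous_on UNIV (gauss t (x::'a::euclidean_space))"
proof (cases "t = 0")
  \<comment> \<open>\<open>0 powr a = 0\<close>, so at \<open>t = 0\<close> the function is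
    constantly 0.\<close>
  case True then show ?thesis by (simp add: gauss_def[abs_def])
next
  case False then show ?thesis unfolding gauss_def[abs_def] by (intro continuous_intros) auto
qed

lemma prod_normal_density_eq_gauss:
  assumes "0 < t"
  shows "(\<Prod>b\<in>Basis. normal_density 0 (sqrt t) ((z::'a::euclidean_space) \<bullet> b)) = gauss t 0 z"
proof -
  have "(\<Prod>b\<in>Basis. normal_density 0 (sqrt t) (z \<bullet> b)) =
        (\<Prod>b\<in>(Basis::'a set). (2 * pi * t) powr (- (1/2)) * exp (- (z \<bullet> b)\<^sup>2 / (2 * t)))"
    using assms by (intro prod.cong refl)
      (simp add: normal_density_def powr_minus powr_half_sqrt field_simps)
  also have "\<dots> = ((2 * pi * t) powr (- (1/2))) ^ DIM('a) * exp (\<Sum>b\<in>(Basis::'a set). - (z \<bullet> b)\<^sup>2 / (2 * t))"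
    by (simp add: prod.distrib exp_sum)
  also have "((2 * pi * t) powr (- (1/2))) ^ DIM('a) = (2 * pi * t) powr (- (real DIM('a) / 2))"
    using assms by (simp add: powr_power)
  also have "(\<Sum>b\<in>(Basis::'a set). - (z \<bullet> b)\<^sup>2 / (2 * t)) = - (norm z)\<^sup>2 / (2 * t)"
  proof -
    have "(norm z)\<^sup>2 = (\<Sum>b\<in>Basis. (z \<bullet> b)\<^sup>2)"
      by (subst power2_norm_eq_inner, subst euclidean_inner) (simp add: power2_eq_square)
    then show ?thesis by (simp add: sum_negf sum_divide_distrib)
  qed
  finally show ?thesis by (simp add: gauss_def)
qed

lemma nn_integral_lborel_translate:
  fixes c :: "'a::euclidean_space"
  assumes [measurable]: "f \<in> borel_measurable borel"
  shows "(\<integral>\<^sup>+w. f (c + w) \<partial>lborel) = (\<integral>\<^sup>+w. f w \<partial>lborel)"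
proof -
  have "(\<integral>\<^sup>+w. f w \<partial>lborel) = (\<integral>\<^sup>+w. f w \<partial>distr lborel borel ((+) c))"
    by (simp add: lborel_distr_plus)
  also have "\<dots> = (\<integral>\<^sup>+w. f (c + w) \<partial>lborel)"
    by (subst nn_integral_distr) auto
  finally show ?thesis ..
qed

lemma nn_integral_gauss:
  assumes "0 < t"
  shows "(\<integral>\<^sup>+w. ennreal (gauss t (x::'a::euclidean_space) w) \<partial>lborel) = 1"
proof -
  have one: "(\<integral>\<^sup>+y. ennreal (normal_density 0 (sqrt t) y) \<partial>lborel) = 1"
    using prob_space.emeasure_space_1[OF prob_space_normal_density[of "sqrt t" 0]] assms
    by (simp add: emeasure_density)
  have "(\<integral>\<^sup>+w. ennreal (gauss t x w) \<partial>lborel) = (\<integral>\<^sup>+w. ennreal (gauss t x (x + w)) \<partial>lborel)"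
    by (subst nn_integral_lborel_translate) auto
  also have "\<dots> = (\<integral>\<^sup>+w. (\<Prod>b\<in>Basis. ennreal (normal_density 0 (sqrt t) ((w::'a) \<bullet> b))) \<partial>lborel)"
    using assms by (intro nn_integral_cong)
      (simp add: gauss_translate prod_normal_density_eq_gauss[symmetric] prod_ennreal)
  also have "\<dots> = 1"
    by (subst nn_integral_lborel_prod) (auto simp: one)
  finally show ?thesis .
qed

text \<open>Completing the square in \<open>w\<close>. The second factor on the right is the law at
  time \<open>s\<close> of the Brownian bridge from \<open>x\<close> to \<open>z\<close>, so the
  identity disintegrates the joint law of the positions at times \<open>s\<close> and
  \<open>t\<close> over the later one.\<close>

lemma gauss_bridge:
  fixes x z w :: "'a::euclidean_space"
  assumes "0 < s" "s < t"
  shows "gauss s x w * gauss (t - s) w z =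
         gauss t x z * gauss (s * (t - s) / t) (x + (s / t) *\<^sub>R (z - x)) w"
proof -
  define u where "u = t - s"
  have u: "0 < u" "t = s + u" "0 < t" using assms by (auto simp: u_def)
  define a b where "a = w - x" and "b = z - x"
  have e1: "(norm (x - w))\<^sup>2 = a \<bullet> a" "(norm (x - z))\<^sup>2 = b \<bullet> b"
    by (simp_all add: a_def b_def dot_square_norm norm_minus_commute)
  have e2: "(norm (w - z))\<^sup>2 = a \<bullet> a - 2 * (a \<bullet> b) + b \<bullet> b"
    by (simp add: a_def b_def power2_norm_eq_inner algebra_simps inner_commute)
  have e3: "(norm (x + (s / t) *\<^sub>R (z - x) - w))\<^sup>2 = (s/t)^2 * (b \<bullet> b) - 2 * (s/t) * (a \<bullet> b) + a \<bullet> a"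
  proof -
    have "x + (s / t) *\<^sub>R (z - x) - w = (s/t) *\<^sub>R b - a" by (simp add: a_def b_def algebra_simps)
    then show ?thesis
      by (simp only: power2_norm_eq_inner) (simp add: inner_diff_left inner_diff_right inner_commute power2_eq_square algebra_simps)
  qed
  have ex: "- (norm (x - w))\<^sup>2 / (2 * s) + - (norm (w - z))\<^sup>2 / (2 * u) =
     - (norm (x - z))\<^sup>2 / (2 * t) + - (norm (x + (s / t) *\<^sub>R (z - x) - w))\<^sup>2 / (2 * (s * u / t))"
    unfolding e1 e2 e3 using assms(1) u(1,3)
    by (simp add: divide_simps u(2)) algebra
  have pre: "(2 * pi * s) powr q * (2 * pi * u) powr q = (2 * pi * t) powr q * (2 * pi * (s * u / t)) powr q" for q
    using assms(1) u(1,3) by (simp add: powr_mult[symmetric] field_simps)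
  show ?thesis
    unfolding gauss_def u_def[symmetric]
    using pre ex by (simp add: mult_exp_exp algebra_simps flip: exp_add)
qed

text \<open>The weight takes away half of the Gaussian exponent, which leaves 2^(d/2) times the
  density of variance \<open>2 * v\<close>. So a function dominated by the weight has a Gaussian
  mean bounded uniformly in \<open>m\<close> and \<open>v\<close>; both estimates of the potential
  under a bridge rest on this.\<close>

lemma nn_integral_gauss_tilt:
  fixes m :: "'a::euclidean_space"
  assumes "0 < v"
  shows "(\<integral>\<^sup>+w. ennreal (gauss v m w * exp ((norm (w - m))\<^sup>2 / (4 * v))) \<partial>lborel) = ennreal (2 powr (real DIM('a) / 2))"
proof -
  have "gauss v m w * exp ((norm (w - m))\<^sup>2 / (4 * v)) = 2 powr (real DIM('a) / 2) * gauss (2 * v) m w" for w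
  proof -
    have "(2 * pi * v) powr (- (real DIM('a) / 2)) = 2 powr (real DIM('a) / 2) * (2 * pi * (2 * v)) powr (- (real DIM('a) / 2))"
      using assms by (simp add: powr_mult powr_minus field_simps flip: powr_add)
    moreover have "- (norm (m - w))\<^sup>2 / (2 * v) + (norm (w - m))\<^sup>2 / (4 * v) = - (norm (m - w))\<^sup>2 / (2 * (2 * v))"
      using assms by (simp add: norm_minus_commute field_simps)
    ultimately show ?thesis
      unfolding gauss_def by (simp add: mult_exp_exp mult.assoc flip: exp_add)
  qed
  then show ?thesis
    using assms by (simp add: ennreal_mult' nn_integral_cmult nn_integral_gauss)
qed

lemma gauss_le: "0 < t \<Longrightarrow> gauss t (x::'a::euclidean_space) y \<le> (2 * pi * t) powr (- (real DIM('a) / 2))"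
  unfolding gauss_def by (rule mult_left_le) auto

section \<open>Finite-dimensional laws of Brownian motion\<close>

text \<open>Time is rounded down to multiples of 1 / (n + 1), and continuity of the paths gives the
  limit. \<open>max s 0\<close> keeps to the times at which the process is controlled.\<close>

lemma borel_measurable_continuous_path:
  fixes B :: "real \<Rightarrow> 'w \<Rightarrow> 'a::euclidean_space"
  assumes B: "\<And>t. 0 \<le> t \<Longrightarrow> B t \<in> borel_measurable M"
    and cont: "\<And>\<omega>. \<omega> \<in> space M \<Longrightarrow> continuous_on {0..} (\<lambda>t. B t \<omega>)"
  shows "(\<lambda>(s, \<omega>). B (max s 0) \<omega>) \<in> borel_measurable (borel \<Otimes>\<^sub>M M)"
proof -
  define k where "k n s = nat \<lfloor>real (Suc n) * max s 0\<rfloor>" for n :: nat and s :: real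
  define q where "q n s = real (k n s) / real (Suc n)" for n s
  show ?thesis
  proof (rule borel_measurable_LIMSEQ_metric[where f="\<lambda>n z. B (q n (fst z)) (snd z)"])
    fix n
    have "(\<lambda>z. B (real (k n (fst z)) / real (Suc n)) (snd z)) \<in> borel_measurable (borel \<Otimes>\<^sub>M M)"
    \<comment> \<open>The rounded time takes countably many values, so the rounded process is pieced
      together from countably many measurable maps.\<close>
    proof (rule measurable_compose_countable[where f="\<lambda>i z. B (real i / real (Suc n)) (snd z)" and g="\<lambda>z. k n (fst z)"])
      show "(\<lambda>z. k n (fst z)) \<in> measurable (borel \<Otimes>\<^sub>M M) (count_space UNIV)"
        unfolding k_def by measurable
      show "(\<lambda>z. B (real i / real (Suc n)) (snd z)) \<in> borel_measurable (borel \<Otimes>\<^sub>M M)" for i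
        by (rule measurable_compose[OF measurable_snd B]) simp
    qed
    then show "(\<lambda>z. B (q n (fst z)) (snd z)) \<in> borel_measurable (borel \<Otimes>\<^sub>M M)"
      by (simp add: q_def)
  next
    fix z :: "real \<times> 'w" assume "z \<in> space (borel \<Otimes>\<^sub>M M)"
    then have sp: "snd z \<in> space M" by (auto simp: space_pair_measure)
    define s where "s = max (fst z) 0"
    have s: "0 \<le> s" by (simp add: s_def)
    have up: "q n (fst z) \<le> s" for n
    proof -
      have "real (k n (fst z)) \<le> real (Suc n) * s"
        unfolding k_def s_def[symmetric] using s by (intro of_nat_floor) simp
      then show ?thesis by (simp add: q_def field_simps)
    qed
    have lo: "s - 1 / real (Suc n) \<le> q n (fst z)" for n
    proof -
      have "real (Suc n) * s - 1 \<le> real (k n (fst z))"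
        unfolding k_def s_def[symmetric] by linarith
      then have "(real (Suc n) * s - 1) / real (Suc n) \<le> q n (fst z)"
        unfolding q_def by (intro divide_right_mono) auto
      then show ?thesis by (simp add: diff_divide_distrib del: of_nat_Suc)
    qed
    have lim: "(\<lambda>n. q n (fst z)) \<longlonglongrightarrow> s"
    proof (rule tendsto_sandwich[OF _ _ _ tendsto_const])
      show "(\<lambda>n. s - 1 / real (Suc n)) \<longlonglongrightarrow> s"
        using tendsto_diff[OF tendsto_const LIMSEQ_inverse_real_of_nat, of s] by (simp add: inverse_eq_divide)
    qed (auto simp only: up lo intro!: always_eventually)
    have "(\<lambda>n. B (q n (fst z)) (snd z)) \<longlonglongrightarrow> B s (snd z)"
      by (rule continuous_on_tendsto_compose[OF cont[OF sp] lim]) (use s in \<open>auto simp: q_def\<close>)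
    then show "(\<lambda>n. B (q n (fst z)) (snd z)) \<longlonglongrightarrow> (case z of (s, \<omega>) \<Rightarrow> B (max s 0) \<omega>)"
      by (simp add: s_def split_beta)
  qed
qed

text \<open>Independence makes the joint law of the increments a product measure, so functionals of
  finitely many positions become iterated integrals.\<close>

lemma brownian_increments_law:
  fixes B :: "real \<Rightarrow> 'w \<Rightarrow> 'a::euclidean_space"
  assumes bm: "brownian_motion_from x M B"
    and \<tau>: "0 \<le> \<tau> 0" "\<And>i. i < n \<Longrightarrow> \<tau> i < \<tau> (Suc i)" and n: "0 < (n::nat)"
    and F: "F \<in> borel_measurable (\<Pi>\<^sub>M i\<in>{..<n}. borel)"
  shows "(\<integral>\<^sup>+\<omega>. F (\<lambda>i\<in>{..<n}. B (\<tau> (Suc i)) \<omega> - B (\<tau> i) \<omega>) \<partial>M) =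
    (\<integral>\<^sup>+v. F v \<partial>(\<Pi>\<^sub>M i\<in>{..<n}. density lborel (\<lambda>z. ennreal (gauss (\<tau> (Suc i) - \<tau> i) (0::'a) z))))"
proof -
  interpret prob_space M using bm by (simp add: brownian_motion_from_def)
  define X where "X i \<omega> = B (\<tau> (Suc i)) \<omega> - B (\<tau> i) \<omega>" for i \<omega>
  have \<tau>0: "0 \<le> \<tau> i" if "i \<le> n" for i
    using that
  proof (induction i)
    case (Suc i) then show ?case using \<tau>(2)[of i] by auto
  qed (use \<tau> in auto)
  have B: "B t \<in> borel_measurable M" if "0 \<le> t" for t
    using bm that by (simp add: brownian_motion_from_def)
  have X[measurable]: "X i \<in> borel_measurable M" if "i < n" for i
    unfolding X_def using that by (intro borel_measurable_diff) (auto intro!: \<tau>0 B)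
  have law: "distr M borel (X i) = density lborel (\<lambda>z. ennreal (gauss (\<tau> (Suc i) - \<tau> i) 0 z))" if "i < n" for i
  proof -
    have "distributed M lborel (X i)
        (\<lambda>z. ennreal (\<Prod>b\<in>Basis. normal_density 0 (sqrt (\<tau> (Suc i) - \<tau> i)) (z \<bullet> b)))"
      unfolding X_def using bm \<tau>(2)[OF that] \<tau>0[of i] that
      by (simp add: brownian_motion_from_def)
    then have "distr M lborel (X i) =
        density lborel (\<lambda>z. ennreal (\<Prod>b\<in>Basis. normal_density 0 (sqrt (\<tau> (Suc i) - \<tau> i)) (z \<bullet> b)))"
      by (rule distributed_distr_eq_density)
    moreover have "distr M lborel (X i) = distr M borel (X i)" by (rule distr_cong) auto
    ultimately show ?thesis
      using \<tau>(2)[OF that] by (simp add: prod_normal_density_eq_gauss)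
  qed
  have indep: "indep_vars (\<lambda>_. borel) X {..<n}"
    unfolding X_def using bm \<tau> by (simp add: brownian_motion_from_def)
  have "(\<integral>\<^sup>+\<omega>. F (\<lambda>i\<in>{..<n}. X i \<omega>) \<partial>M) =
        (\<integral>\<^sup>+v. F v \<partial>distr M (\<Pi>\<^sub>M i\<in>{..<n}. borel) (\<lambda>\<omega>. \<lambda>i\<in>{..<n}. X i \<omega>))"
    using F by (subst nn_integral_distr) (auto intro!: measurable_restrict)
  also have "distr M (\<Pi>\<^sub>M i\<in>{..<n}. borel) (\<lambda>\<omega>. \<lambda>i\<in>{..<n}. X i \<omega>) = (\<Pi>\<^sub>M i\<in>{..<n}. distr M borel (X i))"
    using indep n by (subst indep_vars_iff_distr_eq_PiM'[symmetric]) (auto simp: lessThan_empty_iff)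
  also have "\<dots> = (\<Pi>\<^sub>M i\<in>{..<n}. density lborel (\<lambda>z. ennreal (gauss (\<tau> (Suc i) - \<tau> i) 0 z)))"
    by (rule PiM_cong) (auto simp: law)
  finally show ?thesis unfolding X_def .
qed

lemma product_sigma_finite_gauss:
  "product_sigma_finite (\<lambda>i. density lborel (\<lambda>z. ennreal (gauss (u i) (0::'a::euclidean_space) z)))"
  unfolding product_sigma_finite_def
proof
  fix i
  show "sigma_finite_measure (density lborel (\<lambda>z. ennreal (gauss (u i) (0::'a) z)))"
    by (subst sigma_finite_measure.sigma_finite_iff_density_finite[OF sigma_finite_lborel]) auto
qed

lemma nn_integral_density_gauss_translate:
  fixes x :: "'a::euclidean_space" and f :: "'a \<Rightarrow> ennreal"
  assumes [measurable]: "f \<in> borel_measurable borel"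
  shows "(\<integral>\<^sup>+y. f (x + y) \<partial>density lborel (\<lambda>z. ennreal (gauss u 0 z))) = (\<integral>\<^sup>+w. gauss u x w * f w \<partial>lborel)"
proof -
  have "(\<integral>\<^sup>+y. f (x + y) \<partial>density lborel (\<lambda>z. ennreal (gauss u 0 z))) = (\<integral>\<^sup>+y. gauss u x (x + y) * f (x + y) \<partial>lborel)"
    by (subst nn_integral_density) (auto simp: gauss_translate)
  also have "\<dots> = (\<integral>\<^sup>+w. gauss u x w * f w \<partial>lborel)"
    by (subst nn_integral_lborel_translate) auto
  finally show ?thesis .
qed

text \<open>Positions are partial sums of independent increments, and translation turns increment
  densities into transition densities. The later position is the inner variable.\<close>

lemma brownian_law2:
  fixes B :: "real \<Rightarrow> 'w \<Rightarrow> 'a::euclidean_space" and F :: "'a \<Rightarrow> 'a \<Rightarrow> ennreal"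
  assumes bm: "brownian_motion_from x M B" and st: "0 < s" "s < t"
    and [measurable]: "(\<lambda>(w, z). F w z) \<in> borel_measurable (borel \<Otimes>\<^sub>M borel)"
  shows "(\<integral>\<^sup>+\<omega>. F (B s \<omega>) (B t \<omega>) \<partial>M) =
    (\<integral>\<^sup>+w. ennreal (gauss s x w) * (\<integral>\<^sup>+z. ennreal (gauss (t - s) w z) * F w z \<partial>lborel) \<partial>lborel)"
proof -
  define \<tau> where "\<tau> i = [0, s, t] ! i" for i
  define D where "D i = density lborel (\<lambda>z. ennreal (gauss (\<tau> (Suc i) - \<tau> i) (0::'a) z))" for i
  interpret product_sigma_finite D unfolding D_def by (rule product_sigma_finite_gauss)
  have [simp, measurable_cong]: "sets (D i) = sets borel" for i by (simp add: D_def)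
  have D0: "D 0 = density lborel (\<lambda>z. ennreal (gauss s 0 z))"
    and D1: "D 1 = density lborel (\<lambda>z. ennreal (gauss (t - s) 0 z))"
    by (simp_all add: D_def \<tau>_def)
  have I: "{..<2::nat} = insert 1 (insert 0 {})" by auto
  let ?F = "\<lambda>v::nat \<Rightarrow> 'a. F (x + v 0) (x + v 0 + v 1)"
  have m: "?F \<in> borel_measurable (Pi\<^sub>M {..<2} (\<lambda>_. borel))" by measurable
  have "(\<integral>\<^sup>+\<omega>. F (B s \<omega>) (B t \<omega>) \<partial>M) = (\<integral>\<^sup>+\<omega>. ?F (\<lambda>i\<in>{..<2}. B (\<tau> (Suc i)) \<omega> - B (\<tau> i) \<omega>) \<partial>M)"
  \<comment> \<open>The start at \<open>x\<close> is only almost sure.\<close>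
  proof (rule nn_integral_cong_AE)
    have "AE \<omega> in M. B 0 \<omega> = x" using bm by (simp add: brownian_motion_from_def)
    then show "AE \<omega> in M. F (B s \<omega>) (B t \<omega>) = ?F (\<lambda>i\<in>{..<2}. B (\<tau> (Suc i)) \<omega> - B (\<tau> i) \<omega>)"
      by eventually_elim (simp add: \<tau>_def)
  qed
  also have "\<dots> = (\<integral>\<^sup>+v. ?F v \<partial>Pi\<^sub>M {..<2} D)"
    unfolding D_def
    by (rule brownian_increments_law[OF bm _ _ _ m]) (use st in \<open>auto simp: \<tau>_def less_2_cases_iff\<close>)
  also have "\<dots> = (\<integral>\<^sup>+y. (\<integral>\<^sup>+y'. F (x + y) (x + y + y') \<partial>D 1) \<partial>D 0)"
  proof -
    have "?F \<in> borel_measurable (Pi\<^sub>M (insert 1 {0}) D)" by measurable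
    moreover have "(\<lambda>v. \<integral>\<^sup>+y'. F (x + v) (x + v + y') \<partial>D 1) \<in> borel_measurable (D 0)"
      by measurable
    ultimately show ?thesis
      unfolding I by (subst product_nn_integral_insert)
        (simp_all add: product_nn_integral_singleton[of "\<lambda>v. \<integral>\<^sup>+y'. F (x + v) (x + v + y') \<partial>D 1" 0, simplified])
  qed
  also have "\<dots> = (\<integral>\<^sup>+w. gauss s x w * (\<integral>\<^sup>+z. gauss (t - s) w z * F w z \<partial>lborel) \<partial>lborel)"
    unfolding D0 D1
    by (subst nn_integral_density_gauss_translate) (simp_all add: nn_integral_density_gauss_translate)
  finally show ?thesis .
qed

text \<open>The same reduction with two interior times, one for each of the disjoint windows in
  \<open>density_upper2\<close>.\<close>

lemma brownian_law3:
  fixes B :: "real \<Rightarrow> 'w \<Rightarrow> 'a::euclidean_space" and F :: "'a \<times> 'a \<times> 'a \<Rightarrow> ennreal"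
  assumes bm: "brownian_motion_from x M B" and st: "0 < r" "r < s" "s < t"
    and [measurable]: "F \<in> borel_measurable (borel \<Otimes>\<^sub>M borel \<Otimes>\<^sub>M borel)"
  shows "(\<integral>\<^sup>+\<omega>. F (B r \<omega>, B s \<omega>, B t \<omega>) \<partial>M) =
    (\<integral>\<^sup>+v. ennreal (gauss r x v) * (\<integral>\<^sup>+w. ennreal (gauss (s - r) v w) *
      (\<integral>\<^sup>+z. ennreal (gauss (t - s) w z) * F (v, w, z) \<partial>lborel) \<partial>lborel) \<partial>lborel)"
proof -
  define \<tau> where "\<tau> i = [0, r, s, t] ! i" for i
  define D where "D i = density lborel (\<lambda>z. ennreal (gauss (\<tau> (Suc i) - \<tau> i) (0::'a) z))" for i
  interpret product_sigma_finite D unfolding D_def by (rule product_sigma_finite_gauss)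
  have [simp, measurable_cong]: "sets (D i) = sets borel" for i by (simp add: D_def)
  have D0: "D 0 = density lborel (\<lambda>z. ennreal (gauss r 0 z))"
    and D1: "D 1 = density lborel (\<lambda>z. ennreal (gauss (s - r) 0 z))"
    and D2: "D 2 = density lborel (\<lambda>z. ennreal (gauss (t - s) 0 z))"
    by (simp_all add: D_def \<tau>_def numeral_2_eq_2)
  have I: "{..<3::nat} = insert 2 (insert 1 {0})" by auto
  let ?F = "\<lambda>v::nat \<Rightarrow> 'a. F (x + v 0, x + v 0 + v 1, x + v 0 + v 1 + v 2)"
  have m: "?F \<in> borel_measurable (Pi\<^sub>M {..<3} (\<lambda>_. borel))" by measurable
  have "(\<integral>\<^sup>+\<omega>. F (B r \<omega>, B s \<omega>, B t \<omega>) \<partial>M) = (\<integral>\<^sup>+\<omega>. ?F (\<lambda>i\<in>{..<3}. B (\<tau> (Suc i)) \<omega> - B (\<tau> i) \<omega>) \<partial>M)"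
  proof (rule nn_integral_cong_AE)
    have "AE \<omega> in M. B 0 \<omega> = x" using bm by (simp add: brownian_motion_from_def)
    then show "AE \<omega> in M. F (B r \<omega>, B s \<omega>, B t \<omega>) = ?F (\<lambda>i\<in>{..<3}. B (\<tau> (Suc i)) \<omega> - B (\<tau> i) \<omega>)"
      by eventually_elim (simp add: \<tau>_def numeral_2_eq_2)
  qed
  also have "\<dots> = (\<integral>\<^sup>+v. ?F v \<partial>Pi\<^sub>M {..<3} D)"
    unfolding D_def
    by (rule brownian_increments_law[OF bm _ _ _ m])
      (use st in \<open>auto simp: \<tau>_def numeral_3_eq_3 less_Suc_eq\<close>)
  also have "\<dots> = (\<integral>\<^sup>+y. (\<integral>\<^sup>+y'. (\<integral>\<^sup>+y''. F (x + y, x + y + y', x + y + y' + y'') \<partial>D 2) \<partial>D 1) \<partial>D 0)"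
  proof -
    have "?F \<in> borel_measurable (Pi\<^sub>M (insert 2 (insert 1 {0})) D)" by measurable
    moreover have "(\<lambda>v. \<integral>\<^sup>+y'. F (x + v 0, x + v 0 + v 1, x + v 0 + v 1 + y') \<partial>D 2) \<in> borel_measurable (Pi\<^sub>M (insert 1 {0}) D)"
      by measurable
    moreover have "(\<lambda>v. \<integral>\<^sup>+y. \<integral>\<^sup>+y'. F (x + v, x + v + y, x + v + y + y') \<partial>D 2 \<partial>D 1) \<in> borel_measurable (D 0)"
      by measurable
    ultimately show ?thesis
      unfolding I by (subst product_nn_integral_insert, (simp_all)[3], subst product_nn_integral_insert)
        (simp_all add: product_nn_integral_singleton[of "\<lambda>v. \<integral>\<^sup>+y. \<integral>\<^sup>+y'. F (x + v, x + v + y, x + v + y + y') \<partial>D 2 \<partial>D 1" 0, simplified])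
  qed
  also have "\<dots> = (\<integral>\<^sup>+v. gauss r x v * (\<integral>\<^sup>+w. gauss (s - r) v w * (\<integral>\<^sup>+z. gauss (t - s) w z * F (v, w, z) \<partial>lborel) \<partial>lborel) \<partial>lborel)"
  proof -
    have "(\<integral>\<^sup>+y''. F (v, w, w + y'') \<partial>D 2) = (\<integral>\<^sup>+z. gauss (t - s) w z * F (v, w, z) \<partial>lborel)" for v w
      unfolding D2 using nn_integral_density_gauss_translate[of "\<lambda>z. F (v, w, z)" "t - s" w] by simp
    then have "(\<integral>\<^sup>+y'. (\<integral>\<^sup>+y''. F (v, v + y', v + y' + y'') \<partial>D 2) \<partial>D 1) =
        (\<integral>\<^sup>+w. gauss (s - r) v w * (\<integral>\<^sup>+z. gauss (t - s) w z * F (v, w, z) \<partial>lborel) \<partial>lborel)" for v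
      unfolding D1
      using nn_integral_density_gauss_translate[of "\<lambda>w. \<integral>\<^sup>+z. gauss (t - s) w z * F (v, w, z) \<partial>lborel" "s - r" v]
      by simp
    then show ?thesis
      unfolding D0
      using nn_integral_density_gauss_translate[of
          "\<lambda>v. \<integral>\<^sup>+w. gauss (s - r) v w * (\<integral>\<^sup>+z. gauss (t - s) w z * F (v, w, z) \<partial>lborel) \<partial>lborel" r x]
      by simp
  qed
  finally show ?thesis .
qed

section \<open>Jensen's inequality in time and comparison by test functions\<close>

lemma set_nn_integral_eq_ennreal_set_integral:
  fixes w :: "real \<Rightarrow> real"
  assumes [measurable]: "w \<in> borel_measurable borel" and w0: "\<And>s. 0 \<le> w s"
    and N: "\<And>s. s \<in> {a..b} \<Longrightarrow> w s \<le> N"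
  shows "set_integrable lborel {a..b} w"
    and "(\<integral>\<^sup>+s\<in>{a..b}. ennreal (w s) \<partial>lborel) = ennreal (LBINT s:{a..b}. w s)"
proof -
  show i: "set_integrable lborel {a..b} w"
    unfolding set_integrable_def
    by (rule integrableI_bounded_set_indicator[where B=N]) (use w0 N in \<open>auto simp: emeasure_lborel_Icc_eq\<close>)
  show "(\<integral>\<^sup>+s\<in>{a..b}. ennreal (w s) \<partial>lborel) = ennreal (LBINT s:{a..b}. w s)"
    unfolding set_lebesgue_integral_def
    by (subst nn_integral_eq_integral[symmetric])
      (use i w0 in \<open>auto simp: set_integrable_def indicator_def intro!: nn_integral_cong\<close>)
qed

text \<open>Integrate the tangent inequality of \<open>exp\<close> at the mean of \<open>w\<close>.\<close>

lemma exp_set_integral_le: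
  fixes w :: "real \<Rightarrow> real"
  assumes [measurable]: "w \<in> borel_measurable borel" and w0: "\<And>s. 0 \<le> w s"
    and N: "\<And>s. s \<in> {a..b} \<Longrightarrow> w s \<le> N" and ab: "a < b"
  shows "ennreal (exp (- (LBINT s:{a..b}. w s))) \<le>
    ennreal (1 / (b - a)) * (\<integral>\<^sup>+s\<in>{a..b}. ennreal (exp (- (b - a) * w s)) \<partial>lborel)"
proof -
  define \<tau> where "\<tau> = b - a"
  define A where "A = (LBINT s:{a..b}. w s)"
  have \<tau>: "0 < \<tau>" using ab by (simp add: \<tau>_def)
  have i: "set_integrable lborel {a..b} w"
    by (rule set_nn_integral_eq_ennreal_set_integral(1)[OF _ w0 N]) auto
  have i2: "set_integrable lborel {a..b} (\<lambda>s. exp (- \<tau> * w s))"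
    by (rule set_nn_integral_eq_ennreal_set_integral(1)[where N=1]) (use \<tau> w0 in auto)
  have i1: "set_integrable lborel {a..b} (\<lambda>s. c::real)" for c
    unfolding set_integrable_def by (rule integrableI_bounded_set_indicator[where B="\<bar>c\<bar>"]) (auto simp: emeasure_lborel_Icc_eq)
  have c: "(LBINT s:{a..b}. (c::real)) = \<tau> * c" for c
    using ab by (simp add: set_lebesgue_integral_def \<tau>_def)
  have "(LBINT s:{a..b}. exp (- A) * (1 + A - \<tau> * w s)) \<le> (LBINT s:{a..b}. exp (- \<tau> * w s))"
  proof (rule set_integral_mono)
    show "set_integrable lborel {a..b} (\<lambda>s. exp (- A) * (1 + A - \<tau> * w s))"
      by (intro set_integrable_mult_right set_integral_diff i i1)
    show "exp (- A) * (1 + A - \<tau> * w s) \<le> exp (- \<tau> * w s)" for s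
    proof -
      have "exp (- A) * (1 + (A - \<tau> * w s)) \<le> exp (- A) * exp (A - \<tau> * w s)"
        by (intro mult_left_mono exp_ge_add_one_self) auto
      then show ?thesis by (simp add: mult_exp_exp algebra_simps)
    qed
  qed (rule i2)
  also have "(LBINT s:{a..b}. exp (- A) * (1 + A - \<tau> * w s)) = exp (- A) * \<tau>"
    by (subst set_integral_mult_right, subst set_integral_diff(2))
      (auto intro!: i1 i simp: c A_def[symmetric] algebra_simps)
  finally have "exp (- A) \<le> (1 / \<tau>) * (LBINT s:{a..b}. exp (- \<tau> * w s))"
    using \<tau> by (simp add: field_simps)
  then have "ennreal (exp (- A)) \<le> ennreal (1 / \<tau>) * ennreal (LBINT s:{a..b}. exp (- \<tau> * w s))"
    using \<tau> by (subst ennreal_mult'[symmetric]) (auto intro: ennreal_leI)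
  also have "ennreal (LBINT s:{a..b}. exp (- \<tau> * w s)) = (\<integral>\<^sup>+s\<in>{a..b}. ennreal (exp (- \<tau> * w s)) \<partial>lborel)"
    by (rule set_nn_integral_eq_ennreal_set_integral(2)[symmetric, where N=1]) (use \<tau> w0 in auto)
  finally show ?thesis by (simp add: A_def \<tau>_def)
qed

text \<open>If \<open>p y > q y\<close>, continuity separates the two functions by constants on a
  small ball, and a tent function on that ball contradicts \<open>le\<close>. As the tent lives in
  \<open>ball y \<delta>\<close>, callers need their estimates only for endpoints near
  \<open>y\<close>.\<close>

lemma le_if_integral_test_functions_le:
  fixes p q :: "'a::euclidean_space \<Rightarrow> real"
  assumes p: "continuous_on UNIV p" and q: "continuous_on UNIV q" and q0: "\<And>z. 0 \<le> q z"
    and \<delta>: "0 < \<delta>"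
    and le: "\<And>f. continuous_on UNIV f \<Longrightarrow> bounded (range f) \<Longrightarrow> (\<And>z. 0 \<le> f z) \<Longrightarrow>
      (\<And>z. z \<notin> ball y \<delta> \<Longrightarrow> f z = 0) \<Longrightarrow> (\<integral>\<^sup>+z. ennreal (f z) \<partial>lborel) < \<infinity> \<Longrightarrow>
      (\<integral>\<^sup>+z. ennreal (p z) * ennreal (f z) \<partial>lborel) \<le> (\<integral>\<^sup>+z. ennreal (q z) * ennreal (f z) \<partial>lborel)"
  shows "p y \<le> q y"
proof (rule ccontr)
  assume "\<not> p y \<le> q y"
  \<comment> \<open>Two levels give the strict gap \<open>c * I < d * I\<close> at the end, for
    which \<open>I\<close> has to be both positive and finite.\<close>
  then obtain c d where cd: "q y < c" "c < d" "d < p y" 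
    using dense[of "q y" "p y"] dense by (metis not_le)
  have [measurable]: "p \<in> borel_measurable borel" "q \<in> borel_measurable borel"
    using p q by (auto intro: borel_measurable_continuous_onI)
  have "open (q -` {..<c} \<inter> p -` {d<..})"
    using p q by (intro open_Int open_vimage) auto
  moreover have "y \<in> q -` {..<c} \<inter> p -` {d<..}" using cd by simp
  ultimately obtain e where "0 < e" "ball y e \<subseteq> q -` {..<c} \<inter> p -` {d<..}"
    by (rule openE)
  then have e: "0 < e" "\<And>z. z \<in> ball y e \<Longrightarrow> q z < c \<and> d < p z" by blast+
  define \<epsilon> where "\<epsilon> = min e \<delta>"
  have \<epsilon>: "0 < \<epsilon>" "\<epsilon> \<le> e" "\<epsilon> \<le> \<delta>" using e \<delta> by (auto simp: \<epsilon>_def)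
  define f where "f z = max 0 (\<epsilon> - dist y z)" for z
  have f: "continuous_on UNIV f" unfolding f_def by (intro continuous_intros)
  have [measurable]: "f \<in> borel_measurable borel" using f by (rule borel_measurable_continuous_onI)
  have f0: "0 \<le> f z" "f z \<le> \<epsilon>" for z using \<epsilon> by (auto simp: f_def)
  have out: "f z = 0" if "z \<notin> ball y \<epsilon>" for z using that by (auto simp: f_def)
  have bd: "bounded (range f)" using f0 by (intro boundedI[of _ \<epsilon>]) auto
  define I where "I = (\<integral>\<^sup>+z. ennreal (f z) \<partial>lborel)"
  have "I \<le> (\<integral>\<^sup>+z. ennreal \<epsilon> * indicator (ball y \<epsilon>) z \<partial>lborel)"
    unfolding I_def by (intro nn_integral_mono) (use out f0 in \<open>auto simp: indicator_def intro!: ennreal_leI\<close>)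
  also have "\<dots> < \<infinity>" using \<epsilon>
    by (simp add: nn_integral_cmult_indicator ennreal_mult_less_top emeasure_ball flip: ennreal_mult)
  finally have fin: "I < \<infinity>" .
  have "(\<integral>\<^sup>+z. ennreal (\<epsilon>/2) * indicator (ball y (\<epsilon>/2)) z \<partial>lborel) \<le> I"
    unfolding I_def by (intro nn_integral_mono) (auto simp: f_def indicator_def intro!: ennreal_leI)
  moreover have "0 < (\<integral>\<^sup>+z. ennreal (\<epsilon>/2) * indicator (ball y (\<epsilon>/2)) z \<partial>lborel)"
    using \<epsilon> unit_ball_vol_pos[of "real DIM('a)"]
    by (simp add: nn_integral_cmult_indicator emeasure_ball ennreal_zero_less_mult_iff)
  ultimately have pos: "0 < I" by (rule less_le_trans[rotated])
  have "ennreal d * I = (\<integral>\<^sup>+z. ennreal d * ennreal (f z) \<partial>lborel)" by (simp add: I_def nn_integral_cmult)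
  also have "\<dots> \<le> (\<integral>\<^sup>+z. ennreal (p z) * ennreal (f z) \<partial>lborel)"
  proof (rule nn_integral_mono)
    fix z show "ennreal d * ennreal (f z) \<le> ennreal (p z) * ennreal (f z)"
      using e(2)[of z] \<epsilon> out[of z] by (cases "z \<in> ball y \<epsilon>") (auto intro!: mult_right_mono ennreal_leI)
  qed
  also have "\<dots> \<le> (\<integral>\<^sup>+z. ennreal (q z) * ennreal (f z) \<partial>lborel)"
    using f bd f0 out \<epsilon> fin by (intro le) (auto simp: I_def)
  also have "\<dots> \<le> (\<integral>\<^sup>+z. ennreal c * ennreal (f z) \<partial>lborel)"
  proof (rule nn_integral_mono)
    fix z show "ennreal (q z) * ennreal (f z) \<le> ennreal c * ennreal (f z)"
      using e(2)[of z] \<epsilon> out[of z] by (cases "z \<in> ball y \<epsilon>") (auto intro!: mult_right_mono ennreal_leI)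
  qed
  also have "\<dots> = ennreal c * I" by (simp add: I_def nn_integral_cmult)
  also have "\<dots> < ennreal d * I"
    using cd q0[of y] fin pos by (intro ennreal_mult_strict_right_mono) (auto intro!: ennreal_lessI)
  finally show False by simp
qed

text \<open>Tonelli moves the endpoint integral outside and \<open>gauss_bridge\<close> factors the
  two transition densities. This replaces conditioning on \<open>B t\<close>: \<open>f\<close> tests
  the endpoint, and the inner integral is the bridge mean of \<open>h\<close>.\<close>

lemma brownian_bridge_law:
  fixes B :: "real \<Rightarrow> 'w \<Rightarrow> 'a::euclidean_space" and f h :: "'a \<Rightarrow> ennreal"
  assumes bm: "brownian_motion_from x M B" and st: "0 < s" "s < t"
    and [measurable]: "f \<in> borel_measurable borel" "h \<in> borel_measurable borel"
  shows "(\<integral>\<^sup>+\<omega>. f (B t \<omega>) * h (B s \<omega>) \<partial>M) =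
    (\<integral>\<^sup>+z. f z * ennreal (gauss t x z) *
      (\<integral>\<^sup>+w. h w * ennreal (gauss (s * (t - s) / t) (x + (s / t) *\<^sub>R (z - x)) w) \<partial>lborel) \<partial>lborel)"
proof -
  have "(\<integral>\<^sup>+\<omega>. f (B t \<omega>) * h (B s \<omega>) \<partial>M) =
    (\<integral>\<^sup>+w. ennreal (gauss s x w) * (\<integral>\<^sup>+z. ennreal (gauss (t - s) w z) * (f z * h w) \<partial>lborel) \<partial>lborel)"
    by (rule brownian_law2[OF bm st]) measurable
  also have "\<dots> = (\<integral>\<^sup>+w. \<integral>\<^sup>+z. ennreal (gauss s x w) * (ennreal (gauss (t - s) w z) * (f z * h w)) \<partial>lborel \<partial>lborel)"
    by (simp add: nn_integral_cmult)
  also have "\<dots> = (\<integral>\<^sup>+z. \<integral>\<^sup>+w. ennreal (gauss s x w) * (ennreal (gauss (t - s) w z) * (f z * h w)) \<partial>lborel \<partial>lborel)"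
    by (rule lborel_pair.Fubini') measurable
  also have "\<dots> = (\<integral>\<^sup>+z. \<integral>\<^sup>+w. f z * ennreal (gauss t x z) *
      (h w * ennreal (gauss (s * (t - s) / t) (x + (s / t) *\<^sub>R (z - x)) w)) \<partial>lborel \<partial>lborel)"
  proof (intro nn_integral_cong)
    fix z w
    have "ennreal (gauss s x w) * ennreal (gauss (t - s) w z) =
      ennreal (gauss t x z) * ennreal (gauss (s * (t - s) / t) (x + (s / t) *\<^sub>R (z - x)) w)"
      by (simp add: ennreal_mult[symmetric] gauss_bridge[OF st])
    then show "ennreal (gauss s x w) * (ennreal (gauss (t - s) w z) * (f z * h w)) = f z * ennreal (gauss t x z) *
      (h w * ennreal (gauss (s * (t - s) / t) (x + (s / t) *\<^sub>R (z - x)) w))"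
      by (simp only: mult.assoc[symmetric]) (simp only: mult_ac)
  qed
  also have "\<dots> = (\<integral>\<^sup>+z. f z * ennreal (gauss t x z) *
      (\<integral>\<^sup>+w. h w * ennreal (gauss (s * (t - s) / t) (x + (s / t) *\<^sub>R (z - x)) w) \<partial>lborel) \<partial>lborel)"
    by (simp add: nn_integral_cmult)
  finally show ?thesis .
qed

lemma brownian_law1:
  fixes B :: "real \<Rightarrow> 'w \<Rightarrow> 'a::euclidean_space" and f :: "'a \<Rightarrow> ennreal"
  assumes bm: "brownian_motion_from x M B" and t: "0 < t"
    and [measurable]: "f \<in> borel_measurable borel"
  shows "(\<integral>\<^sup>+\<omega>. f (B t \<omega>) \<partial>M) = (\<integral>\<^sup>+z. f z * ennreal (gauss t x z) \<partial>lborel)"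
  \<comment> \<open>The midpoint is an arbitrary interior time; the bridge mean of 1 is 1.\<close>
  using brownian_bridge_law[OF bm, of "t/2" t f "\<lambda>_. 1"] t by (simp add: nn_integral_gauss)

section \<open>Bounds for the density of the Feynman--Kac functional\<close>

text \<open>Time and starting point are frozen, and \<open>q\<close> stands for
  \<open>p t x\<close>. The only link between \<open>q\<close> and the process is
  \<open>q_int\<close>.\<close>

locale feynman_kac_density =
  fixes x :: "'a::euclidean_space" and M :: "'w measure" and B :: "real \<Rightarrow> 'w \<Rightarrow> 'a"
    and V :: "'a \<Rightarrow> real" and t :: real and q :: "'a \<Rightarrow> real"
  assumes bm: "brownian_motion_from x M B"
    and V0: "0 \<le> V w"
    and V_meas [measurable]: "V \<in> borel_measurable borel"
    and V_bd: "locally_bounded V"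
    and t: "0 < t"
    and q_cont: "continuous_on UNIV q"
    and q0: "0 \<le> q z"
    and q_int: "continuous_on UNIV f \<Longrightarrow> bounded (range f) \<Longrightarrow>
      has_bochner_integral lborel (\<lambda>y. q y * f y)
        (prob_space.expectation M (\<lambda>\<omega>. f (B t \<omega>) * exp (- (LBINT s:{0..t}. V (B s \<omega>)))))"

sublocale feynman_kac_density \<subseteq> prob_space M
  using bm by (simp add: brownian_motion_from_def)

context feynman_kac_density
begin

text \<open>\<open>max s 0\<close> makes the process jointly measurable on the whole real line and
  changes nothing on \<open>{0..t}\<close>.\<close>

definition W :: "real \<Rightarrow> 'w \<Rightarrow> real" where
  "W s \<omega> = V (B (max s 0) \<omega>)"

definition A :: "'w \<Rightarrow> real" where
  "A \<omega> = (LBINT s:{0..t}. W s \<omega>)"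

lemma A_eq: "A \<omega> = (LBINT s:{0..t}. V (B s \<omega>))"
  unfolding A_def W_def by (rule set_lebesgue_integral_cong) auto

lemma B_meas: "0 \<le> s \<Longrightarrow> B s \<in> borel_measurable M"
  using bm by (simp add: brownian_motion_from_def)

lemma B_t_meas [measurable]: "B t \<in> borel_measurable M"
  using t by (intro B_meas) auto

lemma B_cont: "\<omega> \<in> space M \<Longrightarrow> continuous_on {0..} (\<lambda>s. B s \<omega>)"
  using bm by (simp add: brownian_motion_from_def)

lemma W_meas_pair [measurable]: "(\<lambda>(s, \<omega>). W s \<omega>) \<in> borel_measurable (borel \<Otimes>\<^sub>M M)"
  using measurable_compose[OF borel_measurable_continuous_path[OF B_meas B_cont] V_meas]
  by (simp add: W_def split_beta)

lemma W_meas_time: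
  assumes "\<omega> \<in> space M" shows "(\<lambda>s. W s \<omega>) \<in> borel_measurable borel"
  using measurable_Pair1[OF W_meas_pair assms] by simp

lemma W0: "0 \<le> W s \<omega>" by (simp add: W_def V0)

text \<open>A path on \<open>{0..t}\<close> has compact image, where \<open>V\<close> is bounded.
  The bound depends on the path; it serves only integrability in time for a fixed \<omega>.\<close>

lemma W_bd:
  assumes "\<omega> \<in> space M" shows "\<exists>N. \<forall>s\<in>{0..t}. W s \<omega> \<le> N"
proof -
  have "compact ((\<lambda>s. B s \<omega>) ` {0..t})"
    by (intro compact_continuous_image continuous_on_subset[OF B_cont[OF assms]]) auto
  then have "bounded (V ` (\<lambda>s. B s \<omega>) ` {0..t})"
    using V_bd by (simp add: locally_bounded_def)
  then obtain N where "\<forall>v\<in>V ` (\<lambda>s. B s \<omega>) ` {0..t}. norm v \<le> N"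
    by (auto simp: bounded_iff)
  then show ?thesis by (intro exI[of _ N]) (auto simp: W_def)
qed

lemma W_set_integrable:
  assumes "\<omega> \<in> space M" "0 \<le> a" "b \<le> t"
  shows "set_integrable lborel {a..b} (\<lambda>s. W s \<omega>)"
proof -
  obtain N where "\<forall>s\<in>{0..t}. W s \<omega> \<le> N" using W_bd[OF assms(1)] by blast
  then show ?thesis
    using assms by (intro set_nn_integral_eq_ennreal_set_integral(1)[where N=N] W_meas_time W0) auto
qed

lemma nn_integral_W_eq:
  assumes "\<omega> \<in> space M"
  shows "(\<integral>\<^sup>+s\<in>{0..t}. ennreal (W s \<omega>) \<partial>lborel) = ennreal (A \<omega>)"
proof -
  obtain N where "\<forall>s\<in>{0..t}. W s \<omega> \<le> N" using W_bd[OF assms(1)] by blast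
  then show ?thesis unfolding A_def
    using assms by (intro set_nn_integral_eq_ennreal_set_integral(2)[where N=N] W_meas_time W0) auto
qed

lemma A0: "0 \<le> A \<omega>"
  unfolding A_def set_lebesgue_integral_def by (intro integral_nonneg_AE) (auto simp: W0)

lemma W_meas_swap [measurable]: "(\<lambda>(\<omega>, s). W s \<omega>) \<in> borel_measurable (M \<Otimes>\<^sub>M lborel)"
  using measurable_compose[OF measurable_pair_swap' W_meas_pair]
  by (simp add: split_beta cong: measurable_cong_sets)

lemma A_meas [measurable]: "A \<in> borel_measurable M"
proof -
  have "(\<lambda>\<omega>. \<integral>s. indicator {0..t} s *\<^sub>R W s \<omega> \<partial>lborel) \<in> borel_measurable M"
    by (rule lborel.borel_measurable_lebesgue_integral) measurable
  then show ?thesis by (simp add: A_def[abs_def] set_lebesgue_integral_def)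
qed

text \<open>Both sides of \<open>q_int\<close> are finite integrals of nonnegative functions. In
  \<open>ennreal\<close> form, Tonelli and monotonicity apply below without integrability
  conditions.\<close>

lemma nn_integral_test_function:
  assumes f: "continuous_on UNIV f" "bounded (range f)" "\<And>z. 0 \<le> f z"
  shows "(\<integral>\<^sup>+z. ennreal (q z) * ennreal (f z) \<partial>lborel) =
    (\<integral>\<^sup>+\<omega>. ennreal (f (B t \<omega>)) * ennreal (exp (- A \<omega>)) \<partial>M)"
proof -
  have [measurable]: "f \<in> borel_measurable borel" using f(1) by (rule borel_measurable_continuous_onI)
  from f(2) obtain N where N: "\<And>z. norm (f z) \<le> N" by (auto simp: bounded_iff)
  have int: "integrable M (\<lambda>\<omega>. f (B t \<omega>) * exp (- A \<omega>))"
  proof (rule integrable_const_bound[where B=N])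
    have "\<bar>f z\<bar> * exp (- A \<omega>) \<le> N * 1" for z \<omega>
      using N[of z] A0[of \<omega>] by (intro mult_mono) auto
    then show "AE \<omega> in M. norm (f (B t \<omega>) * exp (- A \<omega>)) \<le> N"
      by (simp add: abs_mult)
  qed measurable
  have h: "has_bochner_integral lborel (\<lambda>y. q y * f y) (expectation (\<lambda>\<omega>. f (B t \<omega>) * exp (- A \<omega>)))"
    unfolding A_eq by (rule q_int[OF f(1,2)])
  have "(\<integral>\<^sup>+z. ennreal (q z) * ennreal (f z) \<partial>lborel) = (\<integral>\<^sup>+z. ennreal (q z * f z) \<partial>lborel)"
    by (simp add: ennreal_mult q0 f)
  also have "\<dots> = ennreal (expectation (\<lambda>\<omega>. f (B t \<omega>) * exp (- A \<omega>)))"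
    using h by (subst nn_integral_eq_integral) (auto simp: q0 f has_bochner_integral_iff)
  also have "\<dots> = (\<integral>\<^sup>+\<omega>. ennreal (f (B t \<omega>) * exp (- A \<omega>)) \<partial>M)"
    using int f by (subst nn_integral_eq_integral) auto
  finally show ?thesis by (simp add: ennreal_mult f)
qed

lemma time_average:
  fixes h :: "'w \<Rightarrow> real \<Rightarrow> ennreal"
  assumes [measurable]: "(\<lambda>(\<omega>, s). h \<omega> s) \<in> borel_measurable (M \<Otimes>\<^sub>M lborel)"
    and ab: "a \<le> b" and le: "\<And>s. a < s \<Longrightarrow> s < b \<Longrightarrow> (\<integral>\<^sup>+\<omega>. h \<omega> s \<partial>M) \<le> C"
  shows "(\<integral>\<^sup>+\<omega>. (\<integral>\<^sup>+s\<in>{a..b}. h \<omega> s \<partial>lborel) \<partial>M) \<le> ennreal (b - a) * C"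
proof -
  interpret pair_sigma_finite M lborel
    by (simp add: pair_sigma_finite_def sigma_finite_lborel sigma_finite_measure_axioms)
  have "(\<integral>\<^sup>+\<omega>. (\<integral>\<^sup>+s\<in>{a..b}. h \<omega> s \<partial>lborel) \<partial>M) = (\<integral>\<^sup>+s. (\<integral>\<^sup>+\<omega>. h \<omega> s * indicator {a..b} s \<partial>M) \<partial>lborel)"
    by (rule Fubini'[symmetric]) measurable
  also have "\<dots> \<le> (\<integral>\<^sup>+s. C * indicator {a..b} s \<partial>lborel)"
  proof (rule nn_integral_mono_AE)
    \<comment> \<open>The bridge variance s (t - s) / t vanishes at the ends of
      \<open>{0..t}\<close>, so the bound is assumed on the open interval only.\<close>
    have "AE s in lborel. s \<noteq> a" "AE s in lborel. s \<noteq> b" by (auto intro: AE_lborel_singleton)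
    then show "AE s in lborel. (\<integral>\<^sup>+\<omega>. h \<omega> s * indicator {a..b} s \<partial>M) \<le> C * indicator {a..b} s"
    proof eventually_elim
      case (elim s) then show ?case using le[of s] by (auto simp: indicator_def)
    qed
  qed
  also have "\<dots> = ennreal (b - a) * C" using ab by (simp add: nn_integral_cmult_indicator mult.commute)
  finally show ?thesis .
qed

text \<open>The potential outside \<open>{a..b}\<close> is discarded, then Jensen in time, Tonelli
  and the bridge law apply. The factor \<open>1 / (b - a)\<close> from Jensen cancels the window
  length from \<open>time_average\<close>, so a bound at each single time is enough.\<close>

lemma density_upper:
  assumes ab: "0 \<le> a" "a < b" "b \<le> t" and \<delta>: "0 < \<delta>" and Q0: "0 \<le> Q"
    and Q: "\<And>z s. dist y z < \<delta> \<Longrightarrow> a < s \<Longrightarrow> s < b \<Longrightarrow>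
      (\<integral>\<^sup>+w. ennreal (exp (- (b - a) * V w)) * ennreal (gauss (s * (t - s) / t) (x + (s / t) *\<^sub>R (z - x)) w) \<partial>lborel) \<le> ennreal Q"
  shows "q y \<le> Q * gauss t x y"
proof (rule le_if_integral_test_functions_le[where q="\<lambda>y. Q * gauss t x y" and \<delta>=\<delta>])
  show "continuous_on UNIV (\<lambda>y. Q * gauss t x y)"
    by (intro continuous_intros continuous_on_gauss)
  fix f :: "'a \<Rightarrow> real"
  assume f: "continuous_on UNIV f" "bounded (range f)" "\<And>z. 0 \<le> f z" "\<And>z. z \<notin> ball y \<delta> \<Longrightarrow> f z = 0"
  have [measurable]: "f \<in> borel_measurable borel" using f(1) by (rule borel_measurable_continuous_onI)
  define I where "I = (\<integral>\<^sup>+z. ennreal Q * (ennreal (f z) * ennreal (gauss t x z)) \<partial>lborel)"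
  have "(\<integral>\<^sup>+z. ennreal (q z) * ennreal (f z) \<partial>lborel) =
    (\<integral>\<^sup>+\<omega>. ennreal (f (B t \<omega>)) * ennreal (exp (- A \<omega>)) \<partial>M)" by (rule nn_integral_test_function[OF f(1-3)])
  also have "\<dots> \<le> (\<integral>\<^sup>+\<omega>. ennreal (1 / (b - a)) * (\<integral>\<^sup>+s\<in>{a..b}. (ennreal (f (B t \<omega>)) * ennreal (exp (- (b - a) * W s \<omega>))) \<partial>lborel) \<partial>M)"
  proof (rule nn_integral_mono)
    fix \<omega> assume \<omega>: "\<omega> \<in> space M"
    have [measurable]: "(\<lambda>s. W s \<omega>) \<in> borel_measurable borel" by (rule W_meas_time[OF \<omega>])
    obtain N where N: "\<forall>s\<in>{0..t}. W s \<omega> \<le> N" using W_bd[OF \<omega>] by blast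
    have "(LBINT s:{a..b}. W s \<omega>) \<le> A \<omega>"
      unfolding A_def set_lebesgue_integral_def
      by (rule integral_mono) (use W_set_integrable[OF \<omega>] ab W0 in \<open>auto simp: set_integrable_def indicator_def\<close>)
    then have "ennreal (exp (- A \<omega>)) \<le> ennreal (exp (- (LBINT s:{a..b}. W s \<omega>)))"
      by (intro ennreal_leI) simp
    also have "\<dots> \<le> ennreal (1 / (b - a)) * (\<integral>\<^sup>+s\<in>{a..b}. ennreal (exp (- (b - a) * W s \<omega>)) \<partial>lborel)"
      by (rule exp_set_integral_le[where N=N]) (use N ab W0 in auto)
    finally have "ennreal (f (B t \<omega>)) * ennreal (exp (- A \<omega>)) \<le>
       ennreal (f (B t \<omega>)) * (ennreal (1 / (b - a)) * (\<integral>\<^sup>+s\<in>{a..b}. ennreal (exp (- (b - a) * W s \<omega>)) \<partial>lborel))"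
      by (rule mult_left_mono) simp
    also have "\<dots> = ennreal (1 / (b - a)) * (\<integral>\<^sup>+s\<in>{a..b}. (ennreal (f (B t \<omega>)) * ennreal (exp (- (b - a) * W s \<omega>))) \<partial>lborel)"
      by (simp add: nn_integral_cmult[symmetric] mult_ac)
    finally show "ennreal (f (B t \<omega>)) * ennreal (exp (- A \<omega>)) \<le>
       ennreal (1 / (b - a)) * (\<integral>\<^sup>+s\<in>{a..b}. (ennreal (f (B t \<omega>)) * ennreal (exp (- (b - a) * W s \<omega>))) \<partial>lborel)" .
  qed
  also have "\<dots> = ennreal (1 / (b - a)) * (\<integral>\<^sup>+\<omega>. (\<integral>\<^sup>+s\<in>{a..b}. (ennreal (f (B t \<omega>)) * ennreal (exp (- (b - a) * W s \<omega>))) \<partial>lborel) \<partial>M)"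
    by (rule nn_integral_cmult) measurable
  also have "\<dots> \<le> ennreal (1 / (b - a)) * (ennreal (b - a) * I)"
  proof (intro mult_left_mono time_average)
    fix s assume s: "a < s" "s < b"
    then have s': "0 < s" "s < t" "max s 0 = s" using ab by auto
    have "(\<integral>\<^sup>+\<omega>. ennreal (f (B t \<omega>)) * ennreal (exp (- (b - a) * W s \<omega>)) \<partial>M) =
      (\<integral>\<^sup>+z. ennreal (f z) * ennreal (gauss t x z) *
      (\<integral>\<^sup>+w. ennreal (exp (- (b - a) * V w)) * ennreal (gauss (s * (t - s) / t) (x + (s / t) *\<^sub>R (z - x)) w) \<partial>lborel) \<partial>lborel)"
      unfolding W_def s'(3) by (rule brownian_bridge_law[OF bm s'(1,2)]) measurable
    also have "\<dots> \<le> (\<integral>\<^sup>+z. ennreal (f z) * ennreal (gauss t x z) * ennreal Q \<partial>lborel)"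
    proof (rule nn_integral_mono)
      fix z
      show "ennreal (f z) * ennreal (gauss t x z) *
        (\<integral>\<^sup>+w. ennreal (exp (- (b - a) * V w)) * ennreal (gauss (s * (t - s) / t) (x + (s / t) *\<^sub>R (z - x)) w) \<partial>lborel)
        \<le> ennreal (f z) * ennreal (gauss t x z) * ennreal Q"
      proof (cases "z \<in> ball y \<delta>")
        case True then show ?thesis using Q[of z s] s by (intro mult_left_mono) auto
      qed (simp add: f(4))
    qed
    also have "\<dots> = I" by (simp add: I_def mult_ac)
    finally show "(\<integral>\<^sup>+\<omega>. ennreal (f (B t \<omega>)) * ennreal (exp (- (b - a) * W s \<omega>)) \<partial>M) \<le> I" .
  qed (use ab in auto)
  also have "\<dots> = I" using ab by (simp add: mult.assoc[symmetric] ennreal_mult'[symmetric])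
  also have "\<dots> = (\<integral>\<^sup>+z. ennreal (Q * gauss t x z) * ennreal (f z) \<partial>lborel)"
    using Q0 by (simp add: I_def ennreal_mult mult_ac)
  finally show "(\<integral>\<^sup>+z. ennreal (q z) * ennreal (f z) \<partial>lborel) \<le> (\<integral>\<^sup>+z. ennreal (Q * gauss t x z) * ennreal (f z) \<partial>lborel)" .
qed (use \<delta> Q0 q_cont in auto)

text \<open>Jensen without conditional expectations: with \<open>L = l * t\<close>, the tangent of
  exp at \<open>- L\<close> gives exp (- A) >= exp (- L) (1 + L - A). After testing against
  \<open>f\<close>, the term with \<open>A\<close> is at most the one with \<open>L\<close>, because
  each bridge mean of the integrated potential is at most \<open>L\<close>.\<close>

lemma density_lower:
  assumes \<delta>: "0 < \<delta>" and l: "0 \<le> l"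
    and le: "\<And>z s. dist y z < \<delta> \<Longrightarrow> 0 < s \<Longrightarrow> s < t \<Longrightarrow>
      (\<integral>\<^sup>+w. ennreal (V w) * ennreal (gauss (s * (t - s) / t) (x + (s / t) *\<^sub>R (z - x)) w) \<partial>lborel) \<le> ennreal l"
  shows "exp (- (l * t)) * gauss t x y \<le> q y"
proof (rule le_if_integral_test_functions_le[where p="\<lambda>y. exp (- (l * t)) * gauss t x y" and \<delta>=\<delta>])
  show "continuous_on UNIV (\<lambda>y. exp (- (l * t)) * gauss t x y)"
    by (intro continuous_intros continuous_on_gauss)
  fix f :: "'a \<Rightarrow> real"
  assume f: "continuous_on UNIV f" "bounded (range f)" "\<And>z. 0 \<le> f z" "\<And>z. z \<notin> ball y \<delta> \<Longrightarrow> f z = 0"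
    and fin: "(\<integral>\<^sup>+z. ennreal (f z) \<partial>lborel) < \<infinity>"
  have [measurable]: "f \<in> borel_measurable borel" using f(1) by (rule borel_measurable_continuous_onI)
  define L where "L = l * t"
  have L: "0 \<le> L" using l t by (simp add: L_def)
  define e where "e = exp (- L)"
  define G where "G = (\<integral>\<^sup>+z. ennreal (f z) * ennreal (gauss t x z) \<partial>lborel)"
  have G: "G = (\<integral>\<^sup>+\<omega>. ennreal (f (B t \<omega>)) \<partial>M)"
    unfolding G_def by (rule brownian_law1[OF bm t, symmetric]) measurable
  \<comment> \<open>Finiteness is what permits cancelling \<open>ennreal e * (ennreal L * G)\<close>
    at the end.\<close>
  have Gfin: "G < \<infinity>"
  proof -
    obtain N where N: "\<And>z. norm (f z) \<le> N" using f(2) by (auto simp: bounded_iff)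
    have "G \<le> (\<integral>\<^sup>+\<omega>. ennreal N \<partial>M)" unfolding G
      using N by (intro nn_integral_mono ennreal_leI) (auto simp: abs_le_D1)
    then show ?thesis by (simp add: emeasure_space_1 le_less_trans)
  qed
  define X where "X = (\<integral>\<^sup>+\<omega>. ennreal (f (B t \<omega>)) * ennreal (exp (- A \<omega>)) \<partial>M)"
  define Y where "Y = (\<integral>\<^sup>+\<omega>. ennreal (f (B t \<omega>)) * ennreal (A \<omega>) \<partial>M)"
  have "Y = (\<integral>\<^sup>+\<omega>. (\<integral>\<^sup>+s\<in>{0..t}. (ennreal (f (B t \<omega>)) * ennreal (W s \<omega>)) \<partial>lborel) \<partial>M)"
    unfolding Y_def
  proof (rule nn_integral_cong)
    fix \<omega> assume \<omega>: "\<omega> \<in> space M"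
    have [measurable]: "(\<lambda>s. W s \<omega>) \<in> borel_measurable borel" by (rule W_meas_time[OF \<omega>])
    show "ennreal (f (B t \<omega>)) * ennreal (A \<omega>) = (\<integral>\<^sup>+s\<in>{0..t}. (ennreal (f (B t \<omega>)) * ennreal (W s \<omega>)) \<partial>lborel)"
      by (simp add: nn_integral_W_eq[OF \<omega>, symmetric] nn_integral_cmult[symmetric] mult_ac)
  qed
  also have "\<dots> \<le> ennreal (t - 0) * (ennreal l * G)"
  proof (intro time_average)
    fix s assume s: "0 < s" "s < t"
    then have s': "max s 0 = s" by auto
    have "(\<integral>\<^sup>+\<omega>. ennreal (f (B t \<omega>)) * ennreal (W s \<omega>) \<partial>M) =
      (\<integral>\<^sup>+z. ennreal (f z) * ennreal (gauss t x z) *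
      (\<integral>\<^sup>+w. ennreal (V w) * ennreal (gauss (s * (t - s) / t) (x + (s / t) *\<^sub>R (z - x)) w) \<partial>lborel) \<partial>lborel)"
      unfolding W_def s' by (rule brownian_bridge_law[OF bm s]) measurable
    also have "\<dots> \<le> (\<integral>\<^sup>+z. ennreal (f z) * ennreal (gauss t x z) * ennreal l \<partial>lborel)"
    proof (rule nn_integral_mono)
      fix z
      show "ennreal (f z) * ennreal (gauss t x z) *
        (\<integral>\<^sup>+w. ennreal (V w) * ennreal (gauss (s * (t - s) / t) (x + (s / t) *\<^sub>R (z - x)) w) \<partial>lborel)
        \<le> ennreal (f z) * ennreal (gauss t x z) * ennreal l"
      proof (cases "z \<in> ball y \<delta>")
        case True then show ?thesis using le[of z s] s by (intro mult_left_mono) auto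
      qed (simp add: f(4))
    qed
    also have "\<dots> = ennreal l * G"
      unfolding G_def by (subst nn_integral_cmult[symmetric]) (auto simp: mult_ac)
    finally show "(\<integral>\<^sup>+\<omega>. ennreal (f (B t \<omega>)) * ennreal (W s \<omega>) \<partial>M) \<le> ennreal l * G" .
  qed (use t in auto)
  also have "\<dots> = ennreal L * G"
    using t l by (simp add: L_def ennreal_mult mult_ac)
  finally have Y: "Y \<le> ennreal L * G" .
  have "ennreal (e * (1 + L)) * G = (\<integral>\<^sup>+\<omega>. ennreal (e * (1 + L)) * ennreal (f (B t \<omega>)) \<partial>M)"
    unfolding G by (rule nn_integral_cmult[symmetric]) measurable
  also have "\<dots> \<le> (\<integral>\<^sup>+\<omega>. ennreal (f (B t \<omega>)) * ennreal (exp (- A \<omega>)) + ennreal e * (ennreal (f (B t \<omega>)) * ennreal (A \<omega>)) \<partial>M)"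
  proof (rule nn_integral_mono)
    fix \<omega>
    \<comment> \<open>The tangent inequality; \<open>A\<close> is then moved to the other side, so
      that all terms are nonnegative and live in \<open>ennreal\<close>.\<close>
    have "e * (1 + (L - A \<omega>)) \<le> e * exp (L - A \<omega>)"
      by (intro mult_left_mono exp_ge_add_one_self) (simp add: e_def)
    then have "e * (1 + L) \<le> exp (- A \<omega>) + e * A \<omega>"
      by (simp add: e_def mult_exp_exp algebra_simps)
    then have "e * (1 + L) * f (B t \<omega>) \<le> (exp (- A \<omega>) + e * A \<omega>) * f (B t \<omega>)"
      by (intro mult_right_mono f)
    then have "ennreal (e * (1 + L) * f (B t \<omega>)) \<le> ennreal (f (B t \<omega>) * exp (- A \<omega>) + e * (f (B t \<omega>) * A \<omega>))"
      by (intro ennreal_leI) (simp add: algebra_simps)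
    then show "ennreal (e * (1 + L)) * ennreal (f (B t \<omega>)) \<le>
      ennreal (f (B t \<omega>)) * ennreal (exp (- A \<omega>)) + ennreal e * (ennreal (f (B t \<omega>)) * ennreal (A \<omega>))"
      using f(3) A0 L by (simp add: ennreal_mult e_def)
  qed
  also have "\<dots> = X + ennreal e * Y"
    unfolding X_def Y_def by (subst nn_integral_add) (auto simp: nn_integral_cmult)
  also have "\<dots> \<le> X + ennreal e * (ennreal L * G)"
    by (intro add_left_mono mult_left_mono Y) auto
  finally have "ennreal e * G + ennreal e * (ennreal L * G) \<le> X + ennreal e * (ennreal L * G)"
    using L by (simp add: e_def ennreal_mult distrib_left distrib_right mult.assoc)
  moreover have "ennreal e * (ennreal L * G) \<noteq> \<top>"
    using Gfin by (simp add: ennreal_mult_eq_top_iff)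
  ultimately have "ennreal e * G \<le> X"
    using ennreal_add_left_cancel_le[of "ennreal e * (ennreal L * G)" "ennreal e * G" X]
    by (simp only: add.commute[of _ "ennreal e * (ennreal L * G)"] infinity_ennreal_def) blast
  also have "X = (\<integral>\<^sup>+z. ennreal (q z) * ennreal (f z) \<partial>lborel)"
    unfolding X_def by (rule nn_integral_test_function[OF f(1-3), symmetric])
  finally show "(\<integral>\<^sup>+z. ennreal (exp (- (l * t)) * gauss t x z) * ennreal (f z) \<partial>lborel)
     \<le> (\<integral>\<^sup>+z. ennreal (q z) * ennreal (f z) \<partial>lborel)"
    unfolding G_def by (simp add: nn_integral_cmult[symmetric] ennreal_mult L_def e_def mult_ac)
qed (use \<delta> q_cont q0 in auto)

section \<open>Two disjoint observation windows\<close>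

lemma W_meas_raw [measurable (raw)]:
  assumes "f \<in> borel_measurable N" "h \<in> measurable N M"
  shows "(\<lambda>z. W (f z) (h z)) \<in> borel_measurable N"
  using measurable_compose[OF measurable_Pair[OF assms] W_meas_pair] by simp

lemma three_point_law:
  fixes f h1 h2 :: "'a \<Rightarrow> ennreal"
  assumes rs: "0 < r" "r < s" "s < t"
    and [measurable]: "f \<in> borel_measurable borel" "h1 \<in> borel_measurable borel" "h2 \<in> borel_measurable borel"
  shows "(\<integral>\<^sup>+\<omega>. f (B t \<omega>) * (h1 (B r \<omega>) * h2 (B s \<omega>)) \<partial>M) =
    (\<integral>\<^sup>+z. f z * (\<integral>\<^sup>+v. ennreal (gauss r x v) * (\<integral>\<^sup>+w. ennreal (gauss (s - r) v w) *
      (ennreal (gauss (t - s) w z) * (h1 v * h2 w)) \<partial>lborel) \<partial>lborel) \<partial>lborel)"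
proof -
  define F where "F z v w = ennreal (gauss r x v) * (ennreal (gauss (s - r) v w) * (ennreal (gauss (t - s) w z) * (h1 v * h2 w)))" for z v w
  have [measurable]: "(\<lambda>x. F (a x) (b x) (c x)) \<in> borel_measurable N"
    if [measurable]: "a \<in> borel_measurable N" "b \<in> borel_measurable N" "c \<in> borel_measurable N"
    for a b c and N :: "'b measure"
    unfolding F_def by measurable
  have "(\<integral>\<^sup>+\<omega>. f (B t \<omega>) * (h1 (B r \<omega>) * h2 (B s \<omega>)) \<partial>M) =
    (\<integral>\<^sup>+v. ennreal (gauss r x v) * (\<integral>\<^sup>+w. ennreal (gauss (s - r) v w) *
      (\<integral>\<^sup>+z. ennreal (gauss (t - s) w z) * (f z * (h1 v * h2 w)) \<partial>lborel) \<partial>lborel) \<partial>lborel)"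
    using brownian_law3[OF bm rs, of "\<lambda>(v, w, z). f z * (h1 v * h2 w)"] by simp
  also have "\<dots> = (\<integral>\<^sup>+v. \<integral>\<^sup>+w. \<integral>\<^sup>+z. f z * F z v w \<partial>lborel \<partial>lborel \<partial>lborel)"
    by (simp add: nn_integral_cmult[symmetric] F_def mult_ac)
  also have "\<dots> = (\<integral>\<^sup>+v. \<integral>\<^sup>+z. \<integral>\<^sup>+w. f z * F z v w \<partial>lborel \<partial>lborel \<partial>lborel)"
    by (intro nn_integral_cong lborel_pair.Fubini') measurable
  also have "\<dots> = (\<integral>\<^sup>+z. \<integral>\<^sup>+v. \<integral>\<^sup>+w. f z * F z v w \<partial>lborel \<partial>lborel \<partial>lborel)"
    by (intro lborel_pair.Fubini') measurable
  also have "\<dots> = (\<integral>\<^sup>+z. f z * (\<integral>\<^sup>+v. \<integral>\<^sup>+w. F z v w \<partial>lborel \<partial>lborel) \<partial>lborel)"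
    by (simp add: nn_integral_cmult)
  also have "\<dots> = (\<integral>\<^sup>+z. f z * (\<integral>\<^sup>+v. ennreal (gauss r x v) * (\<integral>\<^sup>+w. ennreal (gauss (s - r) v w) *
      (ennreal (gauss (t - s) w z) * (h1 v * h2 w)) \<partial>lborel) \<partial>lborel) \<partial>lborel)"
    by (simp add: nn_integral_cmult F_def)
  finally show ?thesis .
qed

text \<open>No factor \<open>gauss t x y\<close> is split off here: the three transition densities
  stay inside \<open>Q\<close>, because their joint size yields the additional decay in
  \<open>t\<close>. Jensen is applied in each window separately, and the exponentials
  multiply.\<close>

lemma density_upper2:
  assumes ab: "0 \<le> a" "a < b" "b \<le> c" "c < d" "d \<le> t" and \<delta>: "0 < \<delta>" and Q0: "0 \<le> Q"
    and Q: "\<And>z r s. dist y z < \<delta> \<Longrightarrow> a < r \<Longrightarrow> r < b \<Longrightarrow> c < s \<Longrightarrow> s < d \<Longrightarrow>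
      (\<integral>\<^sup>+v. ennreal (gauss r x v) * (\<integral>\<^sup>+w. ennreal (gauss (s - r) v w) *
      (ennreal (gauss (t - s) w z) * (ennreal (exp (- (b - a) * V v)) * ennreal (exp (- (d - c) * V w)))) \<partial>lborel) \<partial>lborel) \<le> ennreal Q"
  shows "q y \<le> Q"
proof (rule le_if_integral_test_functions_le[where p=q and y=y and q="\<lambda>y. Q" and \<delta>=\<delta>])
  fix f :: "'a \<Rightarrow> real"
  assume f: "continuous_on UNIV f" "bounded (range f)" "\<And>z. 0 \<le> f z" "\<And>z. z \<notin> ball y \<delta> \<Longrightarrow> f z = 0"
  have [measurable]: "f \<in> borel_measurable borel" using f(1) by (rule borel_measurable_continuous_onI)
  define I where "I = (\<integral>\<^sup>+z. ennreal Q * ennreal (f z) \<partial>lborel)"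
  define e1 where "e1 v = ennreal (exp (- (b - a) * v))" for v :: real
  define e2 where "e2 v = ennreal (exp (- (d - c) * v))" for v :: real
  have [measurable]: "e1 \<in> borel_measurable borel" "e2 \<in> borel_measurable borel"
    unfolding e1_def[abs_def] e2_def[abs_def] by measurable
  have "(\<integral>\<^sup>+z. ennreal (q z) * ennreal (f z) \<partial>lborel) =
    (\<integral>\<^sup>+\<omega>. ennreal (f (B t \<omega>)) * ennreal (exp (- A \<omega>)) \<partial>M)" by (rule nn_integral_test_function[OF f(1-3)])
  also have "\<dots> \<le> (\<integral>\<^sup>+\<omega>. ennreal (1 / (b - a)) * (ennreal (1 / (d - c)) *
      (\<integral>\<^sup>+r\<in>{a..b}. (\<integral>\<^sup>+s\<in>{c..d}. (ennreal (f (B t \<omega>)) * (e1 (W r \<omega>) * e2 (W s \<omega>))) \<partial>lborel) \<partial>lborel)) \<partial>M)"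
  proof (rule nn_integral_mono)
    fix \<omega> assume \<omega>: "\<omega> \<in> space M"
    have [measurable]: "(\<lambda>s. W s \<omega>) \<in> borel_measurable borel" by (rule W_meas_time[OF \<omega>])
    obtain N where N: "\<forall>s\<in>{0..t}. W s \<omega> \<le> N" using W_bd[OF \<omega>] by blast
    have i: "set_integrable lborel {0..t} (\<lambda>s. W s \<omega>)" "set_integrable lborel {a..b} (\<lambda>s. W s \<omega>)"
       "set_integrable lborel {c..d} (\<lambda>s. W s \<omega>)"
      using W_set_integrable[OF \<omega>] ab by auto
    have "(LBINT s:{a..b}. W s \<omega>) + (LBINT s:{c..d}. W s \<omega>) =
       (\<integral>s. indicator {a..b} s *\<^sub>R W s \<omega> + indicator {c..d} s *\<^sub>R W s \<omega> \<partial>lborel)"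
      unfolding set_lebesgue_integral_def
      by (rule Bochner_Integration.integral_add[symmetric]) (use i in \<open>auto simp: set_integrable_def\<close>)
    also have "\<dots> \<le> A \<omega>"
      unfolding A_def set_lebesgue_integral_def
    proof (rule integral_mono_AE)
      \<comment> \<open>The windows may touch at \<open>b = c\<close>, where the two indicators add
        up to 2.\<close>
      have "AE s in lborel. s \<noteq> b" by (rule AE_lborel_singleton)
      then show "AE s in lborel. indicator {a..b} s *\<^sub>R W s \<omega> + indicator {c..d} s *\<^sub>R W s \<omega> \<le> indicator {0..t} s *\<^sub>R W s \<omega>"
        by eventually_elim (use ab W0 in \<open>auto simp: indicator_def\<close>)
    qed (use i in \<open>auto simp: set_integrable_def\<close>)
    finally have "ennreal (exp (- A \<omega>)) \<le> ennreal (exp (- (LBINT s:{a..b}. W s \<omega>)) * exp (- (LBINT s:{c..d}. W s \<omega>)))"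
      by (intro ennreal_leI) (simp add: mult_exp_exp)
    also have "\<dots> = ennreal (exp (- (LBINT s:{a..b}. W s \<omega>))) * ennreal (exp (- (LBINT s:{c..d}. W s \<omega>)))"
      by (simp add: ennreal_mult)
    also have "\<dots> \<le> (ennreal (1 / (b - a)) * (\<integral>\<^sup>+s\<in>{a..b}. e1 (W s \<omega>) \<partial>lborel)) *
      (ennreal (1 / (d - c)) * (\<integral>\<^sup>+s\<in>{c..d}. e2 (W s \<omega>) \<partial>lborel))"
      unfolding e1_def e2_def
      by (intro mult_mono exp_set_integral_le[where N=N]) (use N ab W0 in auto)
    finally have "ennreal (f (B t \<omega>)) * ennreal (exp (- A \<omega>)) \<le> ennreal (f (B t \<omega>)) *
      ((ennreal (1 / (b - a)) * (\<integral>\<^sup>+s\<in>{a..b}. e1 (W s \<omega>) \<partial>lborel)) *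
      (ennreal (1 / (d - c)) * (\<integral>\<^sup>+s\<in>{c..d}. e2 (W s \<omega>) \<partial>lborel)))"
      by (rule mult_left_mono) simp
    also have "\<dots> = ennreal (1 / (b - a)) * (ennreal (1 / (d - c)) * (ennreal (f (B t \<omega>)) *
      ((\<integral>\<^sup>+s\<in>{c..d}. e2 (W s \<omega>) \<partial>lborel) * (\<integral>\<^sup>+r\<in>{a..b}. e1 (W r \<omega>) \<partial>lborel))))"
      by (simp only: mult_ac)
    also have "ennreal (f (B t \<omega>)) * ((\<integral>\<^sup>+s\<in>{c..d}. e2 (W s \<omega>) \<partial>lborel) * (\<integral>\<^sup>+r\<in>{a..b}. e1 (W r \<omega>) \<partial>lborel)) =
      (\<integral>\<^sup>+r\<in>{a..b}. (\<integral>\<^sup>+s\<in>{c..d}. (ennreal (f (B t \<omega>)) * (e1 (W r \<omega>) * e2 (W s \<omega>))) \<partial>lborel) \<partial>lborel)"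
    proof -
      define J where "J = (\<integral>\<^sup>+s\<in>{c..d}. e2 (W s \<omega>) \<partial>lborel)"
      define k where "k = ennreal (f (B t \<omega>))"
      have 1: "(\<integral>\<^sup>+s\<in>{c..d}. (k * (e1 (W r \<omega>) * e2 (W s \<omega>))) \<partial>lborel) = (k * e1 (W r \<omega>)) * J" for r
        unfolding J_def by (subst nn_integral_cmult[symmetric]) (auto simp: mult.assoc)
      have "(\<integral>\<^sup>+r\<in>{a..b}. ((k * e1 (W r \<omega>)) * J) \<partial>lborel) = (\<integral>\<^sup>+r. (k * J) * (e1 (W r \<omega>) * indicator {a..b} r) \<partial>lborel)"
        by (simp only: mult_ac)
      also have "\<dots> = (k * J) * (\<integral>\<^sup>+r\<in>{a..b}. e1 (W r \<omega>) \<partial>lborel)"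
        by (rule nn_integral_cmult) measurable
      finally show ?thesis unfolding 1 k_def[symmetric] J_def[symmetric] by (simp only: mult.assoc)
    qed
    finally show "ennreal (f (B t \<omega>)) * ennreal (exp (- A \<omega>)) \<le>
      ennreal (1 / (b - a)) * (ennreal (1 / (d - c)) *
      (\<integral>\<^sup>+r\<in>{a..b}. (\<integral>\<^sup>+s\<in>{c..d}. (ennreal (f (B t \<omega>)) * (e1 (W r \<omega>) * e2 (W s \<omega>))) \<partial>lborel) \<partial>lborel))" .
  qed
  also have "\<dots> = ennreal (1 / (b - a)) * (ennreal (1 / (d - c)) * (\<integral>\<^sup>+\<omega>.
      (\<integral>\<^sup>+r\<in>{a..b}. (\<integral>\<^sup>+s\<in>{c..d}. (ennreal (f (B t \<omega>)) * (e1 (W r \<omega>) * e2 (W s \<omega>))) \<partial>lborel) \<partial>lborel) \<partial>M))"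
    by (subst nn_integral_cmult, measurable, subst nn_integral_cmult) simp_all
  also have "\<dots> \<le> ennreal (1 / (b - a)) * (ennreal (1 / (d - c)) * (ennreal (b - a) * (ennreal (d - c) * I)))"
  proof (intro mult_left_mono time_average)
    fix r s assume rs: "a < r" "r < b" "c < s" "s < d"
    then have rs': "0 < r" "r < s" "s < t" "max s 0 = s" "max r 0 = r" using ab by auto
    have "(\<integral>\<^sup>+\<omega>. ennreal (f (B t \<omega>)) * (e1 (W r \<omega>) * e2 (W s \<omega>)) \<partial>M) =
      (\<integral>\<^sup>+z. ennreal (f z) * (\<integral>\<^sup>+v. ennreal (gauss r x v) * (\<integral>\<^sup>+w. ennreal (gauss (s - r) v w) *
      (ennreal (gauss (t - s) w z) * (e1 (V v) * e2 (V w))) \<partial>lborel) \<partial>lborel) \<partial>lborel)"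
      unfolding W_def rs'(4,5) by (rule three_point_law[OF rs'(1-3)]) measurable
    also have "\<dots> \<le> (\<integral>\<^sup>+z. ennreal (f z) * ennreal Q \<partial>lborel)"
    proof (rule nn_integral_mono)
      fix z
      show "ennreal (f z) * (\<integral>\<^sup>+v. ennreal (gauss r x v) * (\<integral>\<^sup>+w. ennreal (gauss (s - r) v w) *
      (ennreal (gauss (t - s) w z) * (e1 (V v) * e2 (V w))) \<partial>lborel) \<partial>lborel) \<le> ennreal (f z) * ennreal Q"
      proof (cases "z \<in> ball y \<delta>")
        case True then show ?thesis unfolding e1_def e2_def using Q[of z r s] rs by (intro mult_left_mono) auto
      qed (simp add: f(4))
    qed
    also have "\<dots> = I" by (simp add: I_def mult_ac)
    finally show "(\<integral>\<^sup>+\<omega>. ennreal (f (B t \<omega>)) * (e1 (W r \<omega>) * e2 (W s \<omega>)) \<partial>M) \<le> I" .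
  qed (use ab in \<open>auto simp: split_beta\<close>)
  also have "\<dots> = (ennreal (1 / (b - a)) * ennreal (b - a)) * ((ennreal (1 / (d - c)) * ennreal (d - c)) * I)"
    by (simp only: mult_ac)
  also have "\<dots> = I" using ab by (simp add: ennreal_mult'[symmetric])
  finally show "(\<integral>\<^sup>+z. ennreal (q z) * ennreal (f z) \<partial>lborel) \<le> (\<integral>\<^sup>+z. ennreal Q * ennreal (f z) \<partial>lborel)"
    by (simp add: I_def)
qed (use \<delta> Q0 q_cont in auto)

end

section \<open>Potentials comparable to a doubling function\<close>

lemma growth_classD:
  assumes "g \<in> growth_class"
  shows "0 \<le> r \<Longrightarrow> 1 \<le> g r" "0 \<le> r \<Longrightarrow> r \<le> s \<Longrightarrow> g r \<le> g s"
  using assms unfolding growth_class_def mono_on_def by auto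

lemma growth_class_doubling:
  assumes "g \<in> growth_class"
  obtains c where "1 \<le> c" "\<And>r. 0 \<le> r \<Longrightarrow> g (2 * r) \<le> c * g r"
proof -
  obtain c where c: "\<And>r. 0 \<le> r \<Longrightarrow> g (2 * r) \<le> c * g r"
    using assms by (auto simp: growth_class_def)
  \<comment> \<open>At \<open>r = 0\<close> doubling reads g 0 <= c * g 0, which forces 1 <= c since
    g 0 is positive.\<close>
  have "1 * g 0 \<le> c * g 0" using c[of 0] by simp
  then have "1 \<le> c" using growth_classD(1)[OF assms, of 0] by (subst (asm) mult_le_cancel_right) auto
  then show thesis using c that by blast
qed

text \<open>Doubling means polynomial growth of some order \<open>k\<close> with c <= 2^k, and a
  polynomial in \<open>a\<close> is below a multiple of exp (a^2 / 4). The rate 1 / 4 is the one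
  that \<open>nn_integral_gauss_tilt\<close> can absorb.\<close>

lemma growth_class_gaussian_bound:
  assumes g: "g \<in> growth_class"
  obtains C where "1 \<le> C" "\<And>R a. 0 \<le> R \<Longrightarrow> 0 \<le> a \<Longrightarrow> g (R * (2 + a)) \<le> C * exp (a\<^sup>2 / 4) * g R"
proof -
  obtain c where c: "1 \<le> c" "\<And>r. 0 \<le> r \<Longrightarrow> g (2 * r) \<le> c * g r"
    using growth_class_doubling[OF g] by blast
  obtain k0 :: nat where k0: "c < 2 ^ k0" using real_arch_pow[of 2 c] by auto
  \<comment> \<open>\<open>Suc\<close> makes \<open>k\<close> positive, as it appears in
    denominators below.\<close>
  define k where "k = Suc k0"
  have k: "c \<le> 2 ^ k" "0 < k" using k0 c(1) by (auto simp: k_def)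
  have pow: "g (2 ^ n * r) \<le> (2 ^ k) ^ n * g r" if "0 \<le> r" for n r
  proof (induction n)
    case (Suc n)
    have "g (2 ^ Suc n * r) = g (2 * (2 ^ n * r))" by (simp add: mult.assoc)
    also have "\<dots> \<le> c * g (2 ^ n * r)" using that by (intro c) auto
    also have "\<dots> \<le> 2 ^ k * ((2 ^ k) ^ n * g r)"
      using k growth_classD(1)[OF g, of "2 ^ n * r"] that by (intro mult_mono Suc) auto
    finally show ?case by simp
  qed simp
  \<comment> \<open>The k-th power of 2 (2 + a) <= 20 k exp (a^2 / (4 k)), which is proved
    below.\<close>
  define C where "C = (20 * real k) ^ k"
  have C: "1 \<le> C" unfolding C_def using k(2) by (intro one_le_power) auto
  have "g (R * (2 + a)) \<le> C * exp (a\<^sup>2 / 4) * g R" if R: "0 \<le> R" and a: "0 \<le> a" for R a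
  proof -
    \<comment> \<open>The least power of 2 above \<open>2 + a\<close>, which overshoots by a factor
      of at most 2.\<close>
    define n where "n = nat \<lceil>log 2 (2 + a)\<rceil>"
    have l0: "0 \<le> log 2 (2 + a)" using a by simp
    have n: "log 2 (2 + a) \<le> real n" "real n \<le> log 2 (2 + a) + 1" unfolding n_def using l0 by linarith+
    have "2 powr log 2 (2 + a) \<le> 2 powr real n" using n by (intro powr_mono) auto
    then have n1: "2 + a \<le> 2 ^ n" using a by (simp add: powr_realpow)
    have "2 powr real n \<le> 2 powr (log 2 (2 + a) + 1)" using n by (intro powr_mono) auto
    then have n2: "2 ^ n \<le> 2 * (2 + a)" using a by (simp add: powr_realpow powr_add)
    have "g (R * (2 + a)) \<le> g (2 ^ n * R)"
      using R a n1 by (intro growth_classD(2)[OF g]) (auto intro: mult_left_mono simp: mult.commute)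
    also have "\<dots> \<le> (2 ^ k) ^ n * g R" by (rule pow[OF R])
    also have "(2 ^ k) ^ n = ((2::real) ^ n) ^ k" by (simp add: power_mult[symmetric] mult.commute)
    also have "(2 ^ n) ^ k * g R \<le> (C * exp (a\<^sup>2 / 4)) * g R"
    proof (rule mult_right_mono)
      have "2 * (2 + a) \<le> 5 + a\<^sup>2"
        using zero_le_power2[of "a - 1"] by (simp add: power2_eq_square algebra_simps)
      also have "\<dots> \<le> 20 * real k * (1 + a\<^sup>2 / (4 * real k))"
      proof -
        have "20 * real k * (1 + a\<^sup>2 / (4 * real k)) = 20 * real k + 5 * a\<^sup>2"
          using k(2) by (simp add: field_simps)
        moreover have "1 \<le> real k" using k(2) by simp
        moreover have "0 \<le> a\<^sup>2" by simp
        ultimately show ?thesis by linarith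
      qed
      also have "\<dots> \<le> 20 * real k * exp (a\<^sup>2 / (4 * real k))"
        by (intro mult_left_mono exp_ge_add_one_self) auto
      finally have "2 ^ n \<le> 20 * real k * exp (a\<^sup>2 / (4 * real k))" using n2 by simp
      then have "(2 ^ n) ^ k \<le> (20 * real k * exp (a\<^sup>2 / (4 * real k))) ^ k"
        by (intro power_mono) auto
      also have "\<dots> = C * exp (a\<^sup>2 / 4)"
        using k(2) by (simp add: C_def power_mult_distrib exp_of_nat_mult[symmetric])
      finally show "(2 ^ n) ^ k \<le> C * exp (a\<^sup>2 / 4)" .
    qed (use growth_classD(1)[OF g R] in auto)
    finally show ?thesis .
  qed
  then show thesis using C that by blast
qed


text \<open>The growth condition is silent in the unit ball, but there \<open>V\<close> is bounded
  and g >= 1, so a larger constant covers both regions.\<close>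

lemma potential_upper:
  fixes V :: "'a::euclidean_space \<Rightarrow> real"
  assumes g: "g \<in> growth_class" and V: "locally_bounded V" and c2: "0 < c2"
    and up: "\<And>x. 1 < norm x \<Longrightarrow> V x \<le> c2 * g (norm x)"
  obtains K where "0 < K" "\<And>w. V w \<le> K * g (norm w)"
proof -
  have "bounded (V ` cball 0 1)" using V by (simp add: locally_bounded_def)
  then obtain N where "\<forall>v\<in>V ` cball 0 1. norm v \<le> N" unfolding bounded_iff by blast
  then have N: "\<And>w. norm w \<le> 1 \<Longrightarrow> \<bar>V w\<bar> \<le> N" by simp
  define K where "K = max c2 N"
  have "V w \<le> K * g (norm w)" for w
  proof (cases "norm w \<le> 1")
    case True
    have "V w \<le> K * 1" using N[OF True] by (auto simp: K_def)
    also have "\<dots> \<le> K * g (norm w)" using c2 growth_classD(1)[OF g, of "norm w"] by (intro mult_left_mono) (auto simp: K_def)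
    finally show ?thesis .
  next
    case False
    then have "V w \<le> c2 * g (norm w)" by (intro up) auto
    also have "\<dots> \<le> K * g (norm w)" using growth_classD(1)[OF g, of "norm w"] by (intro mult_right_mono) (auto simp: K_def)
    finally show ?thesis .
  qed
  moreover have "0 < K" using c2 by (auto simp: K_def)
  ultimately show thesis using that by blast
qed

text \<open>With a = |w - m| / R one has |w| <= R (2 + a), so \<open>V w\<close> is at most a
  multiple of g R exp (a^2 / 4). The condition v <= R^2 puts this exponential below the weight of
  \<open>nn_integral_gauss_tilt\<close>.\<close>

lemma nn_integral_potential_gauss_le:
  fixes V :: "'a::euclidean_space \<Rightarrow> real"
  assumes g: "g \<in> growth_class" and K: "0 < K" "\<And>w. V w \<le> K * g (norm w)"
  obtains C where "0 < C"
    "\<And>R v m. 0 < R \<Longrightarrow> norm m \<le> 2 * R \<Longrightarrow> 0 < v \<Longrightarrow> v \<le> R\<^sup>2 \<Longrightarrow>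
      (\<integral>\<^sup>+w. ennreal (V w) * ennreal (gauss v m w) \<partial>lborel) \<le> ennreal (C * g R)"
proof -
  obtain D where D: "1 \<le> D" "\<And>R a. 0 \<le> R \<Longrightarrow> 0 \<le> a \<Longrightarrow> g (R * (2 + a)) \<le> D * exp (a\<^sup>2 / 4) * g R"
    using growth_class_gaussian_bound[OF g] by blast
  define C where "C = K * D * 2 powr (real DIM('a) / 2)"
  have "0 < C" using K D by (simp add: C_def)
  moreover have "(\<integral>\<^sup>+w. ennreal (V w) * ennreal (gauss v m w) \<partial>lborel) \<le> ennreal (C * g R)"
    if R: "0 < R" and m: "norm m \<le> 2 * R" and v: "0 < v" "v \<le> R\<^sup>2" for R v m
  proof -
    have gR: "0 \<le> g R" using growth_classD(1)[OF g, of R] R by simp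
    have *: "V w \<le> K * D * g R * exp ((norm (w - m))\<^sup>2 / (4 * v))" for w
    proof -
      define a where "a = norm (w - m) / R"
      have a: "0 \<le> a" using R by (simp add: a_def)
      have "norm w \<le> norm m + norm (w - m)" by (rule norm_triangle_sub)
      also have "\<dots> \<le> R * (2 + a)" using m R by (simp add: a_def algebra_simps)
      finally have "g (norm w) \<le> g (R * (2 + a))" by (intro growth_classD(2)[OF g]) auto
      also have "\<dots> \<le> D * exp (a\<^sup>2 / 4) * g R" using R a by (intro D) auto
      also have "\<dots> \<le> D * exp ((norm (w - m))\<^sup>2 / (4 * v)) * g R"
      proof (intro mult_right_mono mult_left_mono)
        have "a\<^sup>2 / 4 = (norm (w - m))\<^sup>2 / (4 * R\<^sup>2)" by (simp add: a_def power_divide)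
        also have "\<dots> \<le> (norm (w - m))\<^sup>2 / (4 * v)" using v R by (intro divide_left_mono) auto
        finally show "exp (a\<^sup>2 / 4) \<le> exp ((norm (w - m))\<^sup>2 / (4 * v))" by simp
      qed (use D gR in auto)
      finally have "K * g (norm w) \<le> K * (D * exp ((norm (w - m))\<^sup>2 / (4 * v)) * g R)"
        using K by (intro mult_left_mono) auto
      with K(2)[of w] show ?thesis by (simp add: mult_ac)
    qed
    have "ennreal (V w) * ennreal (gauss v m w) \<le>
        ennreal (K * D * g R) * ennreal (gauss v m w * exp ((norm (w - m))\<^sup>2 / (4 * v)))" for w :: 'a
    proof -
      have "V w * gauss v m w \<le> K * D * g R * exp ((norm (w - m))\<^sup>2 / (4 * v)) * gauss v m w"
        by (intro mult_right_mono *) simp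
      then have "ennreal (V w * gauss v m w) \<le> ennreal (K * D * g R * (gauss v m w * exp ((norm (w - m))\<^sup>2 / (4 * v))))"
        by (intro ennreal_leI) (simp add: mult_ac)
      then show ?thesis using K D gR by (simp add: ennreal_mult' ennreal_mult'')
    qed
    then have "(\<integral>\<^sup>+w. ennreal (V w) * ennreal (gauss v m w) \<partial>lborel) \<le>
       (\<integral>\<^sup>+w. ennreal (K * D * g R) * ennreal (gauss v m w * exp ((norm (w - m))\<^sup>2 / (4 * v))) \<partial>lborel)"
      by (intro nn_integral_mono)
    also have "\<dots> = ennreal (K * D * g R) * ennreal (2 powr (real DIM('a) / 2))"
      by (subst nn_integral_cmult) (auto simp: nn_integral_gauss_tilt[OF v(1)])
    also have "\<dots> = ennreal (C * g R)"
      using K D gR by (simp add: C_def ennreal_mult'[symmetric] mult_ac)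
    finally show ?thesis .
  qed
  ultimately show thesis using that by blast
qed

text \<open>The Gaussian mass at distance at least \<open>R / 4\<close> from \<open>m\<close> is absorbed into the tilted density.\<close>

lemma nn_integral_exp_potential_gauss_le:
  fixes V :: "'a::euclidean_space \<Rightarrow> real"
  assumes R: "0 < R" and V0: "\<And>w. 0 \<le> V w" and low: "\<And>w. norm (w - e) \<le> R / 2 \<Longrightarrow> L \<le> V w"
    and m: "norm (m - e) \<le> R / 4" and v: "0 < v" "v \<le> \<tau>"
  shows "(\<integral>\<^sup>+w. ennreal (exp (- \<tau> * V w)) * ennreal (gauss v m w) \<partial>lborel) \<le>
    ennreal (exp (- \<tau> * L) + 2 powr (real DIM('a) / 2) * exp (- R\<^sup>2 / (64 * \<tau>)))"
proof -
  have \<tau>: "0 < \<tau>" using v by simp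
  have *: "exp (- \<tau> * V w) \<le> exp (- \<tau> * L) + exp (- R\<^sup>2 / (64 * \<tau>)) * exp ((norm (w - m))\<^sup>2 / (4 * v))" for w
  proof (cases "norm (w - e) \<le> R / 2")
    case True
    then have "exp (- \<tau> * V w) \<le> exp (- \<tau> * L)" using low[of w] \<tau> by simp
    then show ?thesis by (rule order_trans) simp
  next
    case False
    have "norm (w - e) \<le> norm (w - m) + norm (m - e)"
      using norm_triangle_ineq[of "w - m" "m - e"] by simp
    then have "R / 4 \<le> norm (w - m)" using False m by simp
    then have "(R / 4)\<^sup>2 \<le> (norm (w - m))\<^sup>2" using R by (intro power_mono) auto
    \<comment> \<open>At distance R / 4 the tilt exponent is (R / 4)^2 / (4 v), whence 64.\<close>
    then have "R\<^sup>2 / (64 * v) \<le> (norm (w - m))\<^sup>2 / (4 * v)"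
      using v by (simp add: power_divide field_simps)
    moreover have "R\<^sup>2 / (64 * \<tau>) \<le> R\<^sup>2 / (64 * v)"
      using v by (intro divide_left_mono) auto
    ultimately have "1 \<le> exp (- R\<^sup>2 / (64 * \<tau>)) * exp ((norm (w - m))\<^sup>2 / (4 * v))"
      by (simp add: mult_exp_exp)
    moreover have "exp (- \<tau> * V w) \<le> 1" using V0[of w] \<tau> by simp
    ultimately show ?thesis by (smt (verit) exp_gt_zero)
  qed
  have "(\<integral>\<^sup>+w. ennreal (exp (- \<tau> * V w)) * ennreal (gauss v m w) \<partial>lborel) \<le>
    (\<integral>\<^sup>+w. ennreal (exp (- \<tau> * L)) * ennreal (gauss v m w) +
      ennreal (exp (- R\<^sup>2 / (64 * \<tau>))) * ennreal (gauss v m w * exp ((norm (w - m))\<^sup>2 / (4 * v))) \<partial>lborel)"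
  proof (rule nn_integral_mono)
    fix w
    have "exp (- \<tau> * V w) * gauss v m w \<le> (exp (- \<tau> * L) + exp (- R\<^sup>2 / (64 * \<tau>)) * exp ((norm (w - m))\<^sup>2 / (4 * v))) * gauss v m w"
      by (rule mult_right_mono[OF *]) simp
    then have "ennreal (exp (- \<tau> * V w) * gauss v m w) \<le> ennreal (exp (- \<tau> * L) * gauss v m w +
       exp (- R\<^sup>2 / (64 * \<tau>)) * (gauss v m w * exp ((norm (w - m))\<^sup>2 / (4 * v))))"
      by (intro ennreal_leI) (simp add: algebra_simps)
    then show "ennreal (exp (- \<tau> * V w)) * ennreal (gauss v m w) \<le> ennreal (exp (- \<tau> * L)) * ennreal (gauss v m w) +
      ennreal (exp (- R\<^sup>2 / (64 * \<tau>))) * ennreal (gauss v m w * exp ((norm (w - m))\<^sup>2 / (4 * v)))"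
      by (simp add: ennreal_mult)
  qed
  also have "\<dots> = ennreal (exp (- \<tau> * L)) + ennreal (exp (- R\<^sup>2 / (64 * \<tau>))) * ennreal (2 powr (real DIM('a) / 2))"
    using v by (simp add: nn_integral_add nn_integral_cmult nn_integral_gauss nn_integral_gauss_tilt)
  also have "\<dots> = ennreal (exp (- \<tau> * L) + 2 powr (real DIM('a) / 2) * exp (- R\<^sup>2 / (64 * \<tau>)))"
    by (simp add: ennreal_mult mult_ac)
  finally show ?thesis .
qed

text \<open>For the summand \<open>e\<close> of \<open>h\<close>, one density is bounded by
  \<open>k\<close> and the other two integrate to 1. When both interior points lie in the unit ball,
  all three densities are bounded by \<open>k\<close> and two ball volumes remain. With
  \<open>k\<close> of order t^(-1/2), this cube is the source of t^(-3/2).\<close>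

lemma nn_integral_three_gauss_le:
  fixes x z :: "'a::euclidean_space" and h :: "'a \<Rightarrow> 'a \<Rightarrow> ennreal"
  assumes t: "0 < t1" "0 < t2" and k: "0 \<le> k" "\<And>u v. gauss t1 x v \<le> k" "\<And>v w. gauss t2 (v::'a) w \<le> k" "\<And>w. gauss t3 w z \<le> k"
    and h: "\<And>v w. h v w \<le> ennreal e + indicator (cball 0 1) v * indicator (cball 0 1) w" and e: "0 \<le> e"
  shows "(\<integral>\<^sup>+v. ennreal (gauss t1 x v) * (\<integral>\<^sup>+w. ennreal (gauss t2 v w) * (ennreal (gauss t3 w z) * h v w) \<partial>lborel) \<partial>lborel)
    \<le> ennreal (k * e + k ^ 3 * (measure lborel (cball (0::'a) 1))\<^sup>2)"
proof -
  define \<nu> where "\<nu> = measure lborel (cball (0::'a) 1)"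
  have \<nu>: "emeasure lborel (cball (0::'a) 1) = ennreal \<nu>" "0 \<le> \<nu>"
    unfolding \<nu>_def by (simp_all add: emeasure_eq_ennreal_measure emeasure_cball)
  have m: "(\<lambda>w. c * indicator (cball (0::'a) 1) w) \<in> borel_measurable lborel" for c :: ennreal
    by (intro borel_measurable_times_ennreal borel_measurable_const borel_measurable_indicator) auto
  have 1: "(\<integral>\<^sup>+w. ennreal (gauss t2 v w) * (ennreal (gauss t3 w z) * h v w) \<partial>lborel) \<le>
     ennreal (k * e) + ennreal (k\<^sup>2 * \<nu>) * indicator (cball 0 1) v" for v
  proof -
    have "(\<integral>\<^sup>+w. ennreal (gauss t2 v w) * (ennreal (gauss t3 w z) * h v w) \<partial>lborel) \<le>
      (\<integral>\<^sup>+w. ennreal (k * e) * ennreal (gauss t2 v w) + (ennreal (k\<^sup>2) * indicator (cball 0 1) v) * indicator (cball 0 1) w \<partial>lborel)"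
    proof (rule nn_integral_mono)
      fix w
      have "ennreal (gauss t2 v w) * (ennreal (gauss t3 w z) * h v w) \<le>
        ennreal (gauss t2 v w) * (ennreal k * (ennreal e + indicator (cball 0 1) v * indicator (cball 0 1) w))"
        by (intro mult_left_mono mult_mono h ennreal_leI k) auto
      also have "\<dots> = ennreal (k * e) * ennreal (gauss t2 v w) +
          ennreal (gauss t2 v w) * (ennreal k * (indicator (cball 0 1) v * indicator (cball 0 1) w))"
        using k(1) e by (simp add: ennreal_mult distrib_left mult_ac)
      also have "\<dots> \<le> ennreal (k * e) * ennreal (gauss t2 v w) +
          ennreal k * (ennreal k * (indicator (cball 0 1) v * indicator (cball 0 1) w))"
        by (intro add_left_mono mult_right_mono ennreal_leI k) auto
      also have "ennreal k * (ennreal k * (indicator (cball 0 1) v * indicator (cball 0 1) w)) =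
         (ennreal (k\<^sup>2) * indicator (cball 0 1) v) * indicator (cball 0 1) w"
        using k(1) by (simp add: power2_eq_square ennreal_mult mult_ac)
      finally show "ennreal (gauss t2 v w) * (ennreal (gauss t3 w z) * h v w) \<le>
        ennreal (k * e) * ennreal (gauss t2 v w) + (ennreal (k\<^sup>2) * indicator (cball 0 1) v) * indicator (cball 0 1) w" .
    qed
    also have "\<dots> = ennreal (k * e) + ennreal (k\<^sup>2) * indicator (cball 0 1) v * ennreal \<nu>"
    proof -
      have 2: "(\<integral>\<^sup>+w. ennreal (k * e) * ennreal (gauss t2 v w) \<partial>lborel) = ennreal (k * e)"
        using t by (subst nn_integral_cmult) (auto simp: nn_integral_gauss)
      have 3: "(\<integral>\<^sup>+w. (ennreal (k\<^sup>2) * indicator (cball 0 1) v) * indicator (cball (0::'a) 1) w \<partial>lborel) =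
          ennreal (k\<^sup>2) * indicator (cball 0 1) v * ennreal \<nu>"
        by (subst nn_integral_cmult_indicator) (auto simp: \<nu>)
      show ?thesis
        by (subst nn_integral_add[OF _ m]) (simp, simp only: 2 3)
    qed
    also have "\<dots> = ennreal (k * e) + ennreal (k\<^sup>2 * \<nu>) * indicator (cball 0 1) v"
      using k \<nu> by (simp add: ennreal_mult mult_ac)
    finally show ?thesis .
  qed
  have "(\<integral>\<^sup>+v. ennreal (gauss t1 x v) * (\<integral>\<^sup>+w. ennreal (gauss t2 v w) * (ennreal (gauss t3 w z) * h v w) \<partial>lborel) \<partial>lborel)
    \<le> (\<integral>\<^sup>+v. ennreal (k * e) * ennreal (gauss t1 x v) + ennreal (k ^ 3 * \<nu>) * indicator (cball 0 1) v \<partial>lborel)"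
  proof (rule nn_integral_mono)
    fix v
    have "ennreal (gauss t1 x v) * (\<integral>\<^sup>+w. ennreal (gauss t2 v w) * (ennreal (gauss t3 w z) * h v w) \<partial>lborel) \<le>
       ennreal (gauss t1 x v) * (ennreal (k * e) + ennreal (k\<^sup>2 * \<nu>) * indicator (cball 0 1) v)"
      by (intro mult_left_mono 1) auto
    also have "\<dots> = ennreal (k * e) * ennreal (gauss t1 x v) + ennreal (gauss t1 x v) * (ennreal (k\<^sup>2 * \<nu>) * indicator (cball 0 1) v)"
      by (simp add: distrib_left mult_ac)
    also have "\<dots> \<le> ennreal (k * e) * ennreal (gauss t1 x v) + ennreal k * (ennreal (k\<^sup>2 * \<nu>) * indicator (cball 0 1) v)"
      by (intro add_left_mono mult_right_mono ennreal_leI k) auto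
    also have "ennreal k * (ennreal (k\<^sup>2 * \<nu>) * indicator (cball 0 1) v) = ennreal (k ^ 3 * \<nu>) * indicator (cball 0 1) v"
      using k(1) \<nu>(2) by (simp add: power2_eq_square power3_eq_cube ennreal_mult mult_ac)
    finally show "ennreal (gauss t1 x v) * (\<integral>\<^sup>+w. ennreal (gauss t2 v w) * (ennreal (gauss t3 w z) * h v w) \<partial>lborel) \<le>
      ennreal (k * e) * ennreal (gauss t1 x v) + ennreal (k ^ 3 * \<nu>) * indicator (cball 0 1) v" .
  qed
  also have "\<dots> = ennreal (k * e) + ennreal (k ^ 3 * \<nu>) * ennreal \<nu>"
    using t
    by (subst nn_integral_add[OF _ m], simp, subst nn_integral_cmult, simp, subst nn_integral_cmult_indicator)
      (auto simp: nn_integral_gauss \<nu>)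
  also have "\<dots> = ennreal (k * e + k ^ 3 * \<nu>\<^sup>2)"
    using k(1) e \<nu>(2) by (simp add: ennreal_mult power2_eq_square mult_ac)
  finally show ?thesis by (simp add: \<nu>_def)
qed

section \<open>Time integrals of the heat kernel\<close>

lemma set_nn_integral_powr_from_0:
  fixes p b :: real
  assumes "-1 < p" "0 \<le> b"
  shows "(\<integral>\<^sup>+t\<in>{0..b}. ennreal (t powr p) \<partial>lborel) = ennreal (b powr (p + 1) / (p + 1))"
  using has_integral_powr_from_0[OF assms] by (intro nn_integral_has_integral_lebesgue') auto

lemma set_nn_integral_powr_to_inf:
  fixes p a :: real
  assumes "p < -1" "0 < a"
  shows "(\<integral>\<^sup>+t\<in>{a..}. ennreal (t powr p) \<partial>lborel) = ennreal (- (a powr (p + 1)) / (p + 1))"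
  using has_integral_powr_to_inf[OF assms] by (intro nn_integral_has_integral_lebesgue') auto

lemma set_nn_integral_exp_to_inf:
  fixes k a :: real
  assumes "0 < k"
  shows "(\<integral>\<^sup>+t\<in>{a..}. ennreal (exp (- k * t)) \<partial>lborel) = ennreal (exp (- k * a) / k)"
  using has_integral_exp_minus_to_infinity[OF assms] by (intro nn_integral_has_integral_lebesgue') auto

lemma set_nn_integral_inverse:
  fixes a b :: real
  assumes "0 < a" "a \<le> b"
  shows "(\<integral>\<^sup>+t\<in>{a..b}. ennreal (1 / t) \<partial>lborel) = ennreal (ln b - ln a)"
proof -
  have "((\<lambda>t. 1 / t) has_integral (ln b - ln a)) {a..b}"
  proof (rule fundamental_theorem_of_calculus)
    fix t assume "t \<in> {a..b}"
    then have "(ln has_real_derivative 1 / t) (at t)" using assms by (auto intro!: DERIV_ln_divide)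
    then show "(ln has_vector_derivative 1 / t) (at t within {a..b})"
      by (simp add: has_real_derivative_iff_has_vector_derivative has_vector_derivative_at_within)
  qed (use assms in auto)
  then show ?thesis
    using assms by (intro nn_integral_has_integral_lebesgue') auto
qed

lemma set_nn_integral_const_Icc:
  fixes a b :: real
  assumes "a \<le> b" "0 \<le> k"
  shows "(\<integral>\<^sup>+t\<in>{a..b}. ennreal k \<partial>lborel) = ennreal (k * (b - a))"
  using assms by (simp add: nn_integral_cmult_indicator ennreal_mult)

section \<open>Upper bounds for the time integrals\<close>

lemma power2_powr: "0 < r \<Longrightarrow> (r\<^sup>2) powr q = r powr (2 * q)" for r q :: real
  by (simp add: powr_powr[symmetric])

text \<open>Half of each exponent goes into the inequality between arithmetic and geometric mean,
  which produces r sqrt M; the other half is kept for the integration over \<open>t\<close>.\<close>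

lemma exp_split:
  fixes r t c M :: real
  assumes "0 < t" "0 \<le> r" "0 < c" "0 < M"
  shows "exp (- r\<^sup>2 / (2 * t) - c * M * t) \<le>
    exp (- sqrt (c / 2) * (r * sqrt M)) * (exp (- r\<^sup>2 / (4 * t)) * exp (- (c * M / 2) * t))"
proof -
  have "0 \<le> (r / (2 * sqrt t) - sqrt (c / 2) * sqrt M * sqrt t)\<^sup>2" by simp
  also have "\<dots> = r\<^sup>2 / (4 * t) + (c / 2) * M * t - sqrt (c / 2) * (r * sqrt M)"
  proof -
    have "(r / (2 * sqrt t))\<^sup>2 = r\<^sup>2 / (4 * t)" using assms by (simp add: power_divide power_mult_distrib)
    moreover have "(sqrt (c / 2) * sqrt M * sqrt t)\<^sup>2 = (c / 2) * M * t" using assms by (simp add: power_mult_distrib)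
    moreover have "2 * (r / (2 * sqrt t)) * (sqrt (c / 2) * sqrt M * sqrt t) = sqrt (c / 2) * (r * sqrt M)"
      using assms by (simp add: field_simps)
    ultimately show ?thesis by (simp only: power2_diff)
  qed
  finally have "sqrt (c / 2) * (r * sqrt M) \<le> r\<^sup>2 / (4 * t) + (c / 2) * M * t" by simp
  moreover have "r\<^sup>2 / (2 * t) = 2 * (r\<^sup>2 / (4 * t))" "c * M * t = 2 * ((c / 2) * M * t)" "c * M / 2 * t = (c / 2) * M * t"
    by simp_all
  ultimately have "- r\<^sup>2 / (2 * t) - c * M * t \<le> - sqrt (c / 2) * (r * sqrt M) + (- r\<^sup>2 / (4 * t) + - (c * M / 2) * t)"
    by (simp only: minus_divide_left[symmetric] mult_minus_left)
  then show ?thesis by (simp only: exp_add[symmetric] exp_le_cancel_iff)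
qed

lemma heat_time_integral_le_product:
  fixes r c M p :: real
  assumes "0 \<le> r" "0 < c" "0 < M" and b: "0 \<le> b"
    and le: "(\<integral>\<^sup>+t\<in>{0<..}. ennreal (t powr p * (exp (- r\<^sup>2 / (4 * t)) * exp (- (c * M / 2) * t))) \<partial>lborel) \<le> ennreal b"
  shows "(\<integral>\<^sup>+t\<in>{0<..}. ennreal (t powr p * exp (- r\<^sup>2 / (2 * t) - c * M * t)) \<partial>lborel) \<le>
    ennreal (b * exp (- sqrt (c / 2) * (r * sqrt M)))"
proof -
  let ?e = "exp (- sqrt (c / 2) * (r * sqrt M))"
  have "(\<integral>\<^sup>+t\<in>{0<..}. ennreal (t powr p * exp (- r\<^sup>2 / (2 * t) - c * M * t)) \<partial>lborel) \<le>
    (\<integral>\<^sup>+t. ennreal ?e * (ennreal (t powr p * (exp (- r\<^sup>2 / (4 * t)) * exp (- (c * M / 2) * t))) * indicator {0<..} t) \<partial>lborel)"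
  proof (rule nn_integral_mono)
    fix t :: real
    show "ennreal (t powr p * exp (- r\<^sup>2 / (2 * t) - c * M * t)) * indicator {0<..} t \<le>
       ennreal ?e * (ennreal (t powr p * (exp (- r\<^sup>2 / (4 * t)) * exp (- (c * M / 2) * t))) * indicator {0<..} t)"
    proof (cases "0 < t")
      case True
      have "t powr p * exp (- r\<^sup>2 / (2 * t) - c * M * t) \<le> t powr p * (?e * (exp (- r\<^sup>2 / (4 * t)) * exp (- (c * M / 2) * t)))"
        by (intro mult_left_mono exp_split True assms) auto
      also have "\<dots> = ?e * (t powr p * (exp (- r\<^sup>2 / (4 * t)) * exp (- (c * M / 2) * t)))" by (simp only: mult_ac)
      finally show ?thesis using True by (simp add: ennreal_mult'[symmetric] ennreal_leI)
    qed simp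
  qed
  also have "\<dots> = ennreal ?e * (\<integral>\<^sup>+t\<in>{0<..}. ennreal (t powr p * (exp (- r\<^sup>2 / (4 * t)) * exp (- (c * M / 2) * t))) \<partial>lborel)"
    by (rule nn_integral_cmult) measurable
  also have "\<dots> \<le> ennreal ?e * ennreal b" by (intro mult_left_mono le) auto
  finally show ?thesis using b by (simp add: ennreal_mult'[symmetric] mult.commute)
qed

text \<open>Split at t = r^2. Below, the Gaussian factor bounds the integrand by K r^(-d) on an
  interval of length r^2; above, t^(-d/2) is integrable because d >= 3. Both parts are of order
  r^(2-d).\<close>

lemma heat_time_integral_upper_3:
  fixes r c M :: real and d :: nat
  assumes r: "0 < r" and "0 < c" "0 < M" and d: "3 \<le> d"
  shows "(\<integral>\<^sup>+t\<in>{0<..}. ennreal (t powr (- (real d / 2)) * exp (- r\<^sup>2 / (2 * t) - c * M * t)) \<partial>lborel) \<le>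
    ennreal (((4 * real d) ^ d + 2) * r powr (2 - real d) * exp (- sqrt (c / 2) * (r * sqrt M)))"
proof (rule heat_time_integral_le_product)
  \<comment> \<open>From s^d <= (4 d)^d exp (s / 4), applied to s = r^2 / t.\<close>
  define K :: real where "K = (4 * real d) ^ d"
  let ?D = "real d / 2"
  have K: "0 \<le> K" by (simp add: K_def)
  have "(\<integral>\<^sup>+t\<in>{0<..}. ennreal (t powr (- ?D) * (exp (- r\<^sup>2 / (4 * t)) * exp (- (c * M / 2) * t))) \<partial>lborel) \<le>
    (\<integral>\<^sup>+t. ennreal (K * r powr (- real d)) * indicator {0..r\<^sup>2} t + ennreal (t powr (- ?D)) * indicator {r\<^sup>2..} t \<partial>lborel)"
  proof (rule nn_integral_mono)
    fix t :: real
    show "ennreal (t powr (- ?D) * (exp (- r\<^sup>2 / (4 * t)) * exp (- (c * M / 2) * t))) * indicator {0<..} t \<le>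
      ennreal (K * r powr (- real d)) * indicator {0..r\<^sup>2} t + ennreal (t powr (- ?D)) * indicator {r\<^sup>2..} t"
    proof (cases "0 < t")
      case True
      have le: "t powr (- ?D) * (exp (- r\<^sup>2 / (4 * t)) * exp (- (c * M / 2) * t)) \<le> t powr (- ?D) * (exp (- r\<^sup>2 / (4 * t)) * 1)"
        using True assms by (intro mult_left_mono) auto
      show ?thesis
      proof (cases "t \<le> r\<^sup>2")
        case tr: True
        define s where "s = r\<^sup>2 / t"
        have s: "1 \<le> s" "0 < s" using True tr r by (auto simp: s_def)
        have "t powr (- ?D) = r powr (- real d) * s powr ?D"
        proof -
          have "s powr ?D = (r\<^sup>2) powr ?D / t powr ?D"
            unfolding s_def by (rule powr_divide)
          also have "(r\<^sup>2) powr ?D = r powr real d" using power2_powr[OF r, of ?D] by simp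
          finally have 1: "r powr (- real d) * s powr ?D = (r powr (- real d) * r powr real d) / t powr ?D" by simp
          have "r powr (- real d) * r powr real d = 1" using r by (subst powr_add[symmetric]) simp
          with 1 show ?thesis by (simp add: powr_minus_divide)
        qed
        moreover have "s powr ?D * exp (- s / 4) \<le> K"
        proof -
          have "s powr ?D \<le> s powr real d" using s by (intro powr_mono) auto
          also have "\<dots> = s ^ d" using s by (simp add: powr_realpow)
          also have "\<dots> = K * (s / (4 * real d)) ^ d"
            using d by (subst power_divide) (simp add: K_def)
          also have "\<dots> \<le> K * exp (s / (4 * real d)) ^ d"
          proof (intro mult_left_mono power_mono)
            show "s / (4 * real d) \<le> exp (s / (4 * real d))"
              using exp_ge_add_one_self[of "s / (4 * real d)"] by linarith
          qed (use s K in auto)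
          also have "exp (s / (4 * real d)) ^ d = exp (s / 4)"
            using d by (simp add: exp_of_nat_mult[symmetric])
          finally have "s powr ?D * exp (- s / 4) \<le> K * exp (s / 4) * exp (- s / 4)" by (intro mult_right_mono) auto
          then show ?thesis by (simp add: mult.assoc mult_exp_exp)
        qed
        ultimately have "t powr (- ?D) * exp (- r\<^sup>2 / (4 * t)) \<le> r powr (- real d) * K"
          using mult_left_mono[of "s powr ?D * exp (- s / 4)" K "r powr (- real d)"]
          by (simp add: s_def mult.assoc mult.commute[of 4])
        then have "ennreal (t powr (- ?D) * (exp (- r\<^sup>2 / (4 * t)) * exp (- (c * M / 2) * t))) \<le> ennreal (K * r powr (- real d))"
          using le by (intro ennreal_leI) (simp add: mult.commute)
        then show ?thesis using True tr by (simp add: add_increasing2)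
      next
        case False
        have "t powr (- ?D) * (exp (- r\<^sup>2 / (4 * t)) * 1) \<le> t powr (- ?D) * 1"
          using True by (intro mult_left_mono) auto
        with le have "ennreal (t powr (- ?D) * (exp (- r\<^sup>2 / (4 * t)) * exp (- (c * M / 2) * t))) \<le> ennreal (t powr (- ?D))"
          by (intro ennreal_leI) simp
        then show ?thesis using True False by simp
      qed
    qed simp
  qed
  also have "\<dots> = ennreal (K * r powr (- real d) * (r\<^sup>2 - 0)) + ennreal (- ((r\<^sup>2) powr (- ?D + 1)) / (- ?D + 1))"
    using r d K
    by (subst nn_integral_add) (auto simp: set_nn_integral_const_Icc set_nn_integral_powr_to_inf)
  also have "\<dots> = ennreal (K * r powr (- real d) * (r\<^sup>2 - 0) + - ((r\<^sup>2) powr (- ?D + 1)) / (- ?D + 1))"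
    using K r d by (intro ennreal_plus[symmetric]) (auto intro!: divide_nonneg_nonpos)
  also have "\<dots> \<le> ennreal ((K + 2) * r powr (2 - real d))"
  proof (rule ennreal_leI)
    have 1: "r powr (- real d) * r\<^sup>2 = r powr (2 - real d)"
      using r powr_add[of r "- real d" 2] by (simp add: algebra_simps)
    have 2: "(r\<^sup>2) powr (- ?D + 1) = r powr (2 - real d)"
      using power2_powr[OF r, of "- ?D + 1"] by (simp add: algebra_simps)
    have "- (r powr (2 - real d)) / (- ?D + 1) = r powr (2 - real d) / (?D - 1)"
      using d by (simp add: field_simps)
    \<comment> \<open>d / 2 - 1 >= 1 / 2, which gives the summand 2 of the constant.\<close>
    also have "\<dots> \<le> r powr (2 - real d) / (1 / 2)"
      using d by (intro divide_left_mono) auto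
    finally show "K * r powr (- real d) * (r\<^sup>2 - 0) + - ((r\<^sup>2) powr (- ?D + 1)) / (- ?D + 1) \<le> (K + 2) * r powr (2 - real d)"
      unfolding 2 using 1 by (simp add: algebra_simps)
  qed
  finally show "(\<integral>\<^sup>+t\<in>{0<..}. ennreal (t powr (- ?D) * (exp (- r\<^sup>2 / (4 * t)) * exp (- (c * M / 2) * t))) \<partial>lborel) \<le>
     ennreal (((4 * real d) ^ d + 2) * r powr (2 - real d))" by (simp add: K_def)
qed (use assms in auto)

text \<open>Between r^2 and 1 / M the integrand is at most 1 / t and contributes the logarithm of
  the ratio of the two scales. Below r^2 the Gaussian factor, and above 1 / M the killing, make the
  contributions bounded, by 4 and 2 / c.\<close>

lemma heat_time_integral_upper_2:
  fixes r c M :: real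
  assumes r: "0 < r" and c: "0 < c" and M: "0 < M"
  shows "(\<integral>\<^sup>+t\<in>{0<..}. ennreal (t powr (- 1) * exp (- r\<^sup>2 / (2 * t) - c * M * t)) \<partial>lborel) \<le>
    ennreal ((6 + 2 / c) * max (ln (1 / (r * sqrt M))) 1 * exp (- sqrt (c / 2) * (r * sqrt M)))"
proof (rule heat_time_integral_le_product)
  \<comment> \<open>For r^2 > 1 / M the middle range is empty and the outer ranges overlap, so the
    logarithm, which would be negative, is replaced by 0.\<close>
  define l where "l = (if r\<^sup>2 \<le> 1 / M then ln (1 / M) - ln (r\<^sup>2) else 0)"
  have l: "0 \<le> l" "l \<le> 2 * max (ln (1 / (r * sqrt M))) 1"
  proof -
    have "ln (1 / M) - ln (r\<^sup>2) = 2 * ln (1 / (r * sqrt M))"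
      using r M by (simp add: ln_div ln_mult ln_sqrt ln_realpow)
    then show "l \<le> 2 * max (ln (1 / (r * sqrt M))) 1" by (auto simp: l_def)
    show "0 \<le> l" using r M by (simp add: l_def)
  qed
  have mid: "(\<integral>\<^sup>+t\<in>{r\<^sup>2..1 / M}. ennreal (1 / t) \<partial>lborel) = ennreal l"
    using r M by (cases "r\<^sup>2 \<le> 1 / M") (auto simp: l_def set_nn_integral_inverse)
  have "(\<integral>\<^sup>+t\<in>{0<..}. ennreal (t powr (- 1) * (exp (- r\<^sup>2 / (4 * t)) * exp (- (c * M / 2) * t))) \<partial>lborel) \<le>
    (\<integral>\<^sup>+t. (ennreal (4 / r\<^sup>2) * indicator {0..r\<^sup>2} t + ennreal (1 / t) * indicator {r\<^sup>2..1 / M} t) +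
      ennreal M * (ennreal (exp (- (c * M / 2) * t)) * indicator {1 / M..} t) \<partial>lborel)"
  proof (rule nn_integral_mono)
    fix t :: real
    show "ennreal (t powr (- 1) * (exp (- r\<^sup>2 / (4 * t)) * exp (- (c * M / 2) * t))) * indicator {0<..} t \<le>
      (ennreal (4 / r\<^sup>2) * indicator {0..r\<^sup>2} t + ennreal (1 / t) * indicator {r\<^sup>2..1 / M} t) +
      ennreal M * (ennreal (exp (- (c * M / 2) * t)) * indicator {1 / M..} t)"
    proof (cases "0 < t")
      case t: True
      have e1: "exp (- r\<^sup>2 / (4 * t)) \<le> 1" "exp (- (c * M / 2) * t) \<le> 1" using t c M by auto
      have p: "t powr (- 1) = 1 / t" using t by (simp add: powr_minus divide_inverse)
      consider "t \<le> r\<^sup>2" | "r\<^sup>2 \<le> t" "t \<le> 1 / M" | "1 / M \<le> t" by linarith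
      then show ?thesis
      proof cases
        case 1
        have "r\<^sup>2 / (4 * t) \<le> exp (r\<^sup>2 / (4 * t))" using exp_ge_add_one_self[of "r\<^sup>2 / (4 * t)"] by linarith
        then have "r\<^sup>2 / (4 * t) * exp (- r\<^sup>2 / (4 * t)) \<le> exp (r\<^sup>2 / (4 * t)) * exp (- r\<^sup>2 / (4 * t))"
          by (intro mult_right_mono) auto
        then have "r\<^sup>2 / (4 * t) * exp (- r\<^sup>2 / (4 * t)) \<le> 1" by (simp add: mult_exp_exp)
        then have "1 / t * exp (- r\<^sup>2 / (4 * t)) \<le> 4 / r\<^sup>2" using t r by (simp add: field_simps)
        then have "1 / t * exp (- r\<^sup>2 / (4 * t)) * exp (- (c * M / 2) * t) \<le> 4 / r\<^sup>2 * 1"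
          by (intro mult_mono e1) auto
        then have "ennreal (t powr (- 1) * (exp (- r\<^sup>2 / (4 * t)) * exp (- (c * M / 2) * t))) \<le> ennreal (4 / r\<^sup>2)"
          by (intro ennreal_leI) (simp only: p mult.assoc mult_1_right)
        then show ?thesis using t 1 by (simp add: add_increasing2)
      next
        case 2
        have "1 / t * (exp (- r\<^sup>2 / (4 * t)) * exp (- (c * M / 2) * t)) \<le> 1 / t * (1 * 1)"
          using t by (intro mult_left_mono mult_mono e1) auto
        then have "ennreal (t powr (- 1) * (exp (- r\<^sup>2 / (4 * t)) * exp (- (c * M / 2) * t))) \<le> ennreal (1 / t)"
          by (intro ennreal_leI) (simp only: p mult_1_right)
        then show ?thesis using t 2 by (simp add: add_increasing add_increasing2)
      next
        case 3
        have "1 / t * (exp (- r\<^sup>2 / (4 * t)) * exp (- (c * M / 2) * t)) \<le> M * (1 * exp (- (c * M / 2) * t))"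
          using t 3 M by (intro mult_mono e1) (auto simp: field_simps)
        then have "ennreal (t powr (- 1) * (exp (- r\<^sup>2 / (4 * t)) * exp (- (c * M / 2) * t))) \<le> ennreal M * ennreal (exp (- (c * M / 2) * t))"
          using M t by (subst ennreal_mult[symmetric]) (auto intro!: ennreal_leI simp: p)
        then show ?thesis using t 3 by (simp add: add_increasing)
      qed
    qed simp
  qed
  also have "\<dots> = (ennreal (4 / r\<^sup>2 * (r\<^sup>2 - 0)) + ennreal l) + ennreal M * ennreal (exp (- (c * M / 2) * (1 / M)) / (c * M / 2))"
    using r c M
    by (subst nn_integral_add, measurable, subst nn_integral_add, measurable, subst nn_integral_cmult, measurable,
        subst set_nn_integral_const_Icc, simp, simp, subst mid, subst set_nn_integral_exp_to_inf) auto
  also have "\<dots> = ennreal (4 + l + M * (exp (- (c * M / 2) * (1 / M)) / (c * M / 2)))"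
    using r c M l by (simp add: ennreal_mult'[symmetric])
  also have "\<dots> \<le> ennreal ((6 + 2 / c) * max (ln (1 / (r * sqrt M))) 1)"
  proof (rule ennreal_leI)
    let ?m = "max (ln (1 / (r * sqrt M))) 1"
    have "M * (exp (- (c * M / 2) * (1 / M)) / (c * M / 2)) = 2 / c * exp (- (c / 2))" using c M by (simp add: field_simps)
    also have "\<dots> \<le> 2 / c * ?m" using c by (intro mult_left_mono) (auto simp: max_def intro: order_trans[of _ 1])
    finally have "M * (exp (- (c * M / 2) * (1 / M)) / (c * M / 2)) \<le> 2 / c * ?m" .
    moreover have "4 \<le> 4 * ?m" by simp
    ultimately show "4 + l + M * (exp (- (c * M / 2) * (1 / M)) / (c * M / 2)) \<le> (6 + 2 / c) * ?m"
      using l(2) by (simp only: distrib_right)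
  qed
  finally show "(\<integral>\<^sup>+t\<in>{0<..}. ennreal (t powr (- 1) * (exp (- r\<^sup>2 / (4 * t)) * exp (- (c * M / 2) * t))) \<partial>lborel) \<le>
     ennreal ((6 + 2 / c) * max (ln (1 / (r * sqrt M))) 1)" .
qed (use assms in auto)

text \<open>For d = 1 the singularity t^(-1/2) is integrable, so a single split at 1 / M works. The
  case r = 0 is included, since the diagonal of the line has to be covered.\<close>

lemma heat_time_integral_upper_1:
  fixes r c M :: real
  assumes r: "0 \<le> r" and c: "0 < c" and M: "0 < M"
  shows "(\<integral>\<^sup>+t\<in>{0<..}. ennreal (t powr (- (1/2)) * exp (- r\<^sup>2 / (2 * t) - c * M * t)) \<partial>lborel) \<le>
    ennreal ((2 + 2 / c) * (1 / sqrt M) * exp (- sqrt (c / 2) * (r * sqrt M)))"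
proof (rule heat_time_integral_le_product)
  have "(\<integral>\<^sup>+t\<in>{0<..}. ennreal (t powr (- (1/2)) * (exp (- r\<^sup>2 / (4 * t)) * exp (- (c * M / 2) * t))) \<partial>lborel) \<le>
    (\<integral>\<^sup>+t. ennreal (t powr (- (1/2))) * indicator {0..1 / M} t +
      ennreal (sqrt M) * (ennreal (exp (- (c * M / 2) * t)) * indicator {1 / M..} t) \<partial>lborel)"
  proof (rule nn_integral_mono)
    fix t :: real
    show "ennreal (t powr (- (1/2)) * (exp (- r\<^sup>2 / (4 * t)) * exp (- (c * M / 2) * t))) * indicator {0<..} t \<le>
      ennreal (t powr (- (1/2))) * indicator {0..1 / M} t +
      ennreal (sqrt M) * (ennreal (exp (- (c * M / 2) * t)) * indicator {1 / M..} t)"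
    proof (cases "0 < t")
      case t: True
      have e1: "exp (- r\<^sup>2 / (4 * t)) \<le> 1" "exp (- (c * M / 2) * t) \<le> 1" using t c M by auto
      show ?thesis
      proof (cases "t \<le> 1 / M")
        case True
        have "t powr (- (1/2)) * (exp (- r\<^sup>2 / (4 * t)) * exp (- (c * M / 2) * t)) \<le> t powr (- (1/2)) * (1 * 1)"
          using t by (intro mult_left_mono mult_mono e1) auto
        then have "ennreal (t powr (- (1/2)) * (exp (- r\<^sup>2 / (4 * t)) * exp (- (c * M / 2) * t))) \<le> ennreal (t powr (- (1/2)))"
          by (intro ennreal_leI) simp
        then show ?thesis using t True by (simp add: add_increasing2)
      next
        case False
        have "t powr (- (1/2)) \<le> (1 / M) powr (- (1/2))" using False M t by (intro powr_mono2') auto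
        also have "\<dots> = sqrt M" using M by (simp add: powr_minus powr_half_sqrt powr_divide)
        finally have "t powr (- (1/2)) * (exp (- r\<^sup>2 / (4 * t)) * exp (- (c * M / 2) * t)) \<le> sqrt M * (1 * exp (- (c * M / 2) * t))"
          using t M by (intro mult_mono e1) auto
        then have "ennreal (t powr (- (1/2)) * (exp (- r\<^sup>2 / (4 * t)) * exp (- (c * M / 2) * t))) \<le> ennreal (sqrt M) * ennreal (exp (- (c * M / 2) * t))"
          using M by (subst ennreal_mult[symmetric]) (auto intro!: ennreal_leI)
        then show ?thesis using t False by simp
      qed
    qed simp
  qed
  also have "\<dots> = ennreal ((1 / M) powr (- (1/2) + 1) / (- (1/2) + 1)) + ennreal (sqrt M) * ennreal (exp (- (c * M / 2) * (1 / M)) / (c * M / 2))"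
    using r c M
    by (subst nn_integral_add, measurable, subst nn_integral_cmult, measurable,
        subst set_nn_integral_powr_from_0, simp, simp, subst set_nn_integral_exp_to_inf) auto
  also have "\<dots> = ennreal (2 / sqrt M + sqrt M * (exp (- (c * M / 2) * (1 / M)) / (c * M / 2)))"
    using c M by (simp add: ennreal_mult'[symmetric] powr_half_sqrt real_sqrt_divide)
  also have "\<dots> \<le> ennreal ((2 + 2 / c) * (1 / sqrt M))"
  proof (rule ennreal_leI)
    have "sqrt M * (exp (- (c * M / 2) * (1 / M)) / (c * M / 2)) = sqrt M / M * (2 / c) * exp (- (c / 2))" using c M by (simp add: field_simps)
    also have "\<dots> \<le> sqrt M / M * (2 / c) * 1" using c M by (intro mult_left_mono) auto
    also have "sqrt M / M = 1 / sqrt M" using M by (simp add: real_div_sqrt field_simps)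
    finally show "2 / sqrt M + sqrt M * (exp (- (c * M / 2) * (1 / M)) / (c * M / 2)) \<le> (2 + 2 / c) * (1 / sqrt M)"
      by (simp only: distrib_right) (simp add: mult.commute)
  qed
  finally show "(\<integral>\<^sup>+t\<in>{0<..}. ennreal (t powr (- (1/2)) * (exp (- r\<^sup>2 / (4 * t)) * exp (- (c * M / 2) * t))) \<partial>lborel) \<le>
     ennreal ((2 + 2 / c) * (1 / sqrt M))" .
qed (use assms in auto)

section \<open>Lower bounds for the time integrals\<close>

lemma set_nn_integral_ge_const:
  fixes f :: "real \<Rightarrow> real"
  assumes "{a..b} \<subseteq> S" "a \<le> b" "0 \<le> k" "\<And>t. t \<in> {a..b} \<Longrightarrow> k \<le> f t"
  shows "ennreal (k * (b - a)) \<le> (\<integral>\<^sup>+t\<in>S. ennreal (f t) \<partial>lborel)"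
proof -
  have "ennreal (k * (b - a)) = (\<integral>\<^sup>+t\<in>{a..b}. ennreal k \<partial>lborel)"
    using assms by (simp add: set_nn_integral_const_Icc)
  also have "\<dots> \<le> (\<integral>\<^sup>+t\<in>S. ennreal (f t) \<partial>lborel)"
    using assms by (intro nn_integral_mono) (auto simp: indicator_def intro!: ennreal_leI)
  finally show ?thesis .
qed

text \<open>Only the window from \<open>a\<close> to \<open>2 * a\<close> is kept; \<open>p\<close>
  and \<open>q\<close> bound the Gaussian and the killing exponent there. What remains is the choice
  of \<open>a\<close>.\<close>

lemma heat_time_integral_ge:
  fixes r C M D T a p q :: real
  assumes a: "0 < a" "2 * a \<le> T" and D: "0 \<le> D" and CM: "0 \<le> C * M"
    and p: "r\<^sup>2 / (2 * a) \<le> p" and q: "2 * (C * M) * a \<le> q"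
  shows "ennreal (2 powr (- D) * a powr (1 - D) * exp (- p - q)) \<le>
    (\<integral>\<^sup>+t\<in>{0<..T}. ennreal (t powr (- D) * exp (- r\<^sup>2 / (2 * t) - C * M * t)) \<partial>lborel)"
proof -
  have "ennreal (((2 * a) powr (- D) * exp (- p - q)) * (2 * a - a)) \<le>
    (\<integral>\<^sup>+t\<in>{0<..T}. ennreal (t powr (- D) * exp (- r\<^sup>2 / (2 * t) - C * M * t)) \<partial>lborel)"
  proof (rule set_nn_integral_ge_const)
    fix t assume t: "t \<in> {a..2 * a}"
    have "r\<^sup>2 / (2 * t) \<le> r\<^sup>2 / (2 * a)" using t a by (intro divide_left_mono) auto
    moreover have "C * M * t \<le> C * M * (2 * a)" using t a CM by (intro mult_left_mono) auto
    ultimately have "- p - q \<le> - r\<^sup>2 / (2 * t) - C * M * t" using p q by simp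
    then show "(2 * a) powr (- D) * exp (- p - q) \<le> t powr (- D) * exp (- r\<^sup>2 / (2 * t) - C * M * t)"
      using t a D by (intro mult_mono powr_mono2') auto
  qed (use a in auto)
  also have "((2 * a) powr (- D) * exp (- p - q)) * (2 * a - a) = 2 powr (- D) * a powr (1 - D) * exp (- p - q)"
  proof -
    have "a powr (1 - D) = a powr (- D) * a" using a powr_add[of a "- D" 1] by simp
    then show ?thesis using a by (simp add: powr_mult)
  qed
  finally show ?thesis .
qed

lemma exp_minus_mult_le_1: "0 \<le> c \<Longrightarrow> 0 \<le> u \<Longrightarrow> exp (- c * u) \<le> 1" for c u :: real
  by simp

text \<open>The window sits at a = r / sqrt M, where the two exponents balance, if r sqrt M >= 1,
  and otherwise at a = r^2, where both are bounded. The conditions on \<open>T\<close> make either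
  window fit into the time range.\<close>

lemma heat_time_integral_lower_ge2:
  fixes r C M T :: real and d :: nat
  assumes r: "0 < r" and C: "0 \<le> C" and M: "0 < M" and T: "2 / M \<le> T" "2 * (r / sqrt M) \<le> T" and d: "2 \<le> d"
  shows "ennreal (2 powr (- (real d / 2)) * exp (- 1 / 2 - 2 * C) * (r powr (2 - real d) * exp (- (1 / 2 + 2 * C) * (r * sqrt M)))) \<le>
    (\<integral>\<^sup>+t\<in>{0<..T}. ennreal (t powr (- (real d / 2)) * exp (- r\<^sup>2 / (2 * t) - C * M * t)) \<partial>lborel)"
proof (cases "1 \<le> r * sqrt M")
  case True
  define a where "a = r / sqrt M"
  have a: "0 < a" "a * sqrt M = r" "r * sqrt M * a = r\<^sup>2"
    using r M by (simp_all add: a_def power2_eq_square)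
  have "a \<le> a * (r * sqrt M)" using True a(1) by simp
  then have ar: "a \<le> r\<^sup>2" using a(3) by (simp add: mult.commute)
  have Ma: "M * a = r * sqrt M" using a(2) M by (metis mult.assoc mult.commute real_sqrt_mult_self abs_of_pos)
  have "r powr (2 - real d) = (r\<^sup>2) powr (1 - real d / 2)"
    using power2_powr[OF r, of "1 - real d / 2"] by (simp add: algebra_simps)
  also have "\<dots> \<le> a powr (1 - real d / 2)"
    using a(1) ar d by (intro powr_mono2') auto
  finally have "2 powr (- (real d / 2)) * exp (- 1 / 2 - 2 * C) * (r powr (2 - real d) * exp (- (1 / 2 + 2 * C) * (r * sqrt M))) \<le>
      2 powr (- (real d / 2)) * 1 * (a powr (1 - real d / 2) * exp (- (1 / 2 + 2 * C) * (r * sqrt M)))"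
    using C by (intro mult_mono) auto
  also have "\<dots> = 2 powr (- (real d / 2)) * a powr (1 - real d / 2) * exp (- (r * sqrt M / 2) - 2 * C * (r * sqrt M))"
    by (simp add: algebra_simps)
  finally have "ennreal (2 powr (- (real d / 2)) * exp (- 1 / 2 - 2 * C) * (r powr (2 - real d) * exp (- (1 / 2 + 2 * C) * (r * sqrt M)))) \<le>
    ennreal (2 powr (- (real d / 2)) * a powr (1 - real d / 2) * exp (- (r * sqrt M / 2) - 2 * C * (r * sqrt M)))"
    by (rule ennreal_leI)
  also have "\<dots> \<le> (\<integral>\<^sup>+t\<in>{0<..T}. ennreal (t powr (- (real d / 2)) * exp (- r\<^sup>2 / (2 * t) - C * M * t)) \<partial>lborel)"
  proof (rule heat_time_integral_ge)
    show "r\<^sup>2 / (2 * a) \<le> r * sqrt M / 2" using a by (simp add: field_simps)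
    show "2 * (C * M) * a \<le> 2 * C * (r * sqrt M)" using Ma by (simp add: mult.assoc)
  qed (use a T C M in \<open>auto simp: a_def\<close>)
  finally show ?thesis .
next
  case False
  then have "(r * sqrt M)\<^sup>2 \<le> 1\<^sup>2" using r M by (intro power_mono) auto
  then have rM: "M * r\<^sup>2 \<le> 1" using M by (simp add: power_mult_distrib mult.commute)
  have "2 powr (- (real d / 2)) * exp (- 1 / 2 - 2 * C) * (r powr (2 - real d) * exp (- (1 / 2 + 2 * C) * (r * sqrt M))) \<le>
     2 powr (- (real d / 2)) * exp (- 1 / 2 - 2 * C) * (r powr (2 - real d) * 1)"
    using r C M by (intro mult_left_mono exp_minus_mult_le_1) auto
  also have "\<dots> = 2 powr (- (real d / 2)) * (r\<^sup>2) powr (1 - real d / 2) * exp (- (1 / 2) - 2 * C)"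
    using power2_powr[OF r, of "1 - real d / 2"] by (simp add: algebra_simps)
  finally have "ennreal (2 powr (- (real d / 2)) * exp (- 1 / 2 - 2 * C) * (r powr (2 - real d) * exp (- (1 / 2 + 2 * C) * (r * sqrt M)))) \<le>
     ennreal (2 powr (- (real d / 2)) * (r\<^sup>2) powr (1 - real d / 2) * exp (- (1 / 2) - 2 * C))"
    by (rule ennreal_leI)
  also have "\<dots> \<le> (\<integral>\<^sup>+t\<in>{0<..T}. ennreal (t powr (- (real d / 2)) * exp (- r\<^sup>2 / (2 * t) - C * M * t)) \<partial>lborel)"
  proof (rule heat_time_integral_ge)
    show "2 * (C * M) * r\<^sup>2 \<le> 2 * C" using mult_left_mono[OF rM, of "2 * C"] C by (simp add: mult_ac)
    have "2 * r\<^sup>2 \<le> 2 / M" using rM M by (simp add: field_simps)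
    then show "2 * r\<^sup>2 \<le> T" using T(1) by simp
  qed (use r C M in auto)
  finally show ?thesis .
qed

text \<open>If the logarithm is at most 1, this is the previous bound with d = 2. Otherwise a single
  window of ratio 2 would miss the logarithm, so the whole range from r^2 to 2 / M is used; both
  exponents are bounded on it.\<close>

lemma heat_time_integral_lower_2:
  fixes r C M T :: real
  assumes r: "0 < r" and C: "0 \<le> C" and M: "0 < M" and T: "2 / M \<le> T" "2 * (r / sqrt M) \<le> T"
  shows "ennreal (1 / 2 * exp (- 1 / 2 - 2 * C) * (exp (- (1 / 2 + 2 * C) * (r * sqrt M)) * max (ln (1 / (r * sqrt M))) 1)) \<le>
    (\<integral>\<^sup>+t\<in>{0<..T}. ennreal (t powr (- 1) * exp (- r\<^sup>2 / (2 * t) - C * M * t)) \<partial>lborel)"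
proof (cases "ln (1 / (r * sqrt M)) \<le> 1")
  case True
  then have "max (ln (1 / (r * sqrt M))) 1 = 1" by simp
  moreover have "2 powr (- (real 2 / 2)) = (1 / 2 :: real)" "r powr (2 - real 2) = 1" "real 2 / 2 = 1"
    using r by (simp_all add: powr_minus_divide)
  ultimately show ?thesis
    using heat_time_integral_lower_ge2[OF r C M T order_refl] by (simp only: mult_1_left mult_1_right)
next
  case False
  define l where "l = ln (1 / (r * sqrt M))"
  have l: "1 < l" using False by (simp add: l_def)
  have u0: "0 < r * sqrt M" using r M by simp
  have u: "r * sqrt M \<le> 1"
  proof (rule ccontr)
    assume "\<not> r * sqrt M \<le> 1"
    then have "1 / (r * sqrt M) \<le> 1" by simp
    then have "l \<le> 0" unfolding l_def using u0 by simp
    with l show False by simp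
  qed
  then have "(r * sqrt M)\<^sup>2 \<le> 1\<^sup>2" using r M by (intro power_mono) auto
  then have rM: "M * r\<^sup>2 \<le> 1" using M by (simp add: power_mult_distrib mult.commute)
  then have r2: "r\<^sup>2 \<le> 2 / M" using M by (simp add: field_simps)
  have "ennreal (1 / 2 * exp (- 1 / 2 - 2 * C) * (exp (- (1 / 2 + 2 * C) * (r * sqrt M)) * max (ln (1 / (r * sqrt M))) 1)) \<le>
     ennreal (exp (- 1 / 2 - 2 * C) * (ln (2 / M) - ln (r\<^sup>2)))"
  proof (rule ennreal_leI)
    have "ln (2 / M) - ln (r\<^sup>2) = ln 2 + 2 * l"
      using r M by (simp add: l_def ln_div ln_mult ln_sqrt ln_realpow)
    moreover have "0 \<le> ln (2::real)" by simp
    ultimately have L: "l \<le> ln (2 / M) - ln (r\<^sup>2)" using l by linarith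
    have *: "exp (- (1 / 2 + 2 * C) * (r * sqrt M)) * l \<le> 1 * (ln (2 / M) - ln (r\<^sup>2))"
      using L l C u0 by (intro mult_mono exp_minus_mult_le_1) auto
    have "(1 / 2 * exp (- 1 / 2 - 2 * C)) * (exp (- (1 / 2 + 2 * C) * (r * sqrt M)) * l) \<le>
        exp (- 1 / 2 - 2 * C) * (1 * (ln (2 / M) - ln (r\<^sup>2)))"
      by (rule mult_mono[OF _ *]) (use l in auto)
    then show "1 / 2 * exp (- 1 / 2 - 2 * C) * (exp (- (1 / 2 + 2 * C) * (r * sqrt M)) * max (ln (1 / (r * sqrt M))) 1) \<le>
       exp (- 1 / 2 - 2 * C) * (ln (2 / M) - ln (r\<^sup>2))"
      using l by (simp add: l_def max_def)
  qed
  also have "\<dots> = ennreal (exp (- 1 / 2 - 2 * C)) * (\<integral>\<^sup>+t\<in>{r\<^sup>2..2 / M}. ennreal (1 / t) \<partial>lborel)"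
    using r r2 by (subst set_nn_integral_inverse) (auto simp: ennreal_mult'[symmetric])
  also have "\<dots> = (\<integral>\<^sup>+t. ennreal (exp (- 1 / 2 - 2 * C)) * (ennreal (1 / t) * indicator {r\<^sup>2..2 / M} t) \<partial>lborel)"
    by (rule nn_integral_cmult[symmetric]) measurable
  also have "\<dots> \<le> (\<integral>\<^sup>+t\<in>{0<..T}. ennreal (t powr (- 1) * exp (- r\<^sup>2 / (2 * t) - C * M * t)) \<partial>lborel)"
  proof (rule nn_integral_mono)
    fix t
    show "ennreal (exp (- 1 / 2 - 2 * C)) * (ennreal (1 / t) * indicator {r\<^sup>2..2 / M} t) \<le>
      ennreal (t powr (- 1) * exp (- r\<^sup>2 / (2 * t) - C * M * t)) * indicator {0<..T} t"
    proof (cases "t \<in> {r\<^sup>2..2 / M}")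
      case True
      have r2: "r\<^sup>2 \<le> t" using True by simp
      have "t \<le> 2 / M" using True by simp
      moreover have "0 < r\<^sup>2" using r by simp
      then have "0 < t" using r2 by (rule less_le_trans)
      ultimately have t: "r\<^sup>2 \<le> t" "t \<le> 2 / M" "0 < t" using r2 by blast+
      have "r\<^sup>2 / (2 * t) \<le> 1 / 2" using t by (simp add: field_simps)
      moreover have "C * M * t \<le> 2 * C"
        using mult_left_mono[of "M * t" 2 C] t C M by (simp add: field_simps)
      ultimately have "exp (- 1 / 2 - 2 * C) \<le> exp (- r\<^sup>2 / (2 * t) - C * M * t)" by simp
      then have "t powr (- 1) * exp (- 1 / 2 - 2 * C) \<le> t powr (- 1) * exp (- r\<^sup>2 / (2 * t) - C * M * t)"
        by (rule mult_left_mono) simp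
      moreover have "t powr (- 1) = 1 / t" using t(3) by (simp add: powr_minus divide_inverse)
      ultimately have "exp (- 1 / 2 - 2 * C) * (1 / t) \<le> t powr (- 1) * exp (- r\<^sup>2 / (2 * t) - C * M * t)"
        by (simp only: mult.commute[of "1 / t"])
      then have "ennreal (exp (- 1 / 2 - 2 * C)) * ennreal (1 / t) \<le> ennreal (t powr (- 1) * exp (- r\<^sup>2 / (2 * t) - C * M * t))"
        by (subst ennreal_mult'[symmetric]) (auto intro: ennreal_leI)
      moreover have "t \<in> {0<..T}" using t(2,3) T(1) by simp
      ultimately show ?thesis using True by (simp only: indicator_simps mult_1_right)
    qed simp
  qed
  finally show ?thesis .
qed

text \<open>The short-distance window is at 1 / M instead of r^2: for d = 1 the integral is
  dominated by late times, and the bound must not degenerate at r = 0.\<close>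

lemma heat_time_integral_lower_1:
  fixes r C M T :: real
  assumes r: "0 \<le> r" and C: "0 \<le> C" and M: "0 < M" and T: "2 / M \<le> T" "2 * (r / sqrt M) \<le> T"
  shows "ennreal (2 powr (- (1 / 2)) * exp (- 1 / 2 - 2 * C) * (1 / sqrt M * exp (- (1 / 2 + 2 * C) * (r * sqrt M)))) \<le>
    (\<integral>\<^sup>+t\<in>{0<..T}. ennreal (t powr (- (1 / 2)) * exp (- r\<^sup>2 / (2 * t) - C * M * t)) \<partial>lborel)"
proof (cases "1 \<le> r * sqrt M")
  case True
  define a where "a = r / sqrt M"
  have r0: "0 < r" using True r by (cases "r = 0") auto
  have a: "0 < a" "a * sqrt M = r" "r * sqrt M * a = r\<^sup>2"
    using r0 M by (simp_all add: a_def power2_eq_square)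
  have Ma: "M * a = r * sqrt M" using a(2) M by (metis mult.assoc mult.commute real_sqrt_mult_self abs_of_pos)
  have "1 / M \<le> a" using Ma True M by (simp add: field_simps)
  then have "sqrt (1 / M) \<le> sqrt a" by simp
  then have "1 / sqrt M \<le> a powr (1 - 1 / 2)" using a(1) by (simp add: powr_half_sqrt real_sqrt_divide)
  then have "2 powr (- (1 / 2)) * exp (- 1 / 2 - 2 * C) * (1 / sqrt M * exp (- (1 / 2 + 2 * C) * (r * sqrt M))) \<le>
      2 powr (- (1 / 2)) * 1 * (a powr (1 - 1 / 2) * exp (- (1 / 2 + 2 * C) * (r * sqrt M)))"
    using C M by (intro mult_mono) auto
  also have "\<dots> = 2 powr (- (1 / 2)) * a powr (1 - 1 / 2) * exp (- (r * sqrt M / 2) - 2 * C * (r * sqrt M))"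
    by (simp add: algebra_simps)
  finally have "ennreal (2 powr (- (1 / 2)) * exp (- 1 / 2 - 2 * C) * (1 / sqrt M * exp (- (1 / 2 + 2 * C) * (r * sqrt M)))) \<le>
    ennreal (2 powr (- (1 / 2)) * a powr (1 - 1 / 2) * exp (- (r * sqrt M / 2) - 2 * C * (r * sqrt M)))"
    by (rule ennreal_leI)
  also have "\<dots> \<le> (\<integral>\<^sup>+t\<in>{0<..T}. ennreal (t powr (- (1 / 2)) * exp (- r\<^sup>2 / (2 * t) - C * M * t)) \<partial>lborel)"
  proof (rule heat_time_integral_ge)
    show "r\<^sup>2 / (2 * a) \<le> r * sqrt M / 2" using a by (simp add: field_simps)
    show "2 * (C * M) * a \<le> 2 * C * (r * sqrt M)" using Ma by (simp add: mult.assoc)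
  qed (use a T C M in \<open>auto simp: a_def\<close>)
  finally show ?thesis .
next
  case False
  then have "(r * sqrt M)\<^sup>2 \<le> 1\<^sup>2" using r M by (intro power_mono) auto
  then have rM: "M * r\<^sup>2 \<le> 1" using M by (simp add: power_mult_distrib mult.commute)
  have "2 powr (- (1 / 2)) * exp (- 1 / 2 - 2 * C) * (1 / sqrt M * exp (- (1 / 2 + 2 * C) * (r * sqrt M))) \<le>
     2 powr (- (1 / 2)) * exp (- 1 / 2 - 2 * C) * (1 / sqrt M * 1)"
    using r C M by (intro mult_left_mono exp_minus_mult_le_1) auto
  also have "\<dots> = 2 powr (- (1 / 2)) * (1 / M) powr (1 - 1 / 2) * exp (- (1 / 2) - 2 * C)"
    using M by (simp add: powr_half_sqrt real_sqrt_divide)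
  finally have "ennreal (2 powr (- (1 / 2)) * exp (- 1 / 2 - 2 * C) * (1 / sqrt M * exp (- (1 / 2 + 2 * C) * (r * sqrt M)))) \<le>
     ennreal (2 powr (- (1 / 2)) * (1 / M) powr (1 - 1 / 2) * exp (- (1 / 2) - 2 * C))"
    by (rule ennreal_leI)
  also have "\<dots> \<le> (\<integral>\<^sup>+t\<in>{0<..T}. ennreal (t powr (- (1 / 2)) * exp (- r\<^sup>2 / (2 * t) - C * M * t)) \<partial>lborel)"
  proof (rule heat_time_integral_ge)
    show "r\<^sup>2 / (2 * (1 / M)) \<le> 1 / 2" using rM by (simp add: mult.commute)
  qed (use T C M in auto)
  finally show ?thesis .
qed

text \<open>Near 0 the integrand is at least a multiple of 1 / t. This is the diagonal for d >= 2,
  where the Gaussian exponent is absent.\<close>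

lemma heat_time_integral_diverges:
  fixes k T D :: real
  assumes D: "1 \<le> D" and T: "0 < T" and k: "0 \<le> k"
  shows "(\<integral>\<^sup>+t\<in>{0<..T}. ennreal (t powr (- D) * exp (- k * t)) \<partial>lborel) = \<infinity>"
proof -
  define S where "S = min T 1"
  have S: "0 < S" "S \<le> T" "S \<le> 1" using T by (auto simp: S_def)
  have "ennreal (real n) \<le> (\<integral>\<^sup>+t\<in>{0<..T}. ennreal (t powr (- D) * exp (- k * t)) \<partial>lborel)" for n
  proof -
    \<comment> \<open>Chosen so that exp (- k) (ln S - ln a) = n.\<close>
    define N where "N = real n * exp k"
    define a where "a = S * exp (- N)"
    have a: "0 < a" "a \<le> S" using S by (auto simp: a_def N_def)
    have "ln S - ln a = N" using S by (simp add: a_def ln_mult)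
    then have "ennreal (real n) = ennreal (exp (- k)) * ennreal (ln S - ln a)"
      by (simp add: N_def ennreal_mult'[symmetric] mult_exp_exp)
    also have "\<dots> = ennreal (exp (- k)) * (\<integral>\<^sup>+t\<in>{a..S}. ennreal (1 / t) \<partial>lborel)"
      using a by (subst set_nn_integral_inverse) auto
    also have "\<dots> = (\<integral>\<^sup>+t. ennreal (exp (- k)) * (ennreal (1 / t) * indicator {a..S} t) \<partial>lborel)"
      by (rule nn_integral_cmult[symmetric]) measurable
    also have "\<dots> \<le> (\<integral>\<^sup>+t\<in>{0<..T}. ennreal (t powr (- D) * exp (- k * t)) \<partial>lborel)"
    proof (rule nn_integral_mono)
      fix t
      show "ennreal (exp (- k)) * (ennreal (1 / t) * indicator {a..S} t) \<le> ennreal (t powr (- D) * exp (- k * t)) * indicator {0<..T} t"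
      proof (cases "t \<in> {a..S}")
        case True
        then have t: "0 < t" "t \<le> T" "t \<le> 1" using a S by auto
        have "1 / t = t powr (- 1)" using t by (simp add: powr_minus divide_inverse)
        also have "\<dots> \<le> t powr (- D)" using t D by (intro powr_mono') auto
        finally have "1 / t \<le> t powr (- D)" .
        moreover have "exp (- k) \<le> exp (- k * t)" using t k by (simp add: mult_left_le)
        ultimately have "exp (- k) * (1 / t) \<le> exp (- k * t) * t powr (- D)" using t by (intro mult_mono) auto
        then have "exp (- k) * (1 / t) \<le> t powr (- D) * exp (- k * t)" by (simp only: mult.commute)
        then show ?thesis using True t by (simp add: ennreal_mult'[symmetric] ennreal_leI)
      qed simp
    qed
    finally show ?thesis .
  qed
  then have "of_nat n \<le> (\<integral>\<^sup>+t\<in>{0<..T}. ennreal (t powr (- D) * exp (- k * t)) \<partial>lborel)" for n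
    by (simp add: ennreal_of_nat_eq_real_of_nat)
  then have "\<not> (\<integral>\<^sup>+t\<in>{0<..T}. ennreal (t powr (- D) * exp (- k * t)) \<partial>lborel) < \<top>"
    using ennreal_Ex_less_of_nat leD by blast
  then show ?thesis by (metis infinity_ennreal_def top.not_eq_extremum)
qed

text \<open>Interpolation: min a b <= a^(1/4) b^(3/4) with b = t^(-3/2) leaves t^(-9/8), integrable
  at infinity, while a quarter of the exponential rate in \<open>a\<close> survives. The constant 9
  is 1 from t <= 1 plus 8 from t >= 1.\<close>

lemma set_nn_integral_min_powr_le:
  fixes a :: real
  assumes a: "0 < a" "a \<le> 1"
  shows "(\<integral>\<^sup>+t\<in>{0<..}. ennreal (min a (t powr (- (3/2)))) \<partial>lborel) \<le> ennreal (9 * a powr (1/4))"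
proof -
  have "(\<integral>\<^sup>+t\<in>{0<..}. ennreal (min a (t powr (- (3/2)))) \<partial>lborel) \<le>
    (\<integral>\<^sup>+t. ennreal (a powr (1/4)) * indicator {0..1} t + ennreal (a powr (1/4)) * (ennreal (t powr (- (9/8))) * indicator {1..} t) \<partial>lborel)"
  proof (rule nn_integral_mono)
    fix t :: real
    show "ennreal (min a (t powr (- (3/2)))) * indicator {0<..} t \<le>
      ennreal (a powr (1/4)) * indicator {0..1} t + ennreal (a powr (1/4)) * (ennreal (t powr (- (9/8))) * indicator {1..} t)"
    proof (cases "0 < t")
      case t: True
      have aa: "a \<le> a powr (1/4)" using a powr_mono'[of "1/4" 1 a] by simp
      show ?thesis
      proof (cases "t \<le> 1")
        case True
        have "ennreal (min a (t powr (- (3/2)))) \<le> ennreal (a powr (1/4))" using aa by (intro ennreal_leI) auto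
        then show ?thesis using t True by (simp add: add_increasing2)
      next
        case False
        let ?m = "min a (t powr (- (3/2)))"
        have m: "0 < ?m" using a t by simp
        have "?m = ?m powr (1/4) * ?m powr (3/4)" using m by (simp add: powr_add[symmetric])
        also have "\<dots> \<le> a powr (1/4) * (t powr (- (3/2))) powr (3/4)"
          using m by (intro mult_mono powr_mono2) auto
        also have "\<dots> = a powr (1/4) * t powr (- (9/8))" by (simp add: powr_powr)
        finally have "ennreal ?m \<le> ennreal (a powr (1/4)) * ennreal (t powr (- (9/8)))"
          by (subst ennreal_mult[symmetric]) (auto intro: ennreal_leI)
        then show ?thesis using t False by simp
      qed
    qed simp
  qed
  also have "\<dots> = ennreal (a powr (1/4) * (1 - 0)) + ennreal (a powr (1/4)) * ennreal (- (1 powr (- (9/8) + 1)) / (- (9/8) + 1))"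
    by (subst nn_integral_add, measurable, subst nn_integral_cmult, measurable,
        subst set_nn_integral_const_Icc, simp, simp, subst set_nn_integral_powr_to_inf) auto
  also have "\<dots> = ennreal (9 * a powr (1/4))"
  proof -
    have "- (1 powr (- (9/8) + 1)) / (- (9/8) + 1) = (8::real)" by simp
    moreover have "ennreal (a powr (1/4)) * ennreal 8 = ennreal (a powr (1/4) * 8)"
      by (rule ennreal_mult[symmetric]) auto
    ultimately show ?thesis by (simp only:) (subst ennreal_plus[symmetric], simp_all)
  qed
  finally show ?thesis .
qed

section \<open>Estimates of the Green's function\<close>

text \<open>The d-th power of u <= exp u at u = k x / d.\<close>

lemma power_le_exp:
  fixes k x :: real
  assumes "0 < k" "0 \<le> x" "0 < (d::nat)"
  shows "x ^ d \<le> (real d / k) ^ d * exp (k * x)"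
proof -
  have "x ^ d = (real d / k) ^ d * (k * x / real d) ^ d"
    using assms by (simp add: power_mult_distrib[symmetric])
  also have "\<dots> \<le> (real d / k) ^ d * exp (k * x / real d) ^ d"
  proof (intro mult_left_mono power_mono)
    show "k * x / real d \<le> exp (k * x / real d)"
      using exp_ge_add_one_self[of "k * x / real d"] by linarith
  qed (use assms in auto)
  also have "exp (k * x / real d) ^ d = exp (k * x)"
    using assms by (simp add: exp_of_nat_mult[symmetric])
  finally show ?thesis .
qed

locale schrodinger_setting =
  fixes P :: "'a::euclidean_space \<Rightarrow> 'w measure"
    and B :: "real \<Rightarrow> 'w \<Rightarrow> 'a"
    and V :: "'a \<Rightarrow> real"
    and g :: "real \<Rightarrow> real"
    and C1 C2 :: real
    and p :: "real \<Rightarrow> 'a \<Rightarrow> 'a \<Rightarrow> real"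
  assumes bm: "brownian_family P B"
    and V0: "\<And>x. 0 \<le> V x"
    and V_meas: "V \<in> borel_measurable borel"
    and V_bd: "locally_bounded V"
    and C1: "0 < C1" and C2: "0 < C2"
    and g: "g \<in> growth_class"
    and Vg: "\<And>x. 1 < norm x \<Longrightarrow> C1 * g (norm x) \<le> V x \<and> V x \<le> C2 * g (norm x)"
    and hk: "is_heat_kernel (schrodinger_semigroup P B V) p"
begin

text \<open>The potential is comparable to \<open>g\<close> only outside the unit ball, so the
  length scale is cut off at 1.\<close>

definition R :: "'a \<Rightarrow> 'a \<Rightarrow> real" where
  "R x y = max (max (norm x) (norm y)) 1"

abbreviation "M \<equiv> max_growth g"

lemma R: "1 \<le> R x y" "norm x \<le> R x y" "norm y \<le> R x y"
  by (auto simp: R_def)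

lemma norm_diff_le_R: "norm (x - y) \<le> 2 * R x y"
  using norm_triangle_ineq4[of x y] R(2,3)[of x y] R(2,3)[of y x] by simp

lemma M_ge_1: "1 \<le> M x y"
  using growth_classD(1)[OF g, of "norm x"] by (simp add: max_growth_def le_max_iff_disj)

lemma M_pos: "0 < M x y" using M_ge_1[of x y] by simp

text \<open>Above the cut-off, \<open>R x y\<close> is one of the two norms, and monotonicity
  interchanges \<open>g\<close> with the maximum.\<close>

lemma g_R: "1 < R x y \<Longrightarrow> g (R x y) = M x y"
  using growth_classD(2)[OF g, of "norm x" "norm y"] growth_classD(2)[OF g, of "norm y" "norm x"]
  by (auto simp: R_def max_growth_def max_def split: if_splits)

text \<open>At the cut-off \<open>R x y = 1\<close> the norms may be smaller than 1; the factor
  \<open>g 1\<close> pays for this.\<close>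

lemma g_R_le: "g (R x y) \<le> g 1 * M x y"
proof (cases "R x y = 1")
  case True then show ?thesis using M_ge_1[of x y] growth_classD(1)[OF g, of 1] by (simp add: mult_le_cancel_left1)
next
  case False
  then have "g (R x y) = M x y" using R(1)[of x y] by (intro g_R) auto
  then show ?thesis using M_pos[of x y] growth_classD(1)[OF g, of 1] by (simp add: mult_le_cancel_right1)
qed

section \<open>Two-sided bounds for the heat kernel\<close>

lemma kernel:
  assumes t: "0 < t"
  shows "feynman_kac_density x (P x) B V t (p t x)"
proof
  show "brownian_motion_from x (P x) B" using bm by (simp add: brownian_family_def)
  have "continuous_on UNIV (\<lambda>y. case (t, x, y) of (t, x, y) \<Rightarrow> p t x y)"
    by (rule continuous_on_compose2[where g="\<lambda>(t, x, y). p t x y" and t="{0<..} \<times> UNIV \<times> UNIV"])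
      (use hk t in \<open>auto simp: is_heat_kernel_def intro!: continuous_intros\<close>)
  then show "continuous_on UNIV (p t x)" by simp
  show "has_bochner_integral lborel (\<lambda>y. p t x y * f y)
     (prob_space.expectation (P x) (\<lambda>\<omega>. f (B t \<omega>) * exp (- (LBINT s:{0..t}. V (B s \<omega>)))))"
    if "continuous_on UNIV f" "bounded (range f)" for f
    using hk t that by (auto simp: is_heat_kernel_def schrodinger_semigroup_def)
qed (use hk t V0 V_meas V_bd in \<open>auto simp: is_heat_kernel_def\<close>)

text \<open>The weight in \<open>density_upper\<close> is at most 1. This crude bound handles
  bounded \<open>R x y\<close> in \<open>p_upper\<close>.\<close>

lemma p_le_gauss:
  assumes t: "0 < t" shows "p t x y \<le> gauss t x y"
proof -
  interpret K: feynman_kac_density x "P x" B V t "p t x" by (rule kernel[OF t])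
  have "p t x y \<le> 1 * gauss t x y"
  proof (rule K.density_upper[where a=0 and b=t and \<delta>=1])
    fix z s assume s: "0 < s" "s < t"
    have "(\<integral>\<^sup>+w. ennreal (exp (- (t - 0) * V w)) * ennreal (gauss (s * (t - s) / t) (x + (s / t) *\<^sub>R (z - x)) w) \<partial>lborel) \<le>
       (\<integral>\<^sup>+w. 1 * ennreal (gauss (s * (t - s) / t) (x + (s / t) *\<^sub>R (z - x)) w) \<partial>lborel)"
      using t V0 by (intro nn_integral_mono mult_right_mono) auto
    also have "\<dots> = ennreal 1" using s t by (simp add: nn_integral_gauss)
    finally show "(\<integral>\<^sup>+w. ennreal (exp (- (t - 0) * V w)) * ennreal (gauss (s * (t - s) / t) (x + (s / t) *\<^sub>R (z - x)) w) \<partial>lborel) \<le> ennreal 1" .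
  qed (use t in auto)
  then show ?thesis by simp
qed

text \<open>Bridge means are convex combinations of \<open>x\<close> and a point near
  \<open>y\<close>, hence of norm at most 2 R, and the variance is at most t / 4. So t <= 4 R^2 is
  exactly what brings the variance below R^2, as \<open>nn_integral_potential_gauss_le\<close>
  requires.\<close>

lemma p_lower:
  obtains C where "0 < C"
    "\<And>t x y. 0 < t \<Longrightarrow> t \<le> 4 * (R x y)\<^sup>2 \<Longrightarrow> exp (- (C * M x y * t)) * gauss t x y \<le> p t x y"
proof -
  obtain K where K: "0 < K" "\<And>w. V w \<le> K * g (norm w)"
    using potential_upper[OF g V_bd C2] Vg by blast
  obtain C where C: "0 < C" "\<And>R v m. 0 < R \<Longrightarrow> norm m \<le> 2 * R \<Longrightarrow> 0 < v \<Longrightarrow> v \<le> R\<^sup>2 \<Longrightarrow>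
      (\<integral>\<^sup>+w. ennreal (V w) * ennreal (gauss v m w) \<partial>lborel) \<le> ennreal (C * g R)"
    using nn_integral_potential_gauss_le[OF g K] by blast
  have g1: "1 \<le> g 1" using growth_classD(1)[OF g, of 1] by simp
  show thesis
  proof (rule that[of "C * g 1"])
    show "0 < C * g 1" using C g1 by simp
    fix t x y assume t: "0 < t" and tR: "t \<le> 4 * (R x y)\<^sup>2"
    interpret K: feynman_kac_density x "P x" B V t "p t x" by (rule kernel[OF t])
    have gR: "0 \<le> g (R x y)" using growth_classD(1)[OF g, of "R x y"] R(1)[of x y] by simp
    have "exp (- (C * g (R x y) * t)) * gauss t x y \<le> p t x y"
    proof (rule K.density_lower[where \<delta>=1])
      fix z s assume z: "dist y z < 1" and s: "0 < s" "s < t"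
      define \<theta> where "\<theta> = s / t"
      have \<theta>: "0 \<le> \<theta>" "\<theta> \<le> 1" using s t by (auto simp: \<theta>_def)
      show "(\<integral>\<^sup>+w. ennreal (V w) * ennreal (gauss (s * (t - s) / t) (x + (s / t) *\<^sub>R (z - x)) w) \<partial>lborel) \<le> ennreal (C * g (R x y))"
      proof (rule C(2))
        have "norm z \<le> norm y + norm (z - y)" by (rule norm_triangle_sub)
        \<comment> \<open>Endpoints within distance 1 of \<open>y\<close> have norm at most R + 1 <=
          2 R, thanks to the cut-off of \<open>R\<close> at 1.\<close>
        also have "\<dots> \<le> 2 * R x y" using z R(1)[of x y] R(3)[where x=x and y=y]
          by (simp add: dist_norm norm_minus_commute)
        finally have nz: "norm z \<le> 2 * R x y" .
        have nx: "norm x \<le> 2 * R x y" using R(1)[of x y] R(2)[of x y] by simp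
        have "x + (s / t) *\<^sub>R (z - x) = (1 - \<theta>) *\<^sub>R x + \<theta> *\<^sub>R z" by (simp add: \<theta>_def algebra_simps)
        then have "norm (x + (s / t) *\<^sub>R (z - x)) \<le> (1 - \<theta>) * norm x + \<theta> * norm z"
          using norm_triangle_ineq[of "(1 - \<theta>) *\<^sub>R x" "\<theta> *\<^sub>R z"] \<theta> by simp
        also have "\<dots> \<le> (1 - \<theta>) * (2 * R x y) + \<theta> * (2 * R x y)"
          using nx nz \<theta> by (intro add_mono mult_left_mono) auto
        finally show "norm (x + (s / t) *\<^sub>R (z - x)) \<le> 2 * R x y" by (simp add: algebra_simps)
        have "0 \<le> (s - t / 2)\<^sup>2" by simp
        then have "s * (t - s) \<le> t * (t / 4)" by (simp add: power2_eq_square algebra_simps)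
        then have "s * (t - s) / t \<le> t / 4" using t by (simp add: field_simps)
        with tR show "s * (t - s) / t \<le> (R x y)\<^sup>2" by linarith
      qed (use s t R(1)[of x y] in auto)
    qed (use C gR in auto)
    moreover have "exp (- (C * g 1 * M x y * t)) \<le> exp (- (C * g (R x y) * t))"
      using mult_right_mono[OF mult_left_mono[OF g_R_le[of x y], of C], of t] C t by (simp add: mult.assoc)
    ultimately show "exp (- (C * g 1 * M x y * t)) * gauss t x y \<le> p t x y"
      by (meson gauss_nonneg mult_right_mono order_trans)
  qed
qed

text \<open>The bridge is observed only during a time \<open>\<tau>\<close> next to the endpoint of larger norm: long
  enough to be killed there, too short to leave the region where \<open>V\<close> is comparable to \<open>M x y\<close>.\<close>

lemma p_upper:
  obtains C c where "0 < C" "0 < c"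
    "\<And>t x y. 0 < t \<Longrightarrow> p t x y \<le> C * gauss t x y * (exp (- (c * M x y * t)) + exp (- (c * (R x y * sqrt (M x y)))))"
proof -
  obtain c0 where c0: "1 \<le> c0" "\<And>r. 0 \<le> r \<Longrightarrow> g (2 * r) \<le> c0 * g r"
    using growth_class_doubling[OF g] by blast
  define k where "k = C1 / c0"
  have k: "0 < k" using C1 c0 by (simp add: k_def)
  \<comment> \<open>\<open>k / 10\<close> is the killing rate for the window t / 10, and 1 / 64 is
    the escape rate in \<open>nn_integral_exp_potential_gauss_le\<close>.\<close>
  define c where "c = min (k / 10) (1 / 64)"
  have c: "0 < c" "c \<le> k / 10" "c \<le> k" "c \<le> 1 / 64" using k by (auto simp: c_def)
  define E where "E = (2::real) powr (real DIM('a) / 2)"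
  have E: "0 < E" by (simp add: E_def)
  \<comment> \<open>The second entry settles R < 8, where R sqrt M is bounded.\<close>
  define C where "C = max (1 + E) (exp (c * (8 * sqrt (g 8))))"
  have C: "0 < C" using E by (simp add: C_def less_max_iff_disj)
  have "p t x y \<le> C * gauss t x y * (exp (- (c * M x y * t)) + exp (- (c * (R x y * sqrt (M x y)))))"
    if t: "0 < t" for t x y
  \<comment> \<open>From 8 on there is room: points of norm at least R / 2 lie outside the unit
    ball, and the bridge mean stays within R / 4 of the chosen endpoint although test endpoints vary
    by 1 / 10.\<close>
  proof (cases "R x y < 8")
    case True
    have "M x y \<le> g 8"
    proof -
      have "norm x \<le> 8" "norm y \<le> 8" using True by (auto simp: R_def)
      then show ?thesis unfolding max_growth_def by (auto intro!: growth_classD(2)[OF g])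
    qed
    then have "R x y * sqrt (M x y) \<le> 8 * sqrt (g 8)"
      using True R(1)[of x y] M_pos[of x y] by (intro mult_mono) auto
    then have "exp (c * (R x y * sqrt (M x y))) \<le> exp (c * (8 * sqrt (g 8)))" using c by simp
    also have "\<dots> \<le> C" by (simp add: C_def)
    finally have "exp (c * (R x y * sqrt (M x y))) * exp (- (c * (R x y * sqrt (M x y)))) \<le> C * exp (- (c * (R x y * sqrt (M x y))))"
      by (intro mult_right_mono) auto
    then have "1 \<le> C * exp (- (c * (R x y * sqrt (M x y))))" by (simp add: mult_exp_exp)
    also have "\<dots> \<le> C * (exp (- (c * M x y * t)) + exp (- (c * (R x y * sqrt (M x y)))))"
      using C by (intro mult_left_mono) auto
    finally have "1 * gauss t x y \<le> C * (exp (- (c * M x y * t)) + exp (- (c * (R x y * sqrt (M x y))))) * gauss t x y"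
      by (intro mult_right_mono) auto
    then show ?thesis using p_le_gauss[OF t, of x y] by (simp add: mult_ac)
  next
    case False
    then have R8: "8 \<le> R x y" by simp
    interpret K: feynman_kac_density x "P x" B V t "p t x" by (rule kernel[OF t])
    define m where "m = M x y"
    have m: "1 \<le> m" using M_ge_1 by (simp add: m_def)
    have mg: "m = g (R x y)" using g_R[of x y] R8 by (simp add: m_def)
    \<comment> \<open>t / 10 keeps the bridge mean close to the endpoint. At R / sqrt m the killing
      exponent \<tau> m and the escape exponent R^2 / \<tau> both equal R sqrt m, up to
      constants.\<close>
    define \<tau> where "\<tau> = min (t / 10) (R x y / sqrt m)"
    have "0 < t / 10" "0 < R x y / sqrt m" using t m R8 by auto
    then have "0 < \<tau>" unfolding \<tau>_def by (rule min_less_iff_conj[THEN iffD2, OF conjI])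
    then have \<tau>: "0 < \<tau>" "\<tau> \<le> t / 10" "\<tau> \<le> R x y / sqrt m"
      unfolding \<tau>_def by (blast intro: min.cobounded1 min.cobounded2)+
    define Q where "Q = exp (- \<tau> * (k * m)) + E * exp (- (R x y)\<^sup>2 / (64 * \<tau>))"
    have Q0: "0 \<le> Q" using E by (simp add: Q_def)
    have region: "(\<integral>\<^sup>+w. ennreal (exp (- \<tau> * V w)) * ennreal (gauss v n w) \<partial>lborel) \<le> ennreal Q"
      if e: "norm e = R x y" and n: "norm (n - e) \<le> R x y / 4" and v: "0 < v" "v \<le> \<tau>" for e n v
      unfolding Q_def E_def
    proof (rule nn_integral_exp_potential_gauss_le[OF _ V0 _ n v])
      fix w assume w: "norm (w - e) \<le> R x y / 2"
      have "norm e \<le> norm w + norm (e - w)" by (rule norm_triangle_sub)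
      then have nw: "R x y / 2 \<le> norm w" using w e by (simp add: norm_minus_commute)
      \<comment> \<open>Doubling read backwards: halving the radius costs the factor
        \<open>c0\<close>.\<close>
      have "m \<le> c0 * g (R x y / 2)" using c0(2)[of "R x y / 2"] R8 by (simp add: mg)
      also have "\<dots> \<le> c0 * g (norm w)" using c0(1) nw R8 by (intro mult_left_mono growth_classD(2)[OF g]) auto
      finally have "k * m \<le> k * (c0 * g (norm w))" using k by (intro mult_left_mono) auto
      also have "\<dots> = C1 * g (norm w)" using c0 by (simp add: k_def)
      also have "\<dots> \<le> V w" using Vg[of w] nw R8 by simp
      finally show "k * m \<le> V w" .
    qed (use R8 in auto)
    have pQ: "p t x y \<le> Q * gauss t x y"
    proof (cases "norm y \<le> norm x")
      case True
      then have e: "norm x = R x y" using R8 by (auto simp: R_def max_def split: if_splits)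
      show ?thesis
      proof (rule K.density_upper[where a=0 and b=\<tau> and \<delta>="1/10"])
        fix z s assume z: "dist y z < 1 / 10" and s: "0 < s" "s < \<tau>"
        have st: "s < t" using s \<tau> t by simp
        have s10: "s / t \<le> 1 / 10" using s \<tau> t by (simp add: field_simps)
        have "norm (z - x) \<le> norm (z - y) + norm (y - x)" using norm_triangle_ineq[of "z - y" "y - x"] by simp
        also have "\<dots> \<le> 1 / 10 + 2 * R x y" using z norm_diff_le_R[of x y] by (simp add: dist_norm norm_minus_commute)
        finally have "s / t * norm (z - x) \<le> 1 / 10 * (1 / 10 + 2 * R x y)" using s10 s t by (intro mult_mono) auto
        then have "norm (x + (s / t) *\<^sub>R (z - x) - x) \<le> R x y / 4" using R8 s t by simp
        moreover have "s * (t - s) / t \<le> \<tau>"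
        proof -
          have "s * (t - s) \<le> s * t" using s by (intro mult_left_mono) auto
          then have "s * (t - s) / t \<le> s" using t by (simp add: field_simps)
          then show ?thesis using s by simp
        qed
        moreover have "0 < s * (t - s) / t" using s st t by simp
        ultimately show "(\<integral>\<^sup>+w. ennreal (exp (- (\<tau> - 0) * V w)) * ennreal (gauss (s * (t - s) / t) (x + (s / t) *\<^sub>R (z - x)) w) \<partial>lborel) \<le> ennreal Q"
          using region[OF e] by simp
      qed (use \<tau> t Q0 in auto)
    next
      case False
      then have e: "norm y = R x y" using R8 by (auto simp: R_def max_def split: if_splits)
      show ?thesis
      proof (rule K.density_upper[where a="t - \<tau>" and b=t and \<delta>="1/10"])
        fix z s assume z: "dist y z < 1 / 10" and s: "t - \<tau> < s" "s < t"
        have st: "0 < s" "t - s < \<tau>" using s \<tau> t by auto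
        have s10: "1 - s / t \<le> 1 / 10" "0 \<le> 1 - s / t" using s \<tau> t by (auto simp: field_simps)
        have zy: "norm (z - y) \<le> 1 / 10" using z by (simp add: dist_norm norm_minus_commute)
        have "norm (x - z) \<le> norm (x - y) + norm (y - z)" using norm_triangle_ineq[of "x - y" "y - z"] by simp
        also have "\<dots> \<le> 2 * R x y + 1 / 10" using zy norm_diff_le_R[of x y] by (simp add: norm_minus_commute)
        finally have 1: "(1 - s / t) * norm (x - z) \<le> 1 / 10 * (2 * R x y + 1 / 10)" using s10 by (intro mult_mono) auto
        \<comment> \<open>The mean is expanded around the test endpoint \<open>z\<close>, which is
          itself close to \<open>y\<close>.\<close>
        have "x + (s / t) *\<^sub>R (z - x) - y = (1 - s / t) *\<^sub>R (x - z) + (z - y)" by (simp add: algebra_simps)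
        then have "norm (x + (s / t) *\<^sub>R (z - x) - y) \<le> norm ((1 - s / t) *\<^sub>R (x - z)) + norm (z - y)"
          by (simp only: norm_triangle_ineq)
        also have "norm ((1 - s / t) *\<^sub>R (x - z)) = (1 - s / t) * norm (x - z)" using s10(2) by simp
        also have "(1 - s / t) * norm (x - z) + norm (z - y) \<le> R x y / 4"
          by (rule order_trans[OF add_mono[OF 1 zy]]) (use R8 in \<open>simp add: field_simps\<close>)
        finally have "norm (x + (s / t) *\<^sub>R (z - x) - y) \<le> R x y / 4" .
        moreover have "s * (t - s) / t \<le> \<tau>"
        proof -
          have "s * (t - s) \<le> t * (t - s)" using s by (intro mult_right_mono) auto
          then have "s * (t - s) / t \<le> t - s" using t by (simp add: field_simps)
          then show ?thesis using st by simp
        qed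
        moreover have "0 < s * (t - s) / t" using s st t by simp
        ultimately show "(\<integral>\<^sup>+w. ennreal (exp (- (t - (t - \<tau>)) * V w)) * ennreal (gauss (s * (t - s) / t) (x + (s / t) *\<^sub>R (z - x)) w) \<partial>lborel) \<le> ennreal Q"
          using region[OF e] by simp
      qed (use \<tau> t Q0 in auto)
    qed
    have "Q \<le> (1 + E) * (exp (- (c * m * t)) + exp (- (c * (R x y * sqrt m))))"
    proof -
      have s2: "sqrt m * sqrt m = m" using m by simp
      have 1: "exp (- \<tau> * (k * m)) \<le> exp (- (c * m * t)) + exp (- (c * (R x y * sqrt m)))"
      proof (cases "t / 10 \<le> R x y / sqrt m")
        case True
        then have "\<tau> * (k * m) = (k / 10) * (m * t)" by (simp add: \<tau>_def)
        moreover have "c * (m * t) \<le> (k / 10) * (m * t)" using c m t by (intro mult_right_mono) auto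
        ultimately have "c * m * t \<le> \<tau> * (k * m)" by (simp only: mult.assoc)
        then have "exp (- \<tau> * (k * m)) \<le> exp (- (c * m * t))" by (simp only: mult_minus_left exp_le_cancel_iff neg_le_iff_le)
        then show ?thesis by (simp add: add_increasing2)
      next
        case False
        then have "\<tau> * (k * m) = R x y / sqrt m * (k * (sqrt m * sqrt m))" using s2 by (simp add: \<tau>_def)
        also have "\<dots> = R x y / sqrt m * sqrt m * (k * sqrt m)" by (simp only: mult_ac)
        also have "R x y / sqrt m * sqrt m = R x y" using m by simp
        also have "R x y * (k * sqrt m) = k * (R x y * sqrt m)" by (simp only: mult_ac)
        finally have "\<tau> * (k * m) = k * (R x y * sqrt m)" .
        moreover have "c * (R x y * sqrt m) \<le> k * (R x y * sqrt m)" using c m R8 by (intro mult_right_mono) auto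
        ultimately have "exp (- \<tau> * (k * m)) \<le> exp (- (c * (R x y * sqrt m)))"
          by (simp only: mult_minus_left exp_le_cancel_iff neg_le_iff_le)
        then show ?thesis by (simp add: add_increasing)
      qed
      have "c * (R x y * sqrt m) \<le> 1 / 64 * (R x y * sqrt m)" using c m R8 by (intro mult_right_mono) auto
      also have "\<dots> = (R x y)\<^sup>2 / (64 * (R x y / sqrt m))" using R8 m by (simp add: power2_eq_square field_simps)
      also have "\<dots> \<le> (R x y)\<^sup>2 / (64 * \<tau>)" using \<tau> R8 m by (intro divide_left_mono) auto
      finally have "exp (- (R x y)\<^sup>2 / (64 * \<tau>)) \<le> exp (- (c * (R x y * sqrt m)))" by simp
      also have "\<dots> \<le> exp (- (c * m * t)) + exp (- (c * (R x y * sqrt m)))" by simp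
      finally have "E * exp (- (R x y)\<^sup>2 / (64 * \<tau>)) \<le> E * (exp (- (c * m * t)) + exp (- (c * (R x y * sqrt m))))"
        using E by (intro mult_left_mono) auto
      with 1 show ?thesis unfolding Q_def distrib_right mult_1_left by (rule add_mono)
    qed
    also have "\<dots> \<le> C * (exp (- (c * m * t)) + exp (- (c * (R x y * sqrt m))))"
      by (intro mult_right_mono) (auto simp: C_def)
    finally have "Q * gauss t x y \<le> C * (exp (- (c * m * t)) + exp (- (c * (R x y * sqrt m)))) * gauss t x y"
      by (intro mult_right_mono) auto
    with pQ show ?thesis by (simp add: m_def mult_ac)
  qed
  with C c(1) show thesis using that by blast
qed

text \<open>V >= C1 outside the unit ball. So either an observed position lies outside and its
  window kills exponentially in \<open>t\<close>, or both lie in the ball. Two such positions leave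
  three transition densities of order at most t^(-1/2); one position would leave only t^(-1) for d =
  1, which is not integrable.\<close>

lemma p_decay:
  obtains C where "0 < C" "\<And>t x y. 1 \<le> t \<Longrightarrow> p t x y \<le> C * t powr (- (3 / 2))"
proof -
  \<comment> \<open>The gaps between 0, \<open>r\<close>, \<open>s\<close> and \<open>t\<close> all
    exceed t / 5, and (t / 5)^(-d/2) = 5^(d/2) t^(-d/2).\<close>
  define K :: real where "K = 5 powr (real DIM('a) / 2)"
  have K: "0 < K" by (simp add: K_def)
  define \<nu> where "\<nu> = measure lborel (cball (0::'a) 1)"
  define C where "C = K * (5 / C1) + K ^ 3 * \<nu>\<^sup>2"
  have C: "0 < C" using K C1 by (simp add: C_def add_pos_nonneg)
  have "p t x y \<le> C * t powr (- (3 / 2))" if t: "1 \<le> t" for t x y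
  proof -
    interpret K: feynman_kac_density x "P x" B V t "p t x" using t by (intro kernel) auto
    define k where "k = K * t powr (- (1 / 2))"
    have k: "0 \<le> k" using K by (simp add: k_def)
    have gk: "gauss u v w \<le> k" if u: "t / 5 \<le> u" for u and v w :: 'a
    proof -
      have u0: "0 < u" using u t by simp
      have "1 * u \<le> 2 * pi * u" using u0 pi_gt3 by (intro mult_right_mono) auto
      then have 2: "t / 5 \<le> 2 * pi * u" using u by linarith
      have "gauss u v w \<le> (2 * pi * u) powr (- (real DIM('a) / 2))" by (rule gauss_le[OF u0])
      also have "\<dots> \<le> (t / 5) powr (- (real DIM('a) / 2))" using 2 t by (intro powr_mono2') auto
      also have "\<dots> = K * t powr (- (real DIM('a) / 2))"
        by (simp add: K_def powr_divide powr_minus field_simps)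
      also have "\<dots> \<le> K * t powr (- (1 / 2))"
        using t K DIM_positive[where 'a='a] by (intro mult_left_mono powr_mono) (auto simp: Suc_le_eq)
      finally show ?thesis by (simp add: k_def)
    qed
    define e where "e = exp (- (t / 5) * C1)"
    have V1: "exp (- (t / 5) * V v) \<le> e" if "v \<notin> cball 0 1" for v
    proof -
      have "C1 * 1 \<le> C1 * g (norm v)" using C1 growth_classD(1)[OF g, of "norm v"] by (intro mult_left_mono) auto
      also have "\<dots> \<le> V v" using Vg[of v] that by auto
      finally show ?thesis using t by (simp add: e_def)
    qed
    have V2: "exp (- (t / 5) * V v) \<le> 1" for v using t V0[of v] by simp
    have h: "ennreal (exp (- (t / 5) * V v)) * ennreal (exp (- (t / 5) * V w)) \<le>
        ennreal e + indicator (cball 0 1) v * indicator (cball 0 1) w" for v w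
    proof (cases "v \<in> cball 0 1 \<and> w \<in> cball 0 1")
      case True
      have "exp (- (t / 5) * V v) * exp (- (t / 5) * V w) \<le> 1 * 1" by (intro mult_mono V2) auto
      then have "ennreal (exp (- (t / 5) * V v)) * ennreal (exp (- (t / 5) * V w)) \<le> 1"
        by (simp add: ennreal_mult[symmetric])
      then show ?thesis using True by (simp add: add_increasing)
    next
      case False
      have "exp (- (t / 5) * V v) * exp (- (t / 5) * V w) \<le> e"
      proof (cases "v \<in> cball 0 1")
        case True
        then have "exp (- (t / 5) * V v) * exp (- (t / 5) * V w) \<le> 1 * e" using False by (intro mult_mono V1 V2) auto
        then show ?thesis by simp
      next
        case False
        then have "exp (- (t / 5) * V v) * exp (- (t / 5) * V w) \<le> e * 1" by (intro mult_mono V1 V2) (auto simp: e_def)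
        then show ?thesis by simp
      qed
      then have "ennreal (exp (- (t / 5) * V v)) * ennreal (exp (- (t / 5) * V w)) \<le> ennreal e"
        by (simp add: ennreal_mult[symmetric] ennreal_leI)
      then show ?thesis by (simp add: add_increasing2)
    qed
    have "p t x y \<le> k * e + k ^ 3 * \<nu>\<^sup>2"
    proof (rule K.density_upper2[where a="t / 5" and b="2 * t / 5" and c="3 * t / 5" and d="4 * t / 5" and \<delta>=1])
      fix z r s assume rs: "t / 5 < r" "r < 2 * t / 5" "3 * t / 5 < s" "s < 4 * t / 5"
      have d: "2 * t / 5 - t / 5 = t / 5" "4 * t / 5 - 3 * t / 5 = t / 5" by simp_all
      show "(\<integral>\<^sup>+v. ennreal (gauss r x v) * (\<integral>\<^sup>+w. ennreal (gauss (s - r) v w) *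
          (ennreal (gauss (t - s) w z) * (ennreal (exp (- (2 * t / 5 - t / 5) * V v)) * ennreal (exp (- (4 * t / 5 - 3 * t / 5) * V w)))) \<partial>lborel) \<partial>lborel)
          \<le> ennreal (k * e + k ^ 3 * \<nu>\<^sup>2)"
        unfolding d \<nu>_def
        by (rule nn_integral_three_gauss_le[OF _ _ k _ _ _ h]) (use rs t in \<open>auto intro!: gk simp: e_def\<close>)
    qed (use t k in \<open>auto simp: e_def\<close>)
    also have "\<dots> \<le> C * t powr (- (3 / 2))"
    proof -
      \<comment> \<open>Of the exponential decay only a factor 1 / t is used, which with
        \<open>k\<close> gives t^(-3/2).\<close>
      have "1 + t / 5 * C1 \<le> exp (t / 5 * C1)" by (rule exp_ge_add_one_self)
      then have "t / 5 * C1 \<le> exp (t / 5 * C1)" by linarith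
      then have "t / 5 * C1 * e \<le> exp (t / 5 * C1) * e" by (intro mult_right_mono) (auto simp: e_def)
      then have "t / 5 * C1 * e \<le> 1" by (simp add: e_def mult_exp_exp)
      then have "e \<le> 5 / C1 * (1 / t)" using C1 t by (simp add: field_simps)
      then have "k * e \<le> K * t powr (- (1 / 2)) * (5 / C1 * (1 / t))"
        unfolding k_def using K by (intro mult_left_mono) auto
      also have "\<dots> = K * (5 / C1) * t powr (- (3 / 2))"
        using t powr_add[of t "- (1 / 2)" "- 1"] by (simp add: powr_minus_divide)
      finally have 1: "k * e \<le> K * (5 / C1) * t powr (- (3 / 2))" .
      have "(t powr (- (1 / 2))) ^ 3 = t powr (- (3 / 2))" using t by (simp add: powr_power)
      then have 2: "k ^ 3 * \<nu>\<^sup>2 = K ^ 3 * \<nu>\<^sup>2 * t powr (- (3 / 2))" by (simp add: k_def power_mult_distrib)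
      show ?thesis unfolding C_def distrib_right 2 using 1 by simp
    qed
    finally show ?thesis .
  qed
  with C show thesis using that by blast
qed

text \<open>At t = R / sqrt M the exponents M t and R sqrt M coincide. Before this time the second
  term of \<open>p_upper\<close> is absorbed by the first. After it both are at most exp (- k R sqrt
  M), and the free kernel is below a power of R sqrt M, which half of the rate absorbs.\<close>

lemma p_upper_split:
  obtains C c where "0 < C" "0 < c"
    "\<And>t x y. 0 < t \<Longrightarrow> p t x y \<le> C * (gauss t x y * exp (- (c * M x y * t)) +
       min (exp (- (c * (R x y * sqrt (M x y))))) (t powr (- (3 / 2))))"
proof -
  obtain CA k where A: "0 < CA" "0 < k" "\<And>t x y. 0 < t \<Longrightarrow>
      p t x y \<le> CA * gauss t x y * (exp (- (k * M x y * t)) + exp (- (k * (R x y * sqrt (M x y)))))"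
    using p_upper by blast
  obtain CB where B: "0 < CB" "\<And>t x y. 1 \<le> t \<Longrightarrow> p t x y \<le> CB * t powr (- (3 / 2))"
    using p_decay by blast
  define c where "c = k / 2"
  have c: "0 < c" "c \<le> k" "c + c = k" using A by (simp_all add: c_def)
  define d where "d = DIM('a)"
  have d: "0 < d" by (simp add: d_def)
  define K where "K = (real d / c) ^ d"
  have K: "0 \<le> K" using c by (simp add: K_def)
  define C where "C = max (2 * CA) (max (2 * CA * K) CB)"
  have C: "0 < C" "2 * CA \<le> C" "2 * CA * K \<le> C" "CB \<le> C" using A(1) by (auto simp: C_def less_max_iff_disj)
  have "p t x y \<le> C * (gauss t x y * exp (- (c * M x y * t)) +
       min (exp (- (c * (R x y * sqrt (M x y))))) (t powr (- (3 / 2))))" if t: "0 < t" for t x y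
  proof -
    define m where "m = M x y"
    define s where "s = R x y * sqrt m"
    have m: "1 \<le> m" using M_ge_1 by (simp add: m_def)
    have sm: "sqrt m \<le> s" "1 \<le> s" using m R(1)[of x y] mult_mono[of 1 "R x y" 1 "sqrt m"] by (simp_all add: s_def)
    have mm: "sqrt m * sqrt m = m" using m by simp
    have aux: "u * u * (w / u) = w * u" if "u \<noteq> 0" for u w :: real using that by simp
    show ?thesis
    proof (cases "t \<le> R x y / sqrt m")
      case True
      have "m * t \<le> m * (R x y / sqrt m)" using True m by (intro mult_left_mono) auto
      also have "\<dots> = sqrt m * sqrt m * (R x y / sqrt m)" by (simp only: mm)
      also have "\<dots> = s" unfolding s_def using m by (intro aux) auto
      finally have mt: "k * (m * t) \<le> k * s" using A(2) by (intro mult_left_mono) auto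
      have "c * (m * t) \<le> k * (m * t)" using c m t by (intro mult_right_mono) auto
      with mt have "exp (- (k * m * t)) \<le> exp (- (c * m * t))" "exp (- (k * s)) \<le> exp (- (c * m * t))"
        unfolding exp_le_cancel_iff neg_le_iff_le mult.assoc by (blast intro: order_trans)+
      then have "exp (- (k * m * t)) + exp (- (k * s)) \<le> 2 * exp (- (c * m * t))" by linarith
      then have "CA * gauss t x y * (exp (- (k * m * t)) + exp (- (k * s))) \<le> CA * gauss t x y * (2 * exp (- (c * m * t)))"
        using A(1) by (intro mult_left_mono) auto
      also have "\<dots> = 2 * CA * (gauss t x y * exp (- (c * m * t)))" by simp
      also have "\<dots> \<le> C * (gauss t x y * exp (- (c * m * t)))" using C by (intro mult_right_mono) auto
      also have "\<dots> \<le> C * (gauss t x y * exp (- (c * m * t)) + min (exp (- (c * s))) (t powr (- (3 / 2))))"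
        using C by (intro mult_left_mono) auto
      finally show ?thesis using A(3)[OF t, of x y] by (simp add: m_def s_def)
    next
      case False
      have "m * (R x y / sqrt m) = sqrt m * sqrt m * (R x y / sqrt m)" by (simp only: mm)
      also have "\<dots> = s" unfolding s_def using m by (intro aux) auto
      finally have "s \<le> m * t" using False m mult_left_mono[of "R x y / sqrt m" t m] by simp
      then have ks: "k * s \<le> k * (m * t)" using A(2) by (intro mult_left_mono) auto
      have "gauss t x y \<le> s ^ d"
      proof -
        have "t * 1 \<le> t * (2 * pi)" using t pi_gt3 by (intro mult_left_mono) auto
        then have tp: "t \<le> 2 * pi * t" by (simp add: mult.commute)
        \<comment> \<open>As R >= 1, the late times are at least 1 / s, which bounds the Gaussian
          prefactor by a power of \<open>s\<close>.\<close>
        have "1 / s \<le> R x y / sqrt m"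
        proof -
          have "1 \<le> R x y * R x y" using R(1)[of x y] mult_mono[of 1 "R x y" 1 "R x y"] by simp
          then have "sqrt m \<le> (R x y * R x y) * sqrt m" using m by (simp add: mult_le_cancel_right1)
          then have "sqrt m \<le> R x y * s" by (simp only: s_def mult.assoc)
          then show ?thesis using m sm by (simp add: field_simps)
        qed
        then have st: "1 / s \<le> 2 * pi * t" using False tp by simp
        have "gauss t x y \<le> (2 * pi * t) powr (- (real d / 2))" using gauss_le[OF t, of x y] by (simp add: d_def)
        also have "\<dots> \<le> (1 / s) powr (- (real d / 2))" using st sm by (intro powr_mono2') auto
        also have "\<dots> = s powr (real d / 2)" by (simp only: powr_minus powr_divide powr_one_eq_one inverse_divide div_by_1)
        also have "\<dots> \<le> s powr real d" using sm by (intro powr_mono) auto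
        finally show ?thesis using sm by (simp add: powr_realpow)
      qed
      also have "s ^ d \<le> K * exp (c * s)" unfolding K_def using c sm d by (intro power_le_exp) auto
      finally have gs: "gauss t x y \<le> K * exp (c * s)" .
      have "exp (- (k * m * t)) + exp (- (k * s)) \<le> 2 * exp (- (k * s))"
        using ks by (simp add: mult.assoc)
      then have "CA * gauss t x y * (exp (- (k * m * t)) + exp (- (k * s))) \<le> CA * (K * exp (c * s)) * (2 * exp (- (k * s)))"
        using A(1) gs K by (intro mult_mono) auto
      also have "\<dots> = 2 * CA * K * (exp (c * s) * exp (- (k * s)))" by simp
      also have "exp (c * s) * exp (- (k * s)) = exp (- (c * s))"
        by (simp add: mult_exp_exp c(3)[symmetric] distrib_right)
      also have "2 * CA * K * exp (- (c * s)) \<le> C * exp (- (c * s))" using C by (intro mult_right_mono) auto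
      finally have p1: "p t x y \<le> C * exp (- (c * s))" using A(3)[OF t, of x y] by (simp add: m_def s_def)
      have "p t x y \<le> C * min (exp (- (c * s))) (t powr (- (3 / 2)))"
      proof (cases "1 \<le> t")
        case True
        have "p t x y \<le> CB * t powr (- (3 / 2))" by (rule B(2)[OF True])
        also have "\<dots> \<le> C * t powr (- (3 / 2))" using C by (intro mult_right_mono) auto
        finally show ?thesis using p1 by (simp add: min_def)
      next
        case False
        \<comment> \<open>For t < 1 the minimum is the exponential, because t^(-3/2) >= 1.\<close>
        have "exp (- (c * s)) \<le> 1" using c sm by simp
        also have "1 = 1 powr (- (3 / 2) :: real)" by simp
        also have "\<dots> \<le> t powr (- (3 / 2))" using t False by (intro powr_mono2') auto
        finally show ?thesis using p1 by (simp add: min_def)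
      qed
      also have "\<dots> \<le> C * (gauss t x y * exp (- (c * m * t)) + min (exp (- (c * s))) (t powr (- (3 / 2))))"
        using C by (intro mult_left_mono) auto
      finally show ?thesis by (simp add: m_def s_def)
    qed
  qed
  with C(1) c(1) show thesis using that by blast
qed

text \<open>Real-valued, with |x-y| already cancelled for d = 1, so that one formula covers the
  diagonal of the line as well.\<close>

definition bound :: "real \<Rightarrow> 'a \<Rightarrow> 'a \<Rightarrow> real" where
  "bound c x y =
    (let r = norm (x - y); u = r * sqrt (M x y) in
     exp (- (c * u)) *
       (if DIM('a) \<ge> 3 then r powr (2 - real DIM('a))
        else if DIM('a) = 2 then max (ln (1 / u)) 1
        else 1 / sqrt (M x y)))"

lemma bound_nonneg: "0 \<le> bound c x y"
  using M_pos[of x y] by (auto simp: bound_def Let_def intro!: mult_nonneg_nonneg)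

lemma bound_antimono: "c \<le> c' \<Longrightarrow> bound c' x y \<le> bound c x y"
  unfolding bound_def Let_def using M_pos[of x y]
  by (intro mult_right_mono) (auto intro!: mult_right_mono)

lemma green_bound_eq:
  assumes "x \<noteq> y \<or> DIM('a) = 1"
  shows "green_bound g c x y = ennreal (bound c x y)"
proof (cases "x = y")
  case True
  then show ?thesis using assms by (simp add: green_bound_def bound_def Let_def)
next
  case False
  then have r: "0 < norm (x - y)" by simp
  consider "DIM('a) \<ge> 3" | "DIM('a) = 2" | "DIM('a) = 1"
    using DIM_positive[where 'a='a] by linarith
  then show ?thesis
  proof cases
    case 1 then show ?thesis using False by (simp add: green_bound_def bound_def Phi_def Let_def mult_ac)
  next
    case 2 then show ?thesis using False by (simp add: green_bound_def bound_def Phi_def Let_def mult_ac)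
  next
    case 3
    have "norm (x - y) * (1 / (norm (x - y) * sqrt (M x y))) = 1 / sqrt (M x y)" using r by simp
    then show ?thesis using 3 False r
      by (simp add: green_bound_def bound_def Phi_def Let_def mult_ac)
  qed
qed

section \<open>Integration of the kernel bounds in time\<close>

lemma gauss_eq:
  "0 < t \<Longrightarrow> gauss t x (y::'a) * exp (- (c * t)) =
    (2 * pi) powr (- (real DIM('a) / 2)) * (t powr (- (real DIM('a) / 2)) * exp (- (norm (x - y))\<^sup>2 / (2 * t) - c * t))"
  by (simp add: gauss_def powr_mult mult.assoc mult_exp_exp)

lemma heat_time_integral_upper:
  assumes k: "0 < k"
  obtains C c where "0 < C" "0 < c"
    "\<And>x y. x \<noteq> y \<or> DIM('a) = 1 \<Longrightarrow>
      (\<integral>\<^sup>+t\<in>{0<..}. ennreal (t powr (- (real DIM('a) / 2)) * exp (- (norm (x - y))\<^sup>2 / (2 * t) - k * M x y * t)) \<partial>lborel)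
        \<le> ennreal (C * bound c x y)"
proof -
  let ?I = "\<lambda>x y. \<integral>\<^sup>+t\<in>{0<..}. ennreal (t powr (- (real DIM('a) / 2)) * exp (- (norm (x - y))\<^sup>2 / (2 * t) - k * M x y * t)) \<partial>lborel"
  have c: "0 < sqrt (k / 2)" using k by simp
  consider "DIM('a) \<ge> 3" | "DIM('a) = 2" | "DIM('a) = 1"
    using DIM_positive[where 'a='a] by linarith
  then show thesis
  proof cases
    case 1
    have "?I x y \<le> ennreal (((4 * real DIM('a)) ^ DIM('a) + 2) * bound (sqrt (k / 2)) x y)" if "x \<noteq> y \<or> DIM('a) = 1" for x y
      using heat_time_integral_upper_3[of "norm (x - y)" k "M x y" "DIM('a)"] that 1 k M_pos[of x y]
      by (simp add: bound_def Let_def mult_ac)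
    then show thesis by (intro that[of "(4 * real DIM('a)) ^ DIM('a) + 2" "sqrt (k / 2)"] c) (auto simp: add_nonneg_pos)
  next
    case 2
    have "?I x y \<le> ennreal ((6 + 2 / k) * bound (sqrt (k / 2)) x y)" if "x \<noteq> y \<or> DIM('a) = 1" for x y
      using heat_time_integral_upper_2[of "norm (x - y)" k "M x y"] that 2 k M_pos[of x y]
      by (simp add: bound_def Let_def mult_ac)
    then show thesis using k by (intro that[of "6 + 2 / k" "sqrt (k / 2)"] c) (auto simp: add_pos_pos)
  next
    case 3
    have "?I x y \<le> ennreal ((2 + 2 / k) * bound (sqrt (k / 2)) x y)" if "x \<noteq> y \<or> DIM('a) = 1" for x y
      using heat_time_integral_upper_1[of "norm (x - y)" k "M x y"] 3 k M_pos[of x y]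
      by (simp add: bound_def Let_def mult_ac)
    then show thesis using k by (intro that[of "2 + 2 / k" "sqrt (k / 2)"] c) (auto simp: add_pos_pos)
  qed
qed

text \<open>With s = R sqrt M one has |x-y| sqrt M <= 2 s, so part of the rate gives the decay in
  |x-y|. The rest pays for the prefactor, which is never much smaller than a negative power of
  \<open>s\<close>: |x-y| <= 2 s matters for d >= 3 and sqrt M <= s for d = 1.\<close>

lemma exp_le_bound:
  assumes k: "0 < k"
  obtains C c where "0 < C" "0 < c"
    "\<And>x y. x \<noteq> y \<or> DIM('a) = 1 \<Longrightarrow> exp (- (k * (R x y * sqrt (M x y)))) \<le> C * bound c x y"
proof -
  define d where "d = DIM('a)"
  have d: "0 < d" by (simp add: d_def)
  \<comment> \<open>Of the four quarters of the rate, two go to |x-y| sqrt M <= 2 s and one to the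
    prefactor.\<close>
  define c where "c = k / 4"
  have c: "0 < c" using k by (simp add: c_def)
  define C where "C = (2 * real d / c) ^ d + 1 + 1 / c"
  have C1: "0 < C" "1 \<le> C" "1 / c \<le> C" "(2 * real d / c) ^ d \<le> C" using c by (auto simp: C_def add_pos_pos add_nonneg_pos)
  have "exp (- (k * (R x y * sqrt (M x y)))) \<le> C * bound c x y" if xy: "x \<noteq> y \<or> DIM('a) = 1" for x y
  proof -
    define m where "m = M x y"
    define s where "s = R x y * sqrt m"
    define r where "r = norm (x - y)"
    define e where "e = exp (- (c * (r * sqrt m)))"
    have m: "1 \<le> m" using M_ge_1 by (simp add: m_def)
    have sm: "sqrt m \<le> s" "1 \<le> s" "R x y \<le> s"
      using m R(1)[of x y] mult_mono[of 1 "R x y" 1 "sqrt m"] by (simp_all add: s_def)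
    have r: "0 \<le> r" "r \<le> 2 * R x y" using norm_diff_le_R[of x y] by (simp_all add: r_def)
    have "r * sqrt m \<le> 2 * s" using mult_right_mono[OF r(2), of "sqrt m"] m by (simp add: s_def)
    then have "c * (r * sqrt m) \<le> c * (2 * s)" using c by (intro mult_left_mono) auto
    moreover have "c * s + c * (2 * s) = 3 / 4 * (k * s)" by (simp add: c_def)
    moreover have "0 \<le> k * s" using k sm by simp
    ultimately have "c * s + c * (r * sqrt m) \<le> k * s" by linarith
    then have "exp (- (k * s)) \<le> exp (- (c * s)) * e" by (simp add: e_def mult_exp_exp)
    moreover have "exp (- (c * s)) \<le> C * (if DIM('a) \<ge> 3 then r powr (2 - real DIM('a))
        else if DIM('a) = 2 then max (ln (1 / (r * sqrt m))) 1 else 1 / sqrt m)"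
    proof -
      consider "DIM('a) \<ge> 3" | "DIM('a) = 2" | "DIM('a) = 1"
        using DIM_positive[where 'a='a] by linarith
      then show ?thesis
      proof cases
        case 1
        have r0: "0 < r" using xy 1 by (auto simp: r_def)
        have "r powr (real d - 2) \<le> (2 * s) powr (real d - 2)"
          using r0 r sm 1 by (intro powr_mono2) (auto simp: d_def)
        also have "\<dots> \<le> (2 * s) powr real d" using sm by (intro powr_mono) auto
        also have "\<dots> = 2 ^ d * s ^ d" using sm by (simp add: powr_realpow power_mult_distrib)
        also have "\<dots> \<le> 2 ^ d * ((real d / c) ^ d * exp (c * s))"
          using c sm d by (intro mult_left_mono power_le_exp) auto
        also have "\<dots> = (2 * real d / c) ^ d * exp (c * s)"
          by (simp add: power_mult_distrib power_divide)
        also have "\<dots> \<le> C * exp (c * s)" using C1 by (intro mult_right_mono) auto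
        finally have 2: "r powr (real d - 2) \<le> C * exp (c * s)" .
        have "exp (- (c * s)) = (r powr (2 - real d) * exp (- (c * s))) * r powr (real d - 2)"
          using r0 by (simp add: mult_ac powr_add[symmetric])
        also have "\<dots> \<le> (r powr (2 - real d) * exp (- (c * s))) * (C * exp (c * s))"
          using 2 by (intro mult_left_mono) auto
        also have "\<dots> = C * r powr (2 - real d)" by (simp add: mult_exp_exp mult_ac)
        finally show ?thesis using 1 by (simp add: d_def)
      next
        case 2
        have "exp (- (c * s)) \<le> 1" using c sm by simp
        also have "\<dots> \<le> C * 1" using C1 by simp
        also have "\<dots> \<le> C * max (ln (1 / (r * sqrt m))) 1" using C1 by (intro mult_left_mono) auto
        finally show ?thesis using 2 by simp
      next
        case 3
        have "1 + c * s \<le> exp (c * s)" by (rule exp_ge_add_one_self)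
        then have "c * s \<le> exp (c * s)" by linarith
        then have "c * s * exp (- (c * s)) \<le> exp (c * s) * exp (- (c * s))" by (intro mult_right_mono) auto
        then have "c * s * exp (- (c * s)) \<le> 1" by (simp add: mult_exp_exp)
        then have "exp (- (c * s)) \<le> 1 / c * (1 / s)" using c sm by (simp add: field_simps)
        also have "\<dots> \<le> C * (1 / sqrt m)" using C1 c sm m by (intro mult_mono divide_left_mono) auto
        finally show ?thesis using 3 by simp
      qed
    qed
    ultimately have "exp (- (k * s)) \<le> C * (if DIM('a) \<ge> 3 then r powr (2 - real DIM('a))
        else if DIM('a) = 2 then max (ln (1 / (r * sqrt m))) 1 else 1 / sqrt m) * e"
      by (rule order_trans[OF _ mult_right_mono]) (simp add: e_def)
    then show ?thesis
      unfolding bound_def Let_def r_def[symmetric] m_def[symmetric] s_def[symmetric] e_def[symmetric]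
      by (simp only: mult_ac)
  qed
  with C1(1) c show thesis using that by blast
qed

lemma green_upper:
  obtains C c where "0 < C" "0 < c"
    "\<And>x y. x \<noteq> y \<or> DIM('a) = 1 \<Longrightarrow> green_function p x y \<le> ennreal (C * bound c x y)"
proof -
  obtain CS k where S: "0 < CS" "0 < k" "\<And>t x y. 0 < t \<Longrightarrow> p t x y \<le> CS * (gauss t x y * exp (- (k * M x y * t)) +
       min (exp (- (k * (R x y * sqrt (M x y))))) (t powr (- (3 / 2))))"
    using p_upper_split by blast
  obtain CI ci where I: "0 < CI" "0 < ci" "\<And>x y. x \<noteq> y \<or> DIM('a) = 1 \<Longrightarrow>
      (\<integral>\<^sup>+t\<in>{0<..}. ennreal (t powr (- (real DIM('a) / 2)) * exp (- (norm (x - y))\<^sup>2 / (2 * t) - k * M x y * t)) \<partial>lborel)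
        \<le> ennreal (CI * bound ci x y)"
    using heat_time_integral_upper[OF S(2)] by blast
  \<comment> \<open>Only the power 1 / 4 of the exponential survives
    \<open>set_nn_integral_min_powr_le\<close>.\<close>
  have "0 < k / 4" using S by simp
  then obtain CE ce where E: "0 < CE" "0 < ce"
    "\<And>x y. x \<noteq> y \<or> DIM('a) = 1 \<Longrightarrow> exp (- (k / 4 * (R x y * sqrt (M x y)))) \<le> CE * bound ce x y"
    using exp_le_bound by blast
  \<comment> \<open>\<open>bound\<close> decreases in the rate, so the smaller rate serves both
    parts.\<close>
  define c where "c = min ci ce"
  have c: "0 < c" "c \<le> ci" "c \<le> ce" using I E by (auto simp: c_def)
  define q where "q = (2 * pi) powr (- (real DIM('a) / 2))"
  have q: "0 < q" by (simp add: q_def)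
  define C where "C = CS * q * CI + CS * 9 * CE"
  have C: "0 < C" using S I E q by (simp add: C_def add_pos_pos)
  have "green_function p x y \<le> ennreal (C * bound c x y)" if xy: "x \<noteq> y \<or> DIM('a) = 1" for x y
  proof -
    define f where "f t = t powr (- (real DIM('a) / 2)) * exp (- (norm (x - y))\<^sup>2 / (2 * t) - k * M x y * t)" for t
    define s where "s = R x y * sqrt (M x y)"
    have s: "0 \<le> s" using R(1)[of x y] M_pos[of x y] by (simp add: s_def)
    define a where "a = exp (- (k * s))"
    have a: "0 < a" "a \<le> 1" "a powr (1 / 4) = exp (- (k / 4 * s))"
      using S s by (simp_all add: a_def powr_def)
    define h where "h t = min a (t powr (- (3/2)))" for t :: real
    have f0: "0 \<le> f t" and h0: "0 \<le> h t" for t using a by (simp_all add: f_def h_def)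
    have [measurable]: "f \<in> borel_measurable borel" "h \<in> borel_measurable borel"
      unfolding f_def[abs_def] h_def[abs_def] by measurable
    have "green_function p x y \<le> (\<integral>\<^sup>+t. ennreal (CS * q) * (ennreal (f t) * indicator {0<..} t) + ennreal CS * (ennreal (h t) * indicator {0<..} t) \<partial>lborel)"
      unfolding green_function_def
    proof (rule nn_integral_mono)
      fix t :: real
      show "ennreal (p t x y) * indicator {0<..} t \<le> ennreal (CS * q) * (ennreal (f t) * indicator {0<..} t) + ennreal CS * (ennreal (h t) * indicator {0<..} t)"
      proof (cases "0 < t")
        case True
        have "p t x y \<le> CS * (q * f t + h t)"
          using S(3)[OF True, of x y] gauss_eq[OF True, of x y "k * M x y"]
          by (simp add: q_def f_def h_def a_def s_def)
        then have "ennreal (p t x y) \<le> ennreal (CS * q * f t + CS * h t)" by (intro ennreal_leI) (simp add: distrib_left mult.assoc)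
        also have "\<dots> = ennreal (CS * q) * ennreal (f t) + ennreal CS * ennreal (h t)"
          using S q f0 h0 by (simp add: ennreal_mult[symmetric])
        finally show ?thesis using True by simp
      qed simp
    qed
    also have "\<dots> = ennreal (CS * q) * (\<integral>\<^sup>+t\<in>{0<..}. ennreal (f t) \<partial>lborel) + ennreal CS * (\<integral>\<^sup>+t\<in>{0<..}. ennreal (h t) \<partial>lborel)"
      by (subst nn_integral_add, measurable, subst nn_integral_cmult, measurable, subst nn_integral_cmult, measurable)
    also have "\<dots> \<le> ennreal (CS * q) * ennreal (CI * bound c x y) + ennreal CS * ennreal (9 * (CE * bound c x y))"
    proof (intro add_mono mult_left_mono)
      have "(\<integral>\<^sup>+t\<in>{0<..}. ennreal (f t) \<partial>lborel) \<le> ennreal (CI * bound ci x y)"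
        unfolding f_def by (rule I(3)[OF xy])
      also have "\<dots> \<le> ennreal (CI * bound c x y)"
        using I c by (intro ennreal_leI mult_left_mono bound_antimono) auto
      finally show "(\<integral>\<^sup>+t\<in>{0<..}. ennreal (f t) \<partial>lborel) \<le> ennreal (CI * bound c x y)" .
      have "(\<integral>\<^sup>+t\<in>{0<..}. ennreal (h t) \<partial>lborel) \<le> ennreal (9 * a powr (1 / 4))"
        unfolding h_def by (rule set_nn_integral_min_powr_le[OF a(1,2)])
      also have "a powr (1 / 4) \<le> CE * bound ce x y" using E(3)[OF xy] by (simp add: a(3) s_def)
      also have "CE * bound ce x y \<le> CE * bound c x y" using E c by (intro mult_left_mono bound_antimono) auto
      finally show "(\<integral>\<^sup>+t\<in>{0<..}. ennreal (h t) \<partial>lborel) \<le> ennreal (9 * (CE * bound c x y))"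
        by (simp add: ennreal_leI)
    qed auto
    also have "\<dots> = ennreal (C * bound c x y)"
      using S q I E bound_nonneg[of c x y]
      by (simp add: C_def ennreal_mult[symmetric] ennreal_plus[symmetric] distrib_right mult.assoc del: ennreal_plus)
    finally show ?thesis .
  qed
  with C c(1) show thesis using that by blast
qed

lemma green_ge_time_integral:
  obtains C where "0 < C"
    "\<And>x y. ennreal ((2 * pi) powr (- (real DIM('a) / 2))) *
      (\<integral>\<^sup>+t\<in>{0<..4 * (R x y)\<^sup>2}. ennreal (t powr (- (real DIM('a) / 2)) * exp (- (norm (x - y))\<^sup>2 / (2 * t) - C * M x y * t)) \<partial>lborel)
      \<le> green_function p x y"
proof -
  obtain C where C: "0 < C"
    "\<And>t x y. 0 < t \<Longrightarrow> t \<le> 4 * (R x y)\<^sup>2 \<Longrightarrow> exp (- (C * M x y * t)) * gauss t x y \<le> p t x y"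
    using p_lower by blast
  define q where "q = (2 * pi) powr (- (real DIM('a) / 2))"
  have "ennreal q * (\<integral>\<^sup>+t\<in>{0<..4 * (R x y)\<^sup>2}. ennreal (t powr (- (real DIM('a) / 2)) * exp (- (norm (x - y))\<^sup>2 / (2 * t) - C * M x y * t)) \<partial>lborel)
      \<le> green_function p x y" for x y
  proof -
    define f where "f t = t powr (- (real DIM('a) / 2)) * exp (- (norm (x - y))\<^sup>2 / (2 * t) - C * M x y * t)" for t
    have [measurable]: "f \<in> borel_measurable borel" unfolding f_def[abs_def] by measurable
    have "ennreal q * (\<integral>\<^sup>+t\<in>{0<..4 * (R x y)\<^sup>2}. ennreal (f t) \<partial>lborel) =
      (\<integral>\<^sup>+t. ennreal q * (ennreal (f t) * indicator {0<..4 * (R x y)\<^sup>2} t) \<partial>lborel)"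
      by (rule nn_integral_cmult[symmetric]) measurable
    also have "\<dots> \<le> green_function p x y"
      unfolding green_function_def
    proof (rule nn_integral_mono)
      fix t :: real
      show "ennreal q * (ennreal (f t) * indicator {0<..4 * (R x y)\<^sup>2} t) \<le> ennreal (p t x y) * indicator {0<..} t"
      proof (cases "0 < t \<and> t \<le> 4 * (R x y)\<^sup>2")
        case True
        have "q * f t \<le> p t x y"
          using C(2)[of t x y] True gauss_eq[of t x y "C * M x y"] by (simp add: q_def f_def mult.commute)
        then have "ennreal q * ennreal (f t) \<le> ennreal (p t x y)"
          by (subst ennreal_mult[symmetric]) (auto simp: q_def f_def intro: ennreal_leI)
        then show ?thesis using True by simp
      qed (auto simp: indicator_def)
    qed
    finally show ?thesis by (simp add: f_def)
  qed
  then show thesis using that[OF C(1)] by (simp add: q_def)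
qed

lemma green_lower:
  obtains C c where "0 < C" "0 < c"
    "\<And>x y. x \<noteq> y \<or> DIM('a) = 1 \<Longrightarrow> ennreal (C * bound c x y) \<le> green_function p x y"
    "\<And>x. 2 \<le> DIM('a) \<Longrightarrow> green_function p x x = \<infinity>"
proof -
  define q where "q = (2 * pi) powr (- (real DIM('a) / 2))"
  have q: "0 < q" by (simp add: q_def)
  obtain k where k: "0 < k" and low: "\<And>x y. ennreal q *
      (\<integral>\<^sup>+t\<in>{0<..4 * (R x y)\<^sup>2}. ennreal (t powr (- (real DIM('a) / 2)) * exp (- (norm (x - y))\<^sup>2 / (2 * t) - k * M x y * t)) \<partial>lborel)
      \<le> green_function p x y"
    using green_ge_time_integral unfolding q_def by blast
  define b where "b = 2 powr (- (real DIM('a) / 2)) * exp (- 1 / 2 - 2 * k)"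
  define c where "c = 1 / 2 + 2 * k"
  \<comment> \<open>By M >= 1, R >= 1 and |x-y| <= 2 R, the windows of the time integrals fit below
    4 R^2.\<close>
  have T: "2 / M x y \<le> 4 * (R x y)\<^sup>2" "2 * (norm (x - y) / sqrt (M x y)) \<le> 4 * (R x y)\<^sup>2" for x y
  proof -
    have RR: "R x y \<le> (R x y)\<^sup>2" using R(1)[of x y] by (simp add: power2_eq_square mult_le_cancel_left1)
    have "2 / M x y \<le> 2 / 1" using M_ge_1[of x y] by (intro divide_left_mono) auto
    then show "2 / M x y \<le> 4 * (R x y)\<^sup>2" using RR R(1)[of x y] by linarith
    have "norm (x - y) / sqrt (M x y) \<le> norm (x - y) / 1" using M_ge_1[of x y] by (intro divide_left_mono) auto
    then show "2 * (norm (x - y) / sqrt (M x y)) \<le> 4 * (R x y)\<^sup>2" using RR norm_diff_le_R[of x y] by linarith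
  qed
  have main: "ennreal (b * bound c x y) \<le>
     (\<integral>\<^sup>+t\<in>{0<..4 * (R x y)\<^sup>2}. ennreal (t powr (- (real DIM('a) / 2)) * exp (- (norm (x - y))\<^sup>2 / (2 * t) - k * M x y * t)) \<partial>lborel)"
    if xy: "x \<noteq> y \<or> DIM('a) = 1" for x y
  proof -
    consider "DIM('a) \<ge> 3" | "DIM('a) = 2" | "DIM('a) = 1"
      using DIM_positive[where 'a='a] by linarith
    then show ?thesis
    proof cases
      case 1
      have "b * bound c x y = 2 powr (- (real DIM('a) / 2)) * exp (- 1 / 2 - 2 * k) *
         (norm (x - y) powr (2 - real DIM('a)) * exp (- (1 / 2 + 2 * k) * (norm (x - y) * sqrt (M x y))))"
        unfolding c_def[symmetric] using 1 by (simp add: b_def bound_def Let_def mult_ac)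
      then show ?thesis
        using heat_time_integral_lower_ge2[of "norm (x - y)" k "M x y" "4 * (R x y)\<^sup>2" "DIM('a)"] 1 xy k M_pos[of x y] T[of x y]
        by (simp only:) auto
    next
      case 2
      then have D: "real DIM('a) / 2 = 1" by simp
      have "b * bound c x y = 1 / 2 * exp (- 1 / 2 - 2 * k) *
        (exp (- (1 / 2 + 2 * k) * (norm (x - y) * sqrt (M x y))) * max (ln (1 / (norm (x - y) * sqrt (M x y)))) 1)"
        unfolding c_def[symmetric] using 2 by (simp add: b_def bound_def Let_def powr_minus_divide)
      then show ?thesis
        unfolding D
        using heat_time_integral_lower_2[of "norm (x - y)" k "M x y" "4 * (R x y)\<^sup>2"] 2 xy k M_pos[of x y] T[of x y]
        by (simp only:) auto
    next
      case 3
      then have D: "real DIM('a) / 2 = 1 / 2" by simp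
      have "b * bound c x y = 2 powr (- (1 / 2)) * exp (- 1 / 2 - 2 * k) *
        (1 / sqrt (M x y) * exp (- (1 / 2 + 2 * k) * (norm (x - y) * sqrt (M x y))))"
        unfolding c_def[symmetric] using 3 by (simp add: b_def bound_def Let_def)
      then show ?thesis
        unfolding D
        using heat_time_integral_lower_1[of "norm (x - y)" k "M x y" "4 * (R x y)\<^sup>2"] k M_pos[of x y] T[of x y]
        by (simp only:) auto
    qed
  qed
  show thesis
  proof (rule that[of "q * b" c])
    show "0 < q * b" "0 < c" using q k by (auto simp: b_def c_def)
    show "ennreal (q * b * bound c x y) \<le> green_function p x y" if "x \<noteq> y \<or> DIM('a) = 1" for x y
    proof -
      have "ennreal (q * b * bound c x y) = ennreal q * ennreal (b * bound c x y)"
        using q by (simp add: ennreal_mult'[symmetric] mult.assoc)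
      also have "\<dots> \<le> green_function p x y"
        by (rule order_trans[OF mult_left_mono[OF main[OF that]] low]) simp
      finally show ?thesis .
    qed
    show "green_function p x x = \<infinity>" if d: "2 \<le> DIM('a)" for x
    proof -
      \<comment> \<open>On the diagonal the Gaussian factor is 1, so the singularity t^(-d/2) at 0
        is not damped.\<close>
      have "(\<integral>\<^sup>+t\<in>{0<..4 * (R x x)\<^sup>2}. ennreal (t powr (- (real DIM('a) / 2)) * exp (- (k * M x x) * t)) \<partial>lborel) = \<infinity>"
        using d k M_pos[of x x] R(1)[of x x] by (intro heat_time_integral_diverges) auto
      then have "ennreal q * \<infinity> \<le> green_function p x x" using low[of x x] by simp
      then show ?thesis using q by (simp add: ennreal_mult_top top_unique)
    qed
  qed
qed

lemma green_estimate:
  "\<exists>c1>0. \<exists>c2>0. \<exists>c3>0. \<exists>c4>0. \<forall>x y.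
     ennreal c1 * green_bound g c2 x y \<le> green_function p x y \<and>
     green_function p x y \<le> ennreal c3 * green_bound g c4 x y"
proof -
  obtain c1 c2 where l: "0 < c1" "0 < c2"
    "\<And>x y. x \<noteq> y \<or> DIM('a) = 1 \<Longrightarrow> ennreal (c1 * bound c2 x y) \<le> green_function p x y"
    "\<And>x. 2 \<le> DIM('a) \<Longrightarrow> green_function p x x = \<infinity>"
    using green_lower by blast
  obtain c3 c4 where u: "0 < c3" "0 < c4"
    "\<And>x y. x \<noteq> y \<or> DIM('a) = 1 \<Longrightarrow> green_function p x y \<le> ennreal (c3 * bound c4 x y)"
    using green_upper by blast
  have "ennreal c1 * green_bound g c2 x y \<le> green_function p x y \<and>
     green_function p x y \<le> ennreal c3 * green_bound g c4 x y" for x y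
  proof (cases "x \<noteq> y \<or> DIM('a) = 1")
    case True
    then show ?thesis
      using l(1,3) u(1,3) by (simp add: green_bound_eq ennreal_mult'[symmetric])
  next
    case False
    then have "x = y" "DIM('a) \<noteq> 1" by auto
    moreover from this have "2 \<le> DIM('a)" using DIM_positive[where 'a='a] by linarith
    ultimately have "x = y" "2 \<le> DIM('a)" by auto
    \<comment> \<open>On the diagonal with d >= 2, both the Green's function and the bounds are
      infinite.\<close>
    then show ?thesis using l(4)[of x] u(1) by (simp add: green_bound_def ennreal_mult_top)
  qed
  then show ?thesis using l(1,2) u(1,2) by blast
qed

end

theorem proposition1p3:
  fixes P :: "'a::euclidean_space \<Rightarrow> 'w measure"
    and B :: "real \<Rightarrow> 'w \<Rightarrow> 'a"
    and V :: "'a \<Rightarrow> real"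
    and g :: "real \<Rightarrow> real"
    and C\<^sub>1 C\<^sub>2 :: real
    and p :: "real \<Rightarrow> 'a \<Rightarrow> 'a \<Rightarrow> real"
  assumes "brownian_family P B"
    and "\<And>x. 0 \<le> V x"
    and "V \<in> borel_measurable borel"
    and "locally_bounded V"
    and "0 < C\<^sub>1" and "0 < C\<^sub>2"
    and "g \<in> growth_class"
    and "\<And>x. 1 < norm x \<Longrightarrow> C\<^sub>1 * g (norm x) \<le> V x \<and> V x \<le> C\<^sub>2 * g (norm x)"
    and "is_heat_kernel (schrodinger_semigroup P B V) p"
  shows "\<exists>c\<^sub>1>0. \<exists>c\<^sub>2>0. \<exists>c\<^sub>3>0. \<exists>c\<^sub>4>0. \<forall>x y.
           ennreal c\<^sub>1 * green_bound g c\<^sub>2 x y \<le> green_function p x y \<and>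
           green_function p x y \<le> ennreal c\<^sub>3 * green_bound g c\<^sub>4 x y"
proof -
  interpret schrodinger_setting P B V g C\<^sub>1 C\<^sub>2 p
    by (rule schrodinger_setting.intro) (fact assms)+
  show ?thesis by (rule green_estimate)
qed

end
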